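(* Suppose that $\phi$ is a polynomial in one variable with integer coefficients of degree $k\ge 3$. For all $\epsilon>0$ there exists a constant $C_\epsilon>0$ (which may also depend on $\phi$) such that, for all $N\in\mathbb{N}$ and all sequences $a\in\ell^2(\mathbb{Z})$, \[ \|Ea\|_{L^4(\mathbb{T})}^4\le C_\epsilon N^{\epsilon}\|a\|_{\ell^2(\mathbb{Z})}^4 \] and \[ \|Ea\|_{L^8(\mathbb{T})}^8\le C_\epsilon N^{1+\epsilon}\|a\|_{\ell^2(\mathbb{Z})}^8 . \] Moreover, when $k=3$ and $p>8$, there exists a constant $C_p>0$ (which may also depend on $\phi$) such that, for all $N\in\mathbb{N}$ and all sequences $a\in\ell^2(\mathbb{Z})$, \[ \|Ea\|_{L^p(\mathbb{T})}\le C_p N^{\frac12-\frac3p}\|a\|_{\ell^2(\mathbb{Z})}. \]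
   Context: Write $e(t)=e^{2\pi i t}$, $\mathbb{T}=\mathbb{R}/\mathbb{Z}$, and $\mathbb{N}=\{1,2,3,\dots\}$. For $N\in\mathbb{N}$, a polynomial $\phi$ with integer coefficients, and a complex sequence $a=(a(n))_{n\in\mathbb{Z}}$, the extension operator $E$ (depending on $N$ and $\phi$) is defined by \[ Ea(\alpha)=\sum_{|n|\le N}a(n)\,e(\alpha\phi(n))\qquad(\alpha\in\mathbb{T}), \] where $n$ runs over integers. The $L^p(\mathbb{T})$ norms are with respect to Lebesgue (Haar probability) measure on $\mathbb{T}$. *)

theory Defs
  imports "HOL-Analysis.Analysis" "HOL-Computational_Algebra.Polynomial"
begin

definition e_char :: "real \<Rightarrow> complex" where
  "e_char t = exp (2 * of_real pi * \<i> * of_real t)"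

text \<open>
  A function on the circle $\mathbb{R}/\mathbb{Z}$ is represented by a function on the reals of
  period 1 (see \<open>extension_op_periodic\<close> below).
\<close>

definition extension_op :: "nat \<Rightarrow> int poly \<Rightarrow> (int \<Rightarrow> complex) \<Rightarrow> real \<Rightarrow> complex" where
  "extension_op N \<phi> a \<alpha> =
     (\<Sum>n \<in> {- int N..int N}. a n * e_char (\<alpha> * of_int (poly \<phi> n)))"

text \<open>
  The $L^p$ norm on the circle for finite exponents: Haar probability measure is Lebesgue measure
  on the fundamental domain $[0,1)$. It is only meaningful if \<open>\<lambda>\<alpha>. cmod (f \<alpha>) powr p\<close> is integrable
  there, since the Bochner integral of a non-integrable function is 0; extension operators satisfy
  this by \<open>extension_op_Lp\<close>.
\<close>

definition Lp_norm_circle :: "real \<Rightarrow> (real \<Rightarrow> complex) \<Rightarrow> real" where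
  "Lp_norm_circle p f = (LINT \<alpha>:{0..<1}|lborel. cmod (f \<alpha>) powr p) powr (1 / p)"

definition ell2 :: "(int \<Rightarrow> complex) set" where
  "ell2 = {a. (\<lambda>n. (cmod (a n))\<^sup>2) summable_on UNIV}"

definition ell2_norm :: "(int \<Rightarrow> complex) \<Rightarrow> real" where
  "ell2_norm a = sqrt (\<Sum>\<^sub>\<infinity>n. (cmod (a n))\<^sup>2)"

lemma extension_op_periodic: "extension_op N \<phi> a (\<alpha> + 1) = extension_op N \<phi> a \<alpha>"
proof -
  have "e_char ((\<alpha> + 1) * of_int m) = e_char (\<alpha> * of_int m)" for m
  proof -
    have "e_char ((\<alpha> + 1) * of_int m)
        = e_char (\<alpha> * of_int m) * exp (2 * of_real pi * \<i> * of_int m)"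
      by (simp add: e_char_def algebra_simps exp_add)
    also have "exp (2 * of_real pi * \<i> * of_int m) = (1::complex)"
      by (subst exp_eq_1) (auto intro!: exI[of _ m])
    finally show ?thesis by simp
  qed
  then show ?thesis by (simp add: extension_op_def)
qed

lemma extension_op_Lp:
  assumes "p > 0"
  shows "set_integrable lborel {0..<1} (\<lambda>\<alpha>. cmod (extension_op N \<phi> a \<alpha>) powr p)"
proof -
  have "continuous_on {0..1} (\<lambda>\<alpha>. cmod (extension_op N \<phi> a \<alpha>) powr p)"
    unfolding extension_op_def e_char_def using assms
    by (intro continuous_on_powr' continuous_intros) auto
  then have "set_integrable lborel {0..1} (\<lambda>\<alpha>. cmod (extension_op N \<phi> a \<alpha>) powr p)"
    by (intro borel_integrable_atLeastAtMost')
  then show ?thesis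
    by (rule set_integrable_subset) auto
qed

end

theory Submission
  imports Defs "HOL-Computational_Algebra.Primes"
begin

text \<open>
Why the theorem is true.  Expanding \<open>cmod (Ea x) ^ 2\<close> into a sum over pairs \<open>(m, n)\<close> of
frequencies \<open>\<phi> m - \<phi> n\<close> turns even moments into counting problems.

For the fourth moment, \<open>m - n\<close> divides \<open>\<phi> m - \<phi> n\<close>, so the divisor bound shows that a nonzero
value of the difference is attained by \<open>O(N powr \<epsilon>)\<close> pairs (\<open>card_difference_fiber\<close>); the value
zero leaves boundedly many partners for each \<open>n\<close>.  Parseval then gives \<open>L4_estimate\<close>.

For the eighth moment, suppose first that \<open>a\<close> is the indicator function of a set \<open>S\<close>, with
extension \<open>F\<close>.  Weyl differencing twice bounds \<open>cmod (F x) ^ 4\<close> by \<open>2 * card S ^ 2\<close> plus \<open>8 * N\<close>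
times a sum of characters whose frequencies are second differences of \<open>\<phi>\<close>
(\<open>hua_pointwise\<close>).  Such a second difference with steps \<open>h, l\<close> is divisible by \<open>h\<close> and by \<open>l\<close>, so
it takes each nonzero value \<open>O(N powr \<epsilon>)\<close> times and the value zero \<open>O(card S ^ 2)\<close> times;
multiplying by another factor \<open>cmod (F x) ^ 4\<close> and integrating gives \<open>L8_characteristic\<close>.  With
general weights the same argument would lose a power of \<open>N\<close>.  It is therefore applied to the level
sets of \<open>cmod (a n)\<close>, chosen with ratio \<open>N powr \<delta>\<close> instead of 2: then the number of levels depends
only on \<open>\<delta>\<close>, and on each level \<open>a\<close> is dominated by a multiple of an indicator function without much
loss (\<open>L8_estimate\<close>).

For cubic \<open>\<phi>\<close> and \<open>p > 8\<close> the factor \<open>N powr \<epsilon>\<close> has to disappear.  Write \<open>A\<close> for the \<open>\<ell>\<^sup>2\<close> norm of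
\<open>a\<close> on the window, \<open>E\<close> for the set where \<open>cmod (Ea x)\<close> exceeds \<open>A * sqrt N / D\<close> and \<open>\<mu>\<close> for its measure.
Duality bounds \<open>\<mu>\<^sup>2 * N / D\<^sup>2\<close> by the integral of \<open>cmod (K (x - y))\<close> over \<open>E \<times> E\<close>, where \<open>K\<close>
is the Weyl sum of \<open>\<phi>\<close> (\<open>level_set_duality\<close>).  Either \<open>K\<close> is at most
\<open>C * N powr (31/32)\<close>, or its argument is close to a fraction \<open>a/q\<close> and \<open>K\<close> is at most
\<open>C * N * (q * (1 + N ^ 3 * dist)) powr - \<kappa>\<close> with \<open>\<kappa>\<close> as close to \<open>1/4\<close> as desired
(\<open>weyl_sum_dichotomy\<close>).  No power \<open>N powr \<epsilon>\<close> is lost in the second case: the complete sum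
modulo \<open>q\<close> is estimated by the Weyl inequality at length \<open>q ^ 2\<close>, and the remaining oscillatory
integral by the third derivative test.  The large values of \<open>K\<close> are then majorised by a sum of
squared Dirichlet kernels, whose \<open>l\<close>-th Fourier coefficient is about \<open>N powr - 3\<close> times the number of
divisors of \<open>l\<close> below some \<open>X\<close> which is a fixed power of \<open>D\<close>.  The truncated divisor function has
all its moments bounded by \<open>X powr \<tau>\<close> (\<open>divisors_upto_moment\<close>), so it acts like a constant, and
the Bessel inequality yields \<open>\<mu> \<le> C * D powr p' / N ^ 3\<close> for any \<open>p' > 8\<close> as long as \<open>D\<close> is at most
a small power of \<open>N\<close> (\<open>level_set_bound\<close>).  The limit 8 is \<open>2 / \<kappa>\<close> for \<open>\<kappa> = 1/4\<close>.  These levels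
sum up geometrically when \<open>p > p'\<close>, and below them \<open>cmod (Ea x) powr p\<close> is at most
\<open>cmod (Ea x) ^ 8\<close> times a factor that saves the power of \<open>N\<close> lost in the eighth moment
(\<open>Lp_estimate_cubic\<close>).
\<close>

section \<open>Trigonometric sums on the circle\<close>

lemma e_char_add: "e_char (x + y) = e_char x * e_char y"
  by (simp add: e_char_def algebra_simps exp_add)

lemma e_char_0 [simp]: "e_char 0 = 1"
  by (simp add: e_char_def)

lemma e_char_cis: "e_char t = cis (2 * pi * t)"
  by (simp add: e_char_def cis_conv_exp mult_ac)

lemma norm_e_char [simp]: "cmod (e_char t) = 1"
  by (simp add: e_char_cis)

lemma cnj_e_char: "cnj (e_char t) = e_char (- t)"
  by (simp add: e_char_cis cis_cnj)

lemma e_char_of_int [simp]: "e_char (of_int m) = 1"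
  by (simp add: e_char_cis)

lemma e_char_diff: "e_char (x - y) = e_char x * cnj (e_char y)"
  using e_char_add[of x "- y"] by (simp add: cnj_e_char)

lemma continuous_on_e_char [continuous_intros]:
  "continuous_on S f \<Longrightarrow> continuous_on S (\<lambda>x. e_char (f x))"
  unfolding e_char_def by (intro continuous_intros)

lemma measurable_e_char [measurable]: "e_char \<in> borel_measurable borel"
  by (intro borel_measurable_continuous_onI continuous_intros)

text \<open>
Restricting Lebesgue measure to a fundamental domain keeps functions on the circle as functions of
a real variable while making constants integrable.
\<close>

definition circle :: "real measure" where
  "circle = restrict_space lborel {0..<1}"

lemma space_circle [simp]: "space circle = {0..<1}"
  by (simp add: circle_def space_restrict_space)

lemma measurable_circle_ident [measurable]: "(\<lambda>x. x) \<in> borel_measurable circle"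
  unfolding circle_def by (rule measurable_restrict_space1) simp

lemma measurable_circleI:
  "f \<in> borel_measurable borel \<Longrightarrow> f \<in> borel_measurable circle"
  unfolding circle_def by (rule measurable_restrict_space1) simp

lemma emeasure_circle_space: "emeasure circle {0..<1} = 1"
  by (simp add: circle_def emeasure_restrict_space)

lemma finite_measure_circle: "finite_measure circle"
  by (rule finite_measureI) (simp add: emeasure_circle_space)

interpretation circle: finite_measure circle
  by (rule finite_measure_circle)

lemma measure_circle_space [simp]: "measure circle {0..<1} = 1"
  by (simp add: measure_def emeasure_circle_space)

lemma integrable_circle_bounded:
  fixes f :: "real \<Rightarrow> 'a::{banach, second_countable_topology}"
  assumes "f \<in> borel_measurable circle" "\<And>x. norm (f x) \<le> B"
  shows "integrable circle f"
  using assms by (intro circle.integrable_const_bound[of _ B]) auto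

lemma Lp_norm_circle_eq:
  "Lp_norm_circle p f = (\<integral>x. cmod (f x) powr p \<partial>circle) powr (1 / p)"
  unfolding Lp_norm_circle_def circle_def set_lebesgue_integral_def
  by (subst integral_restrict_space) auto

lemma integral_e_char:
  "(\<integral>x. e_char (x * of_int m) \<partial>circle) = (if m = 0 then 1 else 0)"
proof (cases "m = 0")
  case True
  then show ?thesis by simp
next
  case False
  define w where "w = 2 * of_real pi * \<i> * complex_of_int m"
  have w: "w \<noteq> 0" using False by (simp add: w_def)
  have e: "e_char (x * of_int m) = exp (w * of_real x)" for x
    by (simp add: e_char_def w_def mult_ac)
  have "((\<lambda>z. exp (w * z) / w) has_field_derivative exp (w * z)) (at z)" for z
    using w by (auto intro!: derivative_eq_intros)
  then have D: "((\<lambda>x. exp (w * of_real x) / w) has_vector_derivative exp (w * of_real x)) (at x within A)" for x A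
    by (rule has_vector_derivative_real_field)
  have "(\<integral>x. e_char (x * of_int m) \<partial>circle)
      = (LBINT x:{0..<1}. exp (w * of_real x))"
    unfolding circle_def set_lebesgue_integral_def e by (subst integral_restrict_space) auto
  also have "\<dots> = (LBINT x:{0..1}. exp (w * of_real x))"
  proof (rule set_integral_cong_set)
    show "AE x in lborel. (x \<in> {0..1}) = (x \<in> {0..<1::real})"
      using AE_lborel_singleton[of "1::real"] by eventually_elim auto
  qed (auto simp: set_borel_measurable_def)
  also have "\<dots> = exp (w * of_real 1) / w - exp (w * of_real 0) / w"
    unfolding set_lebesgue_integral_def
  proof (rule integral_FTC_Icc)
    show "continuous_on {0..1} (\<lambda>x. exp (w * complex_of_real x))"
      by (intro continuous_intros)
  qed (use D in auto)
  also have "exp (w * of_real 1) = 1" using e[of 1] by simp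
  finally show ?thesis using False by simp
qed

text \<open>
The index set is arbitrary, and several indices may share a frequency: products of such sums
are again of this form, with product index sets, and no frequencies have to be collected.
\<close>

definition trig_sum :: "'i set \<Rightarrow> ('i \<Rightarrow> complex) \<Rightarrow> ('i \<Rightarrow> int) \<Rightarrow> real \<Rightarrow> complex" where
  "trig_sum I c f x = (\<Sum>i\<in>I. c i * e_char (x * of_int (f i)))"

lemma extension_op_eq_trig_sum: "extension_op N \<phi> a = trig_sum {- int N..int N} a (poly \<phi>)"
  by (simp add: fun_eq_iff extension_op_def trig_sum_def)

lemma measurable_trig_sum [measurable]: "trig_sum I c f \<in> borel_measurable borel"
  unfolding trig_sum_def by measurable

lemma norm_trig_sum_le: "cmod (trig_sum I c f x) \<le> (\<Sum>i\<in>I. cmod (c i))"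
  unfolding trig_sum_def by (rule sum_norm_le) (simp add: norm_mult)

lemma trig_sum_mult_cnj:
  "trig_sum I c f x * cnj (trig_sum J d g x)
     = trig_sum (I \<times> J) (\<lambda>(i, j). c i * cnj (d j)) (\<lambda>(i, j). f i - g j) x"
  unfolding trig_sum_def
  by (simp add: cnj_sum sum_product sum.cartesian_product case_prod_unfold right_diff_distrib
      e_char_diff mult_ac)

lemma trig_sum_mult:
  "trig_sum I c f x * trig_sum J d g x
     = trig_sum (I \<times> J) (\<lambda>(i, j). c i * d j) (\<lambda>(i, j). f i + g j) x"
  unfolding trig_sum_def
  by (simp add: sum_product sum.cartesian_product case_prod_unfold distrib_left
      e_char_add mult_ac)

lemma integral_trig_sum:
  assumes "finite I"
  shows "(\<integral>x. trig_sum I c f x \<partial>circle) = (\<Sum>i\<in>{i\<in>I. f i = 0}. c i)"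
proof -
  have "(\<integral>x. trig_sum I c f x \<partial>circle) = (\<Sum>i\<in>I. \<integral>x. c i * e_char (x * of_int (f i)) \<partial>circle)"
    unfolding trig_sum_def
    by (rule Bochner_Integration.integral_sum)
       (rule integrable_circle_bounded[where B="cmod (c i)" for i], auto simp: norm_mult)
  also have "\<dots> = (\<Sum>i\<in>I. if f i = 0 then c i else 0)"
    by (rule sum.cong) (auto simp: integral_e_char)
  also have "\<dots> = (\<Sum>i\<in>{i\<in>I. f i = 0}. c i)"
    using assms by (simp add: sum.inter_filter)
  finally show ?thesis .
qed

lemma cmod_square_cnj: "complex_of_real ((cmod z)\<^sup>2) = z * cnj z"
  by (simp add: complex_mult_cnj cmod_power2)

lemma integrable_trig_sum_power:
  "integrable circle (\<lambda>x. cmod (trig_sum I c f x) ^ k)"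
  by (rule integrable_circle_bounded[where B="(\<Sum>i\<in>I. cmod (c i)) ^ k"])
     (auto simp: norm_power norm_mult intro!: power_mono norm_trig_sum_le)

lemma integral_trig_sum_norm2:
  assumes "finite I"
  shows "complex_of_real (\<integral>x. (cmod (trig_sum I c f x))\<^sup>2 \<partial>circle)
     = (\<Sum>(i, j)\<in>{(i, j)\<in>I \<times> I. f i = f j}. c i * cnj (c j))"
proof -
  have "complex_of_real (\<integral>x. (cmod (trig_sum I c f x))\<^sup>2 \<partial>circle)
     = (\<integral>x. complex_of_real ((cmod (trig_sum I c f x))\<^sup>2) \<partial>circle)"
    by (rule integral_complex_of_real[symmetric])
  also have "\<dots> = (\<integral>x. trig_sum (I \<times> I) (\<lambda>(i, j). c i * cnj (c j)) (\<lambda>(i, j). f i - f j) x \<partial>circle)"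
    by (simp only: cmod_square_cnj trig_sum_mult_cnj)
  also have "\<dots> = (\<Sum>(i, j)\<in>{(i, j)\<in>I \<times> I. f i = f j}. c i * cnj (c j))"
    using assms by (subst integral_trig_sum) (auto intro!: sum.cong)
  finally show ?thesis .
qed

text \<open>
Collecting the indices of equal frequency leaves an orthogonal system; this is the step that
turns moments into the counting of coincidences among frequencies.
\<close>

lemma parseval_trig_sum:
  assumes "finite I"
  shows "(\<integral>x. (cmod (trig_sum I c f x))\<^sup>2 \<partial>circle)
     = (\<Sum>m\<in>f ` I. (cmod (\<Sum>i\<in>{i\<in>I. f i = m}. c i))\<^sup>2)"
proof -
  let ?A = "\<lambda>m. {i\<in>I. f i = m}"
  have "complex_of_real (\<Sum>m\<in>f ` I. (cmod (\<Sum>i\<in>?A m. c i))\<^sup>2)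
      = (\<Sum>m\<in>f ` I. (\<Sum>(i, j)\<in>?A m \<times> ?A m. c i * cnj (c j)))"
    by (simp add: cmod_square_cnj of_real_sum cnj_sum sum_product sum.cartesian_product del: of_real_power)
  also have "\<dots> = (\<Sum>m\<in>f ` I. (\<Sum>p\<in>{p \<in> {(i, j)\<in>I \<times> I. f i = f j}. f (fst p) = m}.
        c (fst p) * cnj (c (snd p))))"
    by (intro sum.cong) (auto simp: case_prod_unfold)
  also have "\<dots> = (\<Sum>p\<in>{(i, j)\<in>I \<times> I. f i = f j}. c (fst p) * cnj (c (snd p)))"
    using assms by (intro sum.group) (auto intro: finite_subset[of _ "I \<times> I"])
  also have "\<dots> = complex_of_real (\<integral>x. (cmod (trig_sum I c f x))\<^sup>2 \<partial>circle)"
    by (simp add: integral_trig_sum_norm2 assms case_prod_unfold)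
  finally show ?thesis
    by (simp only: of_real_eq_iff)
qed

text \<open>
After Parseval only sums of coefficients over equal frequencies remain, and these can only grow
when the coefficients are replaced by upper bounds of their absolute values.
\<close>

lemma trig_sum_majorant:
  assumes "finite I" "\<And>i. i \<in> I \<Longrightarrow> cmod (c i) \<le> C i"
  shows "(\<integral>x. (cmod (trig_sum I c f x))\<^sup>2 \<partial>circle)
    \<le> (\<integral>x. (cmod (trig_sum I (\<lambda>i. of_real (C i)) f x))\<^sup>2 \<partial>circle)"
  unfolding parseval_trig_sum[OF assms(1)]
proof (intro sum_mono power_mono)
  fix m
  have "cmod (\<Sum>i\<in>{i \<in> I. f i = m}. c i) \<le> (\<Sum>i\<in>{i \<in> I. f i = m}. C i)"
    using assms by (intro sum_norm_le) auto
  also have "\<dots> \<le> cmod (\<Sum>i\<in>{i \<in> I. f i = m}. of_real (C i))"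
    by (metis abs_ge_self norm_of_real of_real_sum)
  finally show "cmod (\<Sum>i\<in>{i \<in> I. f i = m}. c i) \<le> cmod (\<Sum>i\<in>{i \<in> I. f i = m}. complex_of_real (C i))" .
qed simp_all

section \<open>The divisor bound\<close>

lemma card_divisors_prime_power_mult:
  fixes p m :: nat
  assumes "prime p" "m > 0"
  shows "card {d. d dvd p ^ a * m} \<le> (a + 1) * card {d. d dvd m}"
proof -
  have "{d. d dvd p ^ a * m} \<subseteq> (\<lambda>(i, d). p ^ i * d) ` ({..a} \<times> {d. d dvd m})"
  proof
    fix d assume "d \<in> {d. d dvd p ^ a * m}"
    then obtain b c where bc: "d = b * c" "b dvd p ^ a" "c dvd m"
      using division_decomp by blast
    then obtain i where "i \<le> a" "b = p ^ i"
      using divides_primepow_nat assms by blast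
    then show "d \<in> (\<lambda>(i, d). p ^ i * d) ` ({..a} \<times> {d. d dvd m})"
      using bc by auto
  qed
  moreover have "finite {d. d dvd m}" using assms by simp
  ultimately have "card {d. d dvd p ^ a * m} \<le> card ({..a} \<times> {d. d dvd m})"
    by (meson card_image_le card_mono finite_SigmaI finite_atMost finite_imageI le_trans)
  then show ?thesis by (simp add: card_cartesian_product)
qed

text \<open>
This is what one small prime may cost in the divisor bound: the number of exponents grows linearly
while the prime power grows exponentially.
\<close>

lemma Suc_le_powr_bound:
  fixes \<epsilon> :: real
  assumes "\<epsilon> > 0"
  obtains K where "K \<ge> 1" "\<And>a::nat. real (a + 1) \<le> K * 2 powr (\<epsilon> * real a)"
proof
  let ?c = "\<epsilon> * ln 2"
  have c: "?c > 0" using assms by simp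
  show "1 + 1 / ?c \<ge> 1" using c by simp
  show "real (a + 1) \<le> (1 + 1 / ?c) * 2 powr (\<epsilon> * real a)" for a
  proof -
    \<comment> \<open>the exponential is at least its linearisation\<close>
    have "1 + ?c * a \<le> 2 powr (\<epsilon> * real a)"
      using exp_ge_add_one_self[of "?c * a"] by (simp add: powr_def mult_ac)
    then have "(1 + 1 / ?c) * (1 + ?c * a) \<le> (1 + 1 / ?c) * 2 powr (\<epsilon> * real a)"
      using c by (intro mult_left_mono) auto
    moreover have "(1 + 1 / ?c) * (1 + ?c * a) = 1 + a + (?c * a + 1 / ?c)"
      using assms by (simp add: field_simps)
    moreover have "?c * a + 1 / ?c \<ge> 0" using c by simp
    ultimately show ?thesis by simp
  qed
qed

text \<open>
A prime factor \<open>p ^ a\<close> multiplies the number of divisors by at most \<open>a + 1\<close>.  If \<open>p powr \<epsilon> \<ge> 2\<close>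
this is at most \<open>(p ^ a) powr \<epsilon>\<close>, hence free; each of the boundedly many smaller primes costs a constant \<open>K\<close>.
\<close>

lemma divisor_bound:
  fixes \<epsilon> :: real
  assumes "\<epsilon> > 0"
  obtains C where "C \<ge> 1" "\<And>n::nat. n > 0 \<Longrightarrow> real (card {d. d dvd n}) \<le> C * real n powr \<epsilon>"
proof -
  obtain K where K: "K \<ge> 1" "\<And>a::nat. real (a + 1) \<le> K * 2 powr (\<epsilon> * real a)"
    using Suc_le_powr_bound[OF assms] by metis
  define P where "P = nat \<lceil>2 powr (1 / \<epsilon>)\<rceil>"
  have P: "2 \<le> real p powr \<epsilon>" if "p \<ge> P" for p
  proof -
    have "2 powr (1 / \<epsilon>) \<le> real p" using that unfolding P_def by linarith
    then have "(2 powr (1 / \<epsilon>)) powr \<epsilon> \<le> real p powr \<epsilon>" using assms by (intro powr_mono2) auto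
    then show ?thesis using assms by (simp add: powr_powr)
  qed
  have main: "real (card {d. d dvd n}) \<le> K ^ card {p \<in> prime_factors n. p < P} * real n powr \<epsilon>"
    if "n > 0" for n :: nat
    using that
  proof (induction n rule: less_induct)
    case (less n)
    show ?case
    proof (cases "n = 1")
      case True
      then show ?thesis by simp
    next
      case False
      then obtain p where p: "prime p" "p dvd n" using prime_factor_nat by blast
      define a where "a = multiplicity p n"
      \<comment> \<open>split off the full power of a prime divisor; the cofactor \<open>m\<close> has the remaining prime factors\<close>
      obtain m where m: "n = p ^ a * m" "\<not> p dvd m"
        using multiplicity_decompose'[of n p] less.prems p unfolding a_def
        by (metis not_prime_unit gr_implies_not0)
      have "a \<ge> 1" using p less.prems prime_multiplicity_gt_zero_iff[of p n] unfolding a_def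
        by (simp add: Suc_le_eq)
      have "m > 0" using m less.prems by (cases m) auto
      have p2: "p \<ge> 2" using p by (simp add: prime_ge_2_nat)
      have "p ^ a > 1" using \<open>a \<ge> 1\<close> p2
        by (metis One_nat_def Suc_le_eq one_less_power less_le_trans one_less_numeral_iff semiring_norm(76))
      then have "m < n" using m(1) \<open>m > 0\<close> by simp
      define k where "k = card {q \<in> prime_factors m. q < P}"
      have IH: "real (card {d. d dvd m}) \<le> K ^ k * real m powr \<epsilon>"
        using less.IH[OF \<open>m < n\<close> \<open>m > 0\<close>] by (simp add: k_def)
      have pf: "prime_factors n = insert p (prime_factors m)" "p \<notin> prime_factors m"
        using m p \<open>m > 0\<close> \<open>a \<ge> 1\<close> p2
        by (auto simp: in_prime_factors_iff prime_dvd_mult_iff prime_dvd_power_iff primes_dvd_imp_eq)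
      have npow: "real n powr \<epsilon> = (real p powr \<epsilon>) ^ a * real m powr \<epsilon>"
        using p2
        by (simp add: m(1) powr_mult powr_powr mult.commute flip: powr_realpow)
      have "real (card {d. d dvd n}) \<le> real (a + 1) * real (card {d. d dvd m})"
        using card_divisors_prime_power_mult[OF p(1) \<open>m > 0\<close>, of a] unfolding m(1)
        by (metis of_nat_le_iff of_nat_mult)
      also have "\<dots> \<le> real (a + 1) * (K ^ k * real m powr \<epsilon>)"
        using IH by (intro mult_left_mono) auto
      also have "\<dots> \<le> K ^ card {p \<in> prime_factors n. p < P} * real n powr \<epsilon>"
      proof (cases "p < P")
        case True
        have "{q \<in> prime_factors n. q < P} = insert p {q \<in> prime_factors m. q < P}"
          using pf True by auto
        then have card: "card {q \<in> prime_factors n. q < P} = Suc k"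
          using pf by (simp add: k_def)
        have "real (a + 1) \<le> K * 2 powr (\<epsilon> * real a)" by (rule K)
        also have "\<dots> \<le> K * (real p powr \<epsilon>) ^ a"
        proof -
          have "2 powr (\<epsilon> * real a) \<le> real p powr (\<epsilon> * real a)"
            using p2 assms by (intro powr_mono2) auto
          then show ?thesis using K(1) p2 by (simp add: powr_powr flip: powr_realpow)
        qed
        finally have "real (a + 1) * (K ^ k * real m powr \<epsilon>)
            \<le> K * (real p powr \<epsilon>) ^ a * (K ^ k * real m powr \<epsilon>)"
          using K(1) by (intro mult_right_mono) auto
        then show ?thesis unfolding card npow by (simp add: mult_ac)
      next
        case False
        have "{q \<in> prime_factors n. q < P} = {q \<in> prime_factors m. q < P}"
          using pf False by auto
        then have card: "card {q \<in> prime_factors n. q < P} = k"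
          by (simp add: k_def)
        have "real (a + 1) \<le> 2 ^ a"
          by (metis Suc_eq_plus1 Suc_leI less_exp of_nat_le_iff of_nat_numeral of_nat_power)
        also have "\<dots> \<le> (real p powr \<epsilon>) ^ a" using P[of p] False by (intro power_mono) auto
        finally have "real (a + 1) * (K ^ k * real m powr \<epsilon>)
            \<le> (real p powr \<epsilon>) ^ a * (K ^ k * real m powr \<epsilon>)"
          using K(1) by (intro mult_right_mono) auto
        then show ?thesis unfolding card npow by (simp add: mult_ac)
      qed
      finally show ?thesis .
    qed
  qed
  show thesis
  proof (rule that[of "K ^ P"])
    show "K ^ P \<ge> 1" using K by simp
    fix n :: nat assume n: "n > 0"
    have "card {p \<in> prime_factors n. p < P} \<le> card {..<P}"
      by (intro card_mono) auto
    then have "K ^ card {p \<in> prime_factors n. p < P} * real n powr \<epsilon> \<le> K ^ P * real n powr \<epsilon>"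
      using K by (intro mult_right_mono power_increasing) auto
    then show "real (card {d. d dvd n}) \<le> K ^ P * real n powr \<epsilon>"
      using main[OF n] by linarith
  qed
qed

section \<open>Differences of integer polynomials\<close>

lemma poly_diff_dvd:
  fixes p :: "int poly"
  shows "x - y dvd poly p x - poly p y"
proof (induction p)
  case 0
  then show ?case by simp
next
  case (pCons a p)
  have "poly (pCons a p) x - poly (pCons a p) y = x * (poly p x - poly p y) + (x - y) * poly p y"
    by (simp add: algebra_simps)
  then show ?case using pCons.IH by (simp add: dvd_add dvd_mult)
qed

definition shift_diff :: "int \<Rightarrow> int poly \<Rightarrow> int poly" where
  "shift_diff h p = pcompose p [:h, 1:] - p"

lemma poly_shift_diff: "poly (shift_diff h p) x = poly p (x + h) - poly p x"
  by (simp add: shift_diff_def poly_pcompose add.commute)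

text \<open>
Only the two leading coefficients of a shifted polynomial are needed: they show that a difference
operator lowers the degree by exactly one.
\<close>

lemma coeff_pcompose_shift:
  fixes p :: "int poly"
  assumes "degree p \<le> Suc n"
  shows "coeff (pcompose p [:c, 1:]) n = coeff p n + of_nat (Suc n) * c * coeff p (Suc n)"
  using assms
proof (induction p arbitrary: n)
  case 0
  then show ?case by simp
next
  case (pCons a p)
  let ?q = "pcompose p [:c, 1:]"
  have dq: "degree ?q = degree p" by (simp add: degree_pcompose)
  show ?case
  proof (cases n)
    case 0
    have "degree p = 0" using pCons 0 by (cases "p = 0") auto
    then obtain b where "p = [:b:]" using degree_eq_zeroE by blast
    then show ?thesis using 0 by (simp add: pcompose_pCons)
  next
    case (Suc k)
    have dp: "degree p \<le> Suc k" using pCons Suc by (cases "p = 0") auto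
    have 1: "coeff ?q k = coeff p k + of_nat (Suc k) * c * coeff p (Suc k)"
      using pCons.IH[OF dp] .
    have 2: "coeff ?q (Suc k) = coeff p (Suc k)"
    proof -
      have "coeff ?q (Suc k) = coeff p (Suc k) + of_nat (Suc (Suc k)) * c * coeff p (Suc (Suc k))"
        using pCons.IH[of "Suc k"] dp by simp
      also have "coeff p (Suc (Suc k)) = 0" using dp by (intro coeff_eq_0) simp
      finally show ?thesis by simp
    qed
    have "coeff (pcompose (pCons a p) [:c, 1:]) n = c * coeff ?q (Suc k) + coeff ?q k"
      using Suc by (simp add: pcompose_pCons)
    then show ?thesis using Suc by (simp add: 1 2 algebra_simps)
  qed
qed

lemma degree_shift_diff:
  assumes "degree p = Suc d" "h \<noteq> 0"
  shows "degree (shift_diff h p) = d"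
    "lead_coeff (shift_diff h p) = of_nat (Suc d) * h * lead_coeff p"
proof -
  have c: "coeff (shift_diff h p) d = of_nat (Suc d) * h * lead_coeff p"
    using assms coeff_pcompose_shift[of p d h] by (simp add: shift_diff_def)
  have "coeff (shift_diff h p) n = 0" if "n > d" for n
  proof -
    have "coeff p (Suc n) = 0" using assms that by (intro coeff_eq_0) simp
    then show ?thesis using assms that coeff_pcompose_shift[of p n h] by (simp add: shift_diff_def)
  qed
  then have "degree (shift_diff h p) \<le> d" by (meson degree_le)
  moreover have "coeff (shift_diff h p) d \<noteq> 0"
    using c assms by (metis degree_0 leading_coeff_neq_0 mult_eq_0_iff nat.distinct(1) of_nat_eq_0_iff)
  ultimately show "degree (shift_diff h p) = d"
    using le_degree le_antisym by blast
  then show "lead_coeff (shift_diff h p) = of_nat (Suc d) * h * lead_coeff p" using c by simp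
qed

lemma card_poly_fiber:
  fixes p :: "int poly"
  assumes "degree p \<ge> 1"
  shows "finite {x. poly p x = m}" "card {x. poly p x = m} \<le> degree p"
proof -
  let ?q = "p - [:m:]"
  have "degree ?q = degree p" using assms degree_add_eq_left[of "[:-m:]" p] by (simp add: diff_conv_add_uminus del: add_uminus_conv_diff)
  moreover have q: "?q \<noteq> 0" using assms
    by (metis degree_pCons_0 eq_iff_diff_eq_0 not_one_le_zero)
  moreover have "{x. poly p x = m} = {x. poly ?q x = 0}" by auto
  ultimately show "finite {x. poly p x = m}" "card {x. poly p x = m} \<le> degree p"
    using poly_roots_finite[OF q] card_poly_roots_bound[OF q] by auto
qed

lemma poly_growth:
  fixes p :: "int poly"
  obtains C where "C \<ge> 1" "\<And>x N. N \<ge> 1 \<Longrightarrow> \<bar>x\<bar> \<le> int N \<Longrightarrow> \<bar>poly p x\<bar> \<le> C * int N ^ degree p"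
proof (rule that[of "1 + (\<Sum>i\<le>degree p. \<bar>coeff p i\<bar>)"])
  show "1 + (\<Sum>i\<le>degree p. \<bar>coeff p i\<bar>) \<ge> 1" by (simp add: sum_nonneg)
  fix x and N :: nat assume N: "N \<ge> 1" and x: "\<bar>x\<bar> \<le> int N"
  have "\<bar>poly p x\<bar> \<le> (\<Sum>i\<le>degree p. \<bar>coeff p i\<bar> * \<bar>x\<bar> ^ i)"
    unfolding poly_altdef by (rule order_trans[OF sum_abs]) (simp add: abs_mult power_abs)
  also have "\<dots> \<le> (\<Sum>i\<le>degree p. \<bar>coeff p i\<bar> * int N ^ degree p)"
  proof (intro sum_mono mult_left_mono)
    fix i assume "i \<in> {..degree p}"
    then have "\<bar>x\<bar> ^ i \<le> int N ^ i" "int N ^ i \<le> int N ^ degree p"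
      using x N by (auto intro: power_mono power_increasing)
    then show "\<bar>x\<bar> ^ i \<le> int N ^ degree p" by linarith
  qed auto
  also have "\<dots> \<le> (1 + (\<Sum>i\<le>degree p. \<bar>coeff p i\<bar>)) * int N ^ degree p"
    by (simp add: sum_distrib_right distrib_right)
  finally show "\<bar>poly p x\<bar> \<le> (1 + (\<Sum>i\<le>degree p. \<bar>coeff p i\<bar>)) * int N ^ degree p" .
qed

section \<open>Oscillatory integrals\<close>

text \<open>
Away from a critical point \<open>z\<close> derivative tests apply; the neighbourhood of radius \<open>\<delta>\<close> is
estimated trivially.  The interval may be cut off on either side, in which case the missing
integral is over an empty interval and vanishes.
\<close>

lemma oscillatory_integral_split:
  fixes f :: "real \<Rightarrow> complex"
  assumes f: "continuous_on UNIV f" "\<And>t. norm (f t) \<le> 1"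
    and z: "z \<in> {a..b}" and "\<delta> > 0" "B \<ge> 0"
    and L: "norm (integral {a..z - \<delta>} f) \<le> B" and R: "norm (integral {z + \<delta>..b} f) \<le> B"
  shows "norm (integral {a..b} f) \<le> 2 * \<delta> + 2 * B"
proof -
  have int: "f integrable_on {s..t}" for s t
    by (intro integrable_continuous_interval continuous_on_subset[OF f(1)]) simp
  define u where "u = max a (z - \<delta>)"
  define v where "v = min b (z + \<delta>)"
  have uv: "a \<le> u" "u \<le> z" "z \<le> v" "v \<le> b" "v - u \<le> 2 * \<delta>"
    using z \<open>\<delta> > 0\<close> by (auto simp: u_def v_def)
  have "integral {a..b} f = integral {a..u} f + integral {u..b} f"
    using uv int by (intro Henstock_Kurzweil_Integration.integral_combine[symmetric]) auto
  also have "integral {u..b} f = integral {u..v} f + integral {v..b} f"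
    using uv int by (intro Henstock_Kurzweil_Integration.integral_combine[symmetric]) auto
  finally have "norm (integral {a..b} f)
      \<le> norm (integral {a..u} f) + (norm (integral {u..v} f) + norm (integral {v..b} f))"
    by (auto intro!: order_trans[OF norm_triangle_ineq] norm_triangle_ineq)
  moreover have "norm (integral {a..u} f) \<le> B"
    using L \<open>B \<ge> 0\<close> by (cases "a \<le> z - \<delta>") (auto simp: u_def max_def)
  moreover have "norm (integral {v..b} f) \<le> B"
    using R \<open>B \<ge> 0\<close> by (cases "z + \<delta> \<le> b") (auto simp: v_def min_def)
  moreover have "norm (integral {u..v} f) \<le> 1 * (v - u)"
    using uv f by (intro integral_bound continuous_on_subset[OF f(1)]) auto
  ultimately have "norm (integral {a..b} f) \<le> B + (1 * (v - u) + B)"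
    by linarith
  also have "\<dots> \<le> 2 * \<delta> + 2 * B" using uv(5) by simp
  finally show ?thesis .
qed

text \<open>
The point \<open>z\<close> is the zero of \<open>Q\<close> if there is one, and otherwise the end of the interval at which \<open>Q\<close> is
closest to zero; nothing can be claimed at \<open>z\<close> itself in the latter case.
\<close>

lemma monotone_poly_linear_growth:
  fixes Q :: "real poly"
  assumes "a \<le> b" "\<kappa> > 0" and d: "\<And>t. t \<in> {a..b} \<Longrightarrow> poly (pderiv Q) t \<ge> \<kappa>"
  obtains z where "z \<in> {a..b}"
    "\<And>t. t \<in> {z<..b} \<Longrightarrow> poly Q t \<ge> \<kappa> * (t - z)"
    "\<And>t. t \<in> {a..<z} \<Longrightarrow> poly Q t \<le> - (\<kappa> * (z - t))"
proof -
  have mono: "poly Q t - poly Q s \<ge> \<kappa> * (t - s)" if "s \<in> {a..b}" "t \<in> {a..b}" "s \<le> t" for s t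
  proof (cases "s = t")
    case False
    then have "s < t" using that by simp
    then obtain x where "x > s" "x < t" "poly Q t - poly Q s = (t - s) * poly (pderiv Q) x"
      using poly_MVT[of s t Q] by blast
    moreover from this have "poly (pderiv Q) x \<ge> \<kappa>" using that by (intro d) auto
    ultimately show ?thesis using that by (simp add: mult.commute mult_right_mono)
  qed simp
  obtain z where z: "z \<in> {a..b}" "z < b \<longrightarrow> poly Q z \<ge> 0" "z > a \<longrightarrow> poly Q z \<le> 0"
  proof (cases "poly Q a \<ge> 0")
    case True
    then show thesis using that[of a] \<open>a \<le> b\<close> by auto
  next
    case a: False
    show thesis
    proof (cases "poly Q b \<le> 0")
      case True
      then show thesis using that[of b] \<open>a \<le> b\<close> by auto
    next
      case False
      then have "a < b" using a \<open>a \<le> b\<close> by (cases "a = b") auto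
      then obtain x where "x > a" "x < b" "poly Q x = 0"
        using poly_IVT_pos[of a b Q] a False by auto
      then show thesis using that[of x] by auto
    qed
  qed
  show thesis
  proof (rule that[OF z(1)])
    fix t
    show "poly Q t \<ge> \<kappa> * (t - z)" if "t \<in> {z<..b}"
      using mono[of z t] z that by auto
    show "poly Q t \<le> - (\<kappa> * (z - t))" if "t \<in> {a..<z}"
      using mono[of t z] z that by auto
  qed
qed

lemma norm_integral_cis_minus:
  "norm (integral S (\<lambda>t. cis (- F t))) = norm (integral S (\<lambda>t. cis (F t)))"
proof -
  have "(\<lambda>t. cis (- F t)) = cnj \<circ> (\<lambda>t. cis (F t))"
    by (simp add: fun_eq_iff cis_cnj)
  then show ?thesis
    by (simp add: integral_cnj[symmetric] o_def)
qed

lemma continuous_on_cis_poly: "continuous_on S (\<lambda>t. cis (poly P t))"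
  unfolding cis_conv_exp by (intro continuous_intros)

text \<open>
Integration by parts against \<open>1 / P'\<close>: the boundary terms cost \<open>2 / \<mu>\<close>, and since \<open>P''\<close> has one sign
the remaining integrand \<open>P'' / P'^2\<close> is the derivative of a monotone function with values between
\<open>0\<close> and \<open>1 / \<mu>\<close> in absolute value.
\<close>

lemma van_der_Corput_first_pos:
  fixes P :: "real poly"
  assumes "\<mu> > 0" and P': "\<And>t. t \<in> {a..b} \<Longrightarrow> poly (pderiv P) t \<ge> \<mu>"
    and sgn: "(\<forall>t\<in>{a..b}. poly (pderiv (pderiv P)) t \<ge> 0) \<or> (\<forall>t\<in>{a..b}. poly (pderiv (pderiv P)) t \<le> 0)"
  shows "norm (integral {a..b} (\<lambda>t. cis (poly P t))) \<le> 3 / \<mu>"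
proof (cases "a \<le> b")
  case False
  then show ?thesis using \<open>\<mu> > 0\<close> by simp
next
  case True
  let ?P1 = "pderiv P"
  let ?P2 = "pderiv (pderiv P)"
  have nz: "poly ?P1 t \<noteq> 0" if "t \<in> {a..b}" for t using P'[OF that] \<open>\<mu> > 0\<close> by auto
  \<comment> \<open>\<open>H\<close> is the boundary term and \<open>r\<close> the new integrand of the integration by parts\<close>
  define H where "H = (\<lambda>t. - \<i> * cis (poly P t) * of_real (inverse (poly ?P1 t)))"
  define r where "r = (\<lambda>t. \<i> * cis (poly P t) * of_real (poly ?P2 t / (poly ?P1 t)\<^sup>2))"
  have dcis: "((\<lambda>t. cis (poly P t)) has_vector_derivative (\<i> * cis (poly P t) * of_real (poly ?P1 t))) (at t within A)" for t A
  proof -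
    have 1: "(poly P has_vector_derivative poly ?P1 t) (at t within A)"
      using poly_DERIV[of P t] by (simp add: has_real_derivative_iff_has_vector_derivative has_vector_derivative_at_within)
    have 2: "((\<lambda>z. exp (\<i> * z)) has_field_derivative (exp (\<i> * of_real (poly P t)) * \<i>)) (at (of_real (poly P t)))"
      by (auto intro!: derivative_eq_intros)
    have 3: "((\<lambda>t. complex_of_real (poly P t)) has_vector_derivative of_real (poly ?P1 t)) (at t within A)"
      using bounded_linear.has_vector_derivative[OF bounded_linear_of_real 1] .
    show ?thesis
      using field_vector_diff_chain_within[OF 3 has_field_derivative_at_within[OF 2]]
      by (simp add: cis_conv_exp o_def mult_ac)
  qed
  have dH: "(H has_vector_derivative (cis (poly P t) + r t)) (at t within {a..b})" if t: "t \<in> {a..b}" for t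
  proof -
    have "((\<lambda>t. inverse (poly ?P1 t)) has_real_derivative (- (poly ?P2 t / (poly ?P1 t)\<^sup>2))) (at t within {a..b})"
      using nz[OF t] by (auto intro!: derivative_eq_intros simp: power2_eq_square divide_inverse)
    then have "((\<lambda>t. complex_of_real (inverse (poly ?P1 t))) has_vector_derivative of_real (- (poly ?P2 t / (poly ?P1 t)\<^sup>2))) (at t within {a..b})"
      unfolding has_real_derivative_iff_has_vector_derivative
      by (rule bounded_linear.has_vector_derivative[OF bounded_linear_of_real])
    from has_vector_derivative_mult[OF has_vector_derivative_mult_right[OF dcis, of "- \<i>"] this]
    have "(H has_vector_derivative (- \<i> * cis (poly P t) * of_real (- (poly ?P2 t / (poly ?P1 t)\<^sup>2))
       + - \<i> * (\<i> * cis (poly P t) * of_real (poly ?P1 t)) * of_real (inverse (poly ?P1 t)))) (at t within {a..b})"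
      unfolding H_def by simp
    moreover have "- \<i> * cis (poly P t) * of_real (- (poly ?P2 t / (poly ?P1 t)\<^sup>2))
       + - \<i> * (\<i> * cis (poly P t) * of_real (poly ?P1 t)) * of_real (inverse (poly ?P1 t))
       = cis (poly P t) + r t"
    proof -
      have "complex_of_real (poly ?P1 t) * of_real (inverse (poly ?P1 t)) = 1"
        using nz[OF t] by (simp flip: of_real_mult)
      then show ?thesis by (simp add: r_def mult.assoc[symmetric] del: of_real_inverse)
    qed
    ultimately show ?thesis by metis
  qed
  have i1: "((\<lambda>t. cis (poly P t) + r t) has_integral (H b - H a)) {a..b}"
    by (rule fundamental_theorem_of_calculus[OF True dH])
  have cr: "continuous_on {a..b} r"
    unfolding r_def cis_conv_exp using nz by (intro continuous_intros) auto
  have ir: "r integrable_on {a..b}" using cr by (rule integrable_continuous_interval)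
  have ic: "(\<lambda>t. cis (poly P t)) integrable_on {a..b}"
    by (intro integrable_continuous_interval continuous_on_cis_poly)
  have eq: "integral {a..b} (\<lambda>t. cis (poly P t)) = H b - H a - integral {a..b} r"
    using i1 Henstock_Kurzweil_Integration.integral_add[OF ic ir] by (simp add: integral_unique algebra_simps)
  define R where "R = (\<lambda>t. poly ?P2 t / (poly ?P1 t)\<^sup>2)"
  have iR: "(R has_integral (- inverse (poly ?P1 b) - - inverse (poly ?P1 a))) {a..b}"
    unfolding R_def
  proof (rule fundamental_theorem_of_calculus[OF True])
    fix t assume t: "t \<in> {a..b}"
    have "((\<lambda>t. - inverse (poly ?P1 t)) has_real_derivative (poly ?P2 t / (poly ?P1 t)\<^sup>2)) (at t within {a..b})"
      using nz[OF t] by (auto intro!: derivative_eq_intros simp: power2_eq_square divide_inverse)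
    then show "((\<lambda>t. - inverse (poly ?P1 t)) has_vector_derivative (poly ?P2 t / (poly ?P1 t)\<^sup>2)) (at t within {a..b})"
      unfolding has_real_derivative_iff_has_vector_derivative .
  qed
  have pos: "0 < inverse (poly ?P1 t)" "inverse (poly ?P1 t) \<le> 1 / \<mu>" if "t \<in> {a..b}" for t
    using P'[OF that] \<open>\<mu> > 0\<close> by (auto simp: inverse_eq_divide frac_le)
  have ab: "a \<in> {a..b}" "b \<in> {a..b}" using True by auto
  have "norm (integral {a..b} r) \<le> 1 / \<mu>"
    using sgn
  proof
    assume s: "\<forall>t\<in>{a..b}. poly ?P2 t \<ge> 0"
    have "norm (integral {a..b} r) \<le> integral {a..b} R"
      using ir iR s by (intro integral_norm_bound_integral)
        (auto simp: r_def R_def norm_mult norm_divide norm_power)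
    also have "\<dots> \<le> 1 / \<mu>" using integral_unique[OF iR] pos[OF ab(1)] pos[OF ab(2)] by linarith
    finally show ?thesis .
  next
    assume s: "\<forall>t\<in>{a..b}. poly ?P2 t \<le> 0"
    have iR': "((\<lambda>t. - R t) has_integral - (- inverse (poly ?P1 b) - - inverse (poly ?P1 a))) {a..b}"
      using iR by (rule has_integral_neg)
    have "norm (integral {a..b} r) \<le> integral {a..b} (\<lambda>t. - R t)"
      using ir iR' s by (intro integral_norm_bound_integral)
        (auto simp: r_def R_def norm_mult norm_divide norm_power)
    also have "\<dots> \<le> 1 / \<mu>" using integral_unique[OF iR'] pos[OF ab(1)] pos[OF ab(2)] by linarith
    finally show ?thesis .
  qed
  moreover have "norm (H a) \<le> 1 / \<mu>" "norm (H b) \<le> 1 / \<mu>"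
    using pos[OF ab(1)] pos[OF ab(2)] by (auto simp: H_def norm_mult norm_inverse)
  ultimately have "norm (H b - H a - integral {a..b} r) \<le> 1 / \<mu> + 1 / \<mu> + 1 / \<mu>"
    by (intro norm_triangle_le_diff add_mono) (auto intro: norm_triangle_le_diff)
  then show ?thesis unfolding eq by simp
qed

lemma van_der_Corput_first:
  fixes P :: "real poly"
  assumes "\<mu> > 0"
    and P': "(\<forall>t\<in>{a..b}. poly (pderiv P) t \<ge> \<mu>) \<or> (\<forall>t\<in>{a..b}. poly (pderiv P) t \<le> - \<mu>)"
    and sgn: "\<forall>t\<in>{a..b}. poly (pderiv (pderiv P)) t \<ge> 0"
  shows "norm (integral {a..b} (\<lambda>t. cis (poly P t))) \<le> 3 / \<mu>"
  using P'
proof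
  assume "\<forall>t\<in>{a..b}. poly (pderiv P) t \<ge> \<mu>"
  then show ?thesis using assms by (intro van_der_Corput_first_pos) auto
next
  assume "\<forall>t\<in>{a..b}. poly (pderiv P) t \<le> - \<mu>"
  then have "norm (integral {a..b} (\<lambda>t. cis (poly (- P) t))) \<le> 3 / \<mu>"
    using assms by (intro van_der_Corput_first_pos) (auto simp: pderiv_minus le_minus_iff)
  then show ?thesis by (simp add: norm_integral_cis_minus)
qed

text \<open>
At distance \<open>\<delta>\<close> from the point where \<open>P'\<close> is smallest the first derivative test applies with
\<open>\<mu> = \<kappa> * \<delta>\<close>; the choice \<open>\<delta> = 1 / sqrt \<kappa>\<close> balances the two contributions.
\<close>

lemma van_der_Corput_second:
  fixes P :: "real poly"
  assumes "\<kappa> > 0" and P'': "\<And>t. t \<in> {a..b} \<Longrightarrow> poly (pderiv (pderiv P)) t \<ge> \<kappa>"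
  shows "norm (integral {a..b} (\<lambda>t. cis (poly P t))) \<le> 8 / sqrt \<kappa>"
proof (cases "a \<le> b")
  case False
  then show ?thesis using \<open>\<kappa> > 0\<close> by simp
next
  case True
  obtain z where z: "z \<in> {a..b}"
    "\<And>t. t \<in> {z<..b} \<Longrightarrow> poly (pderiv P) t \<ge> \<kappa> * (t - z)"
    "\<And>t. t \<in> {a..<z} \<Longrightarrow> poly (pderiv P) t \<le> - (\<kappa> * (z - t))"
    using monotone_poly_linear_growth[OF True \<open>\<kappa> > 0\<close> P''] by blast
  define \<delta> where "\<delta> = 1 / sqrt \<kappa>"
  have \<delta>: "\<delta> > 0" and \<kappa>\<delta>: "\<kappa> * \<delta> = sqrt \<kappa>"
    using \<open>\<kappa> > 0\<close> by (auto simp: \<delta>_def real_div_sqrt)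
  have s: "sqrt \<kappa> > 0" using \<open>\<kappa> > 0\<close> by simp
  have P2: "0 \<le> poly (pderiv (pderiv P)) t" if "t \<in> {a..b}" for t using P''[OF that] \<open>\<kappa> > 0\<close> by linarith
  have L: "norm (integral {a..z - \<delta>} (\<lambda>t. cis (poly P t))) \<le> 3 / sqrt \<kappa>"
  proof (rule van_der_Corput_first[OF s])
    show "(\<forall>t\<in>{a..z - \<delta>}. sqrt \<kappa> \<le> poly (pderiv P) t) \<or> (\<forall>t\<in>{a..z - \<delta>}. poly (pderiv P) t \<le> - sqrt \<kappa>)"
    proof (intro disjI2 ballI)
      fix t assume t: "t \<in> {a..z - \<delta>}"
      then have "poly (pderiv P) t \<le> - (\<kappa> * (z - t))" using \<delta> by (intro z) auto
      moreover have "\<kappa> * (z - t) \<ge> \<kappa> * \<delta>" using t \<open>\<kappa> > 0\<close> by (intro mult_left_mono) auto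
      ultimately show "poly (pderiv P) t \<le> - sqrt \<kappa>" using \<kappa>\<delta> by linarith
    qed
  qed (use P2 z(1) \<delta> in auto)
  have R: "norm (integral {z + \<delta>..b} (\<lambda>t. cis (poly P t))) \<le> 3 / sqrt \<kappa>"
  proof (rule van_der_Corput_first[OF s])
    show "(\<forall>t\<in>{z + \<delta>..b}. sqrt \<kappa> \<le> poly (pderiv P) t) \<or> (\<forall>t\<in>{z + \<delta>..b}. poly (pderiv P) t \<le> - sqrt \<kappa>)"
    proof (intro disjI1 ballI)
      fix t assume t: "t \<in> {z + \<delta>..b}"
      then have "poly (pderiv P) t \<ge> \<kappa> * (t - z)" using \<delta> by (intro z) auto
      moreover have "\<kappa> * (t - z) \<ge> \<kappa> * \<delta>" using t \<open>\<kappa> > 0\<close> by (intro mult_left_mono) auto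
      ultimately show "poly (pderiv P) t \<ge> sqrt \<kappa>" using \<kappa>\<delta> by linarith
    qed
  qed (use P2 z(1) \<delta> in auto)
  have "norm (integral {a..b} (\<lambda>t. cis (poly P t))) \<le> 2 * \<delta> + 2 * (3 / sqrt \<kappa>)"
    by (rule oscillatory_integral_split[OF continuous_on_cis_poly _ z(1) \<delta> _ L R]) (use s in auto)
  then show ?thesis by (simp add: \<delta>_def)
qed

text \<open>
The same step as from the first to the second derivative, now balanced at \<open>\<delta> = \<kappa> powr (- 1/3)\<close>.
\<close>

lemma van_der_Corput_third:
  fixes P :: "real poly"
  assumes "\<kappa> > 0" and P3: "\<And>t. poly (pderiv (pderiv (pderiv P))) t \<ge> \<kappa>"
  shows "norm (integral {a..b} (\<lambda>t. cis (poly P t))) \<le> 18 * \<kappa> powr (- 1 / 3)"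
proof (cases "a \<le> b")
  case False
  then show ?thesis using \<open>\<kappa> > 0\<close> by simp
next
  case True
  obtain z where z: "z \<in> {a..b}"
    "\<And>t. t \<in> {z<..b} \<Longrightarrow> poly (pderiv (pderiv P)) t \<ge> \<kappa> * (t - z)"
    "\<And>t. t \<in> {a..<z} \<Longrightarrow> poly (pderiv (pderiv P)) t \<le> - (\<kappa> * (z - t))"
    using monotone_poly_linear_growth[OF True \<open>\<kappa> > 0\<close> P3] by blast
  define \<delta> where "\<delta> = \<kappa> powr (- 1 / 3)"
  have \<delta>: "\<delta> > 0" using \<open>\<kappa> > 0\<close> by (auto simp: \<delta>_def)
  have \<kappa>\<delta>: "\<kappa> * \<delta> = \<kappa> powr (2 / 3)"
    using \<open>\<kappa> > 0\<close> powr_add[of \<kappa> 1 "- 1 / 3"] by (simp add: \<delta>_def)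
  have s: "\<kappa> * \<delta> > 0" using \<open>\<kappa> > 0\<close> \<delta> by simp
  have "sqrt (\<kappa> * \<delta>) = \<kappa> powr (1 / 3)"
    unfolding \<kappa>\<delta> by (rule real_sqrt_unique) (simp_all add: power2_eq_square powr_add[symmetric])
  then have sq: "8 / sqrt (\<kappa> * \<delta>) = 8 * \<delta>"
    by (simp add: \<delta>_def powr_minus_divide)
  have L: "norm (integral {a..z - \<delta>} (\<lambda>t. cis (poly P t))) \<le> 8 * \<delta>"
  proof -
    have "norm (integral {a..z - \<delta>} (\<lambda>t. cis (poly (- P) t))) \<le> 8 / sqrt (\<kappa> * \<delta>)"
    proof (rule van_der_Corput_second[OF s])
      fix t assume t: "t \<in> {a..z - \<delta>}"
      then have "poly (pderiv (pderiv P)) t \<le> - (\<kappa> * (z - t))" using \<delta> by (intro z) auto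
      moreover have "\<kappa> * (z - t) \<ge> \<kappa> * \<delta>" using t \<open>\<kappa> > 0\<close> by (intro mult_left_mono) auto
      ultimately show "\<kappa> * \<delta> \<le> poly (pderiv (pderiv (- P))) t" by (simp add: pderiv_minus)
    qed
    then show ?thesis by (simp add: norm_integral_cis_minus sq)
  qed
  have R: "norm (integral {z + \<delta>..b} (\<lambda>t. cis (poly P t))) \<le> 8 * \<delta>"
    unfolding sq[symmetric]
  proof (rule van_der_Corput_second[OF s])
    fix t assume t: "t \<in> {z + \<delta>..b}"
    then have "poly (pderiv (pderiv P)) t \<ge> \<kappa> * (t - z)" using \<delta> by (intro z) auto
    moreover have "\<kappa> * (t - z) \<ge> \<kappa> * \<delta>" using t \<open>\<kappa> > 0\<close> by (intro mult_left_mono) auto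
    ultimately show "\<kappa> * \<delta> \<le> poly (pderiv (pderiv P)) t" by linarith
  qed
  have "norm (integral {a..b} (\<lambda>t. cis (poly P t))) \<le> 2 * \<delta> + 2 * (8 * \<delta>)"
    by (rule oscillatory_integral_split[OF continuous_on_cis_poly _ z(1) \<delta> _ L R]) (use \<delta> in auto)
  then show ?thesis by (simp add: \<delta>_def)
qed

text \<open>
The third derivative of a cubic is the constant \<open>6 * lead_coeff \<phi>\<close>, which is nonzero and an integer, so the third
derivative test holds on every interval with the same constant.
\<close>

lemma cubic_oscillatory_integral:
  fixes \<phi> :: "int poly"
  assumes "degree \<phi> = 3" "\<theta> \<noteq> 0"
  shows "norm (integral {a..b} (\<lambda>t. e_char (\<theta> * poly (map_poly real_of_int \<phi>) t))) \<le> 18 * \<bar>\<theta>\<bar> powr (- 1 / 3)"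
proof -
  define \<psi> :: "real poly" where "\<psi> = map_poly real_of_int \<phi>"
  define c :: real where "c = of_int (lead_coeff \<phi>)"
  have "\<phi> \<noteq> 0" using assms by auto
  then have "lead_coeff \<phi> \<noteq> 0" by simp
  then have "1 \<le> \<bar>lead_coeff \<phi>\<bar>" by linarith
  then have "real_of_int 1 \<le> real_of_int \<bar>lead_coeff \<phi>\<bar>" by (simp only: of_int_le_iff)
  then have c: "\<bar>c\<bar> \<ge> 1" unfolding c_def by simp
  have d3: "pderiv (pderiv (pderiv \<psi>)) = [:6 * c:]"
  proof (rule poly_eqI)
    fix n
    have "coeff \<psi> (n + 3) = (if n = 0 then c else 0)"
      using assms by (auto simp: \<psi>_def c_def coeff_map_poly intro!: coeff_eq_0)
    then show "coeff (pderiv (pderiv (pderiv \<psi>))) n = coeff [:6 * c:] n"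
      by (cases n) (auto simp: coeff_pderiv numeral_3_eq_3)
  qed
  define P where "P = smult (2 * pi * \<theta>) \<psi>"
  have P3: "poly (pderiv (pderiv (pderiv P))) t = 2 * pi * \<theta> * (6 * c)" for t
    by (simp add: P_def pderiv_smult d3)
  have big: "\<bar>\<theta>\<bar> \<le> \<bar>2 * pi * \<theta> * (6 * c)\<bar>"
  proof -
    have "\<bar>\<theta>\<bar> * 1 \<le> \<bar>\<theta>\<bar> * (12 * pi * \<bar>c\<bar>)"
      using mult_mono[of 1 "12 * pi" 1 "\<bar>c\<bar>"] c pi_gt3 by (intro mult_left_mono) simp_all
    then show ?thesis by (simp add: abs_mult mult_ac)
  qed
  have e: "e_char (\<theta> * poly \<psi> t) = cis (poly P t)" for t
    by (simp add: e_char_cis P_def mult_ac)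
  have "norm (integral {a..b} (\<lambda>t. cis (poly P t))) \<le> 18 * \<bar>\<theta>\<bar> powr (- 1 / 3)"
  proof (cases "2 * pi * \<theta> * (6 * c) > 0")
    case True
    then show ?thesis using assms big by (intro van_der_Corput_third) (auto simp: P3)
  next
    case False
    then have "norm (integral {a..b} (\<lambda>t. cis (poly (- P) t))) \<le> 18 * \<bar>\<theta>\<bar> powr (- 1 / 3)"
      using assms big by (intro van_der_Corput_third) (auto simp: P3 pderiv_minus)
    then show ?thesis by (simp add: norm_integral_cis_minus)
  qed
  then show ?thesis unfolding \<psi>_def[symmetric] e .
qed

section \<open>Moments of a truncated divisor function\<close>

lemma sum_inverse_le_ln: "(\<Sum>r\<in>{1..n}. 1 / real r) \<le> 1 + ln (real n)" if "n \<ge> 1" for n :: nat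
  using that
proof (induction n rule: dec_induct)
  case base
  then show ?case by simp
next
  case (step n)
  have "ln (real n / real (Suc n)) \<le> real n / real (Suc n) - 1"
    using step.hyps by (intro ln_le_minus_one) auto
  moreover have "ln (real n / real (Suc n)) = ln n - ln (Suc n)"
    using step.hyps by (simp add: ln_div)
  moreover have "real n / real (Suc n) - 1 = - (1 / real (Suc n))" by (simp add: field_simps)
  ultimately show ?case using step.IH by simp
qed

lemma sum_inverse_le_powr:
  fixes \<epsilon> :: real
  assumes "\<epsilon> > 0" "n \<ge> 1"
  shows "(\<Sum>r\<in>{1..n}. 1 / real r) \<le> (1 + 1 / \<epsilon>) * real n powr \<epsilon>"
proof -
  have "ln (real n) \<le> real n powr \<epsilon> / \<epsilon>" using assms by (intro ln_powr_bound) auto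
  moreover have "1 \<le> real n powr \<epsilon>" using assms by (intro ge_one_powr_ge_zero) auto
  ultimately show ?thesis using sum_inverse_le_ln[OF assms(2)] by (simp add: algebra_simps)
qed

definition divisors_upto :: "nat \<Rightarrow> nat \<Rightarrow> nat set" where
  "divisors_upto X l = {q\<in>{1..X}. q dvd l}"

lemma card_multiples_le:
  "g \<ge> 1 \<Longrightarrow> real (card {l\<in>{1..L}. g dvd l}) \<le> real L / real g"
proof -
  assume g: "g \<ge> 1"
  have "{l\<in>{1..L}. g dvd l} \<subseteq> (\<lambda>k. g * k) ` {1..L div g}"
  proof
    fix l assume "l \<in> {l\<in>{1..L}. g dvd l}"
    then obtain k where k: "l = g * k" "1 \<le> l" "l \<le> L" by (auto elim: dvdE)
    then have "k \<ge> 1" "k \<le> L div g" using g by (auto simp: less_eq_div_iff_mult_less_eq mult.commute intro: Suc_leI)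
    then show "l \<in> (\<lambda>k. g * k) ` {1..L div g}" using k by auto
  qed
  then have "card {l\<in>{1..L}. g dvd l} \<le> card ((\<lambda>k. g * k) ` {1..L div g})"
    by (rule card_mono[rotated]) simp
  also have "\<dots> \<le> card {1..L div g}" by (rule card_image_le) simp
  finally have "card {l\<in>{1..L}. g dvd l} \<le> L div g" by simp
  then have "real (card {l\<in>{1..L}. g dvd l}) \<le> real (L div g)" by (rule of_nat_mono)
  also have "\<dots> \<le> real L / real g" by (rule of_nat_div_le_of_nat)
  finally show ?thesis .
qed

text \<open>
\<open>1 / lcm q g\<close> is \<open>gcd q g / (q * g)\<close>; bounding the gcd by the sum of all common divisors \<open>d\<close> and writing
\<open>q = d * r\<close> leaves one harmonic sum for each divisor of \<open>g\<close>.
\<close>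

lemma sum_inverse_lcm_le:
  fixes g X :: nat
  assumes "g \<ge> 1"
  shows "(\<Sum>q\<in>{1..X}. 1 / real (lcm q g)) \<le> real (card {d. d dvd g}) / real g * (\<Sum>r\<in>{1..X}. 1 / real r)"
proof -
  have fin: "finite {d. d dvd g}" using assms by simp
  have "(\<Sum>q\<in>{1..X}. 1 / real (lcm q g)) = (\<Sum>q\<in>{1..X}. real (gcd q g) / real q) / real g"
    unfolding sum_divide_distrib
  proof (rule sum.cong)
    fix q assume q: "q \<in> {1..X}"
    have "real (lcm q g) * real (gcd q g) = real q * real g"
      by (metis of_nat_mult prod_gcd_lcm_nat mult.commute)
    moreover have "lcm q g > 0" using q assms by (simp add: lcm_pos_nat)
    ultimately show "1 / real (lcm q g) = real (gcd q g) / real q / real g"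
      using q assms by (simp add: field_simps)
  qed simp
  also have "(\<Sum>q\<in>{1..X}. real (gcd q g) / real q) \<le> (\<Sum>q\<in>{1..X}. \<Sum>d\<in>{d. d dvd g}. if d dvd q then real d / real q else 0)"
  proof (rule sum_mono)
    fix q
    have "real (gcd q g) / real q = (if gcd q g dvd q then real (gcd q g) / real q else 0)" by simp
    also have "\<dots> \<le> (\<Sum>d\<in>{d. d dvd g}. if d dvd q then real d / real q else 0)"
      using fin by (intro member_le_sum) auto
    finally show "real (gcd q g) / real q \<le> (\<Sum>d\<in>{d. d dvd g}. if d dvd q then real d / real q else 0)" .
  qed
  also have "\<dots> = (\<Sum>d\<in>{d. d dvd g}. \<Sum>q\<in>{1..X}. if d dvd q then real d / real q else 0)"
    by (rule sum.swap)
  also have "\<dots> \<le> (\<Sum>d\<in>{d. d dvd g}. \<Sum>r\<in>{1..X}. 1 / real r)"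
  proof (rule sum_mono)
    fix d assume "d \<in> {d. d dvd g}"
    then have d: "d \<ge> 1" using assms by (cases d) auto
    have "(\<Sum>q\<in>{1..X}. if d dvd q then real d / real q else 0) = (\<Sum>q\<in>{q\<in>{1..X}. d dvd q}. real d / real q)"
      by (simp only: sum.inter_filter[OF finite_atLeastAtMost])
    also have "\<dots> \<le> (\<Sum>q\<in>(\<lambda>r. d * r) ` {1..X}. real d / real q)"
    proof (rule sum_mono2)
      show "{q \<in> {1..X}. d dvd q} \<subseteq> (\<lambda>r. d * r) ` {1..X}"
      proof
        fix q assume "q \<in> {q \<in> {1..X}. d dvd q}"
        then obtain k where k: "q = d * k" "1 \<le> q" "q \<le> X" by (auto elim: dvdE)
        have "k \<le> d * k" using d by simp
        then have "k \<le> X" using k by linarith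
        moreover have "1 \<le> k" using k by (cases k) auto
        ultimately show "q \<in> (\<lambda>r. d * r) ` {1..X}" using k by auto
      qed
    qed auto
    also have "\<dots> = (\<Sum>r\<in>{1..X}. 1 / real r)"
      using d by (subst sum.reindex) (auto simp: inj_on_def)
    finally show "(\<Sum>q\<in>{1..X}. if d dvd q then real d / real q else 0) \<le> (\<Sum>r\<in>{1..X}. 1 / real r)" .
  qed
  also have "\<dots> = real (card {d. d dvd g}) * (\<Sum>r\<in>{1..X}. 1 / real r)" by simp
  finally show ?thesis by (simp add: divide_right_mono)
qed

text \<open>
One factor of the \<open>b\<close>-th power is opened as a sum over \<open>q \<le> X\<close>, which replaces the condition
\<open>g dvd l\<close> by \<open>lcm q g dvd l\<close>.  Keeping the divisibility condition in the statement is what makes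
the induction on \<open>b\<close> work.  The loss is a power of \<open>X\<close>, not of \<open>L\<close>.
\<close>

lemma divisors_upto_moment:
  fixes \<tau> :: real
  assumes "\<tau> > 0"
  shows "\<exists>C>0. \<forall>X\<ge>1. \<forall>L. \<forall>g\<ge>1. (\<Sum>l\<in>{l\<in>{1..L}. g dvd l}. real (card (divisors_upto X l)) ^ b)
     \<le> C * real L * (real X powr \<tau>) * (real g powr \<tau>) / real g"
  using assms
proof (induction b arbitrary: \<tau>)
  case 0
  show ?case
  proof (intro exI[of _ 1] conjI allI impI)
    fix X L g :: nat assume "X \<ge> 1" "g \<ge> 1"
    then have "1 * 1 \<le> real X powr \<tau> * real g powr \<tau>"
      using 0 by (intro mult_mono ge_one_powr_ge_zero) auto
    then have "real L / real g * 1 \<le> real L / real g * (real X powr \<tau> * real g powr \<tau>)"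
      by (intro mult_left_mono) auto
    then show "(\<Sum>l\<in>{l\<in>{1..L}. g dvd l}. real (card (divisors_upto X l)) ^ 0)
      \<le> 1 * real L * (real X powr \<tau>) * (real g powr \<tau>) / real g"
      using card_multiples_le[OF \<open>g \<ge> 1\<close>, of L] by simp
  qed simp
next
  case (Suc b)
  define \<sigma> where "\<sigma> = \<tau> / 4"
  have \<sigma>: "\<sigma> > 0" using Suc.prems by (simp add: \<sigma>_def)
  obtain C1 where C1: "C1 > 0" and IH: "\<And>X L g. X \<ge> 1 \<Longrightarrow> g \<ge> 1 \<Longrightarrow>
    (\<Sum>l\<in>{l\<in>{1..L}. g dvd l}. real (card (divisors_upto X l)) ^ b)
     \<le> C1 * real L * (real X powr \<sigma>) * (real g powr \<sigma>) / real g"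
    using Suc.IH[OF \<sigma>] by blast
  obtain C2 where C2: "C2 \<ge> 1" "\<And>n::nat. n > 0 \<Longrightarrow> real (card {d. d dvd n}) \<le> C2 * real n powr \<sigma>"
    using divisor_bound[OF \<sigma>] by blast
  define C3 where "C3 = 1 + 1 / \<sigma>"
  have C3: "C3 > 0" using \<sigma> by (simp add: C3_def add_pos_pos)
  show ?case
  proof (intro exI[of _ "C1 * C2 * C3"] conjI allI impI)
    show "C1 * C2 * C3 > 0" using C1 C2 C3 by simp
    fix X L g :: nat assume X: "X \<ge> 1" and g: "g \<ge> 1"
    let ?A = "\<lambda>g. {l\<in>{1..L}. g dvd l}"
    let ?d = "\<lambda>l. real (card (divisors_upto X l))"
    define K where "K = C1 * real L * (real X powr \<sigma>) * (real X powr \<sigma> * real g powr \<sigma>)"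
    have K: "K \<ge> 0" using C1 by (simp add: K_def)
    have "(\<Sum>l\<in>?A g. ?d l ^ Suc b) = (\<Sum>l\<in>?A g. \<Sum>q\<in>{1..X}. if q dvd l then ?d l ^ b else 0)"
    proof (rule sum.cong)
      fix l
      have "(\<Sum>q\<in>{1..X}. if q dvd l then ?d l ^ b else 0) = (\<Sum>q\<in>divisors_upto X l. ?d l ^ b)"
        unfolding divisors_upto_def by (simp only: sum.inter_filter[OF finite_atLeastAtMost])
      then show "?d l ^ Suc b = (\<Sum>q\<in>{1..X}. if q dvd l then ?d l ^ b else 0)" by simp
    qed simp
    also have "\<dots> = (\<Sum>q\<in>{1..X}. \<Sum>l\<in>?A g. if q dvd l then ?d l ^ b else 0)"
      by (rule sum.swap)
    also have "\<dots> = (\<Sum>q\<in>{1..X}. \<Sum>l\<in>?A (lcm q g). ?d l ^ b)"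
    proof (rule sum.cong)
      fix q
      have "?A (lcm q g) = {l \<in> ?A g. q dvd l}" by auto
      then show "(\<Sum>l\<in>?A g. if q dvd l then ?d l ^ b else 0) = (\<Sum>l\<in>?A (lcm q g). ?d l ^ b)"
        by (simp only: sum.inter_filter[of "?A g"] finite_Collect_conjI finite_atLeastAtMost Collect_mem_eq simp_thms)
    qed simp
    also have "\<dots> \<le> (\<Sum>q\<in>{1..X}. K * (1 / real (lcm q g)))"
    proof (rule sum_mono)
      fix q assume q: "q \<in> {1..X}"
      have lpos: "lcm q g \<ge> 1" using q g by (simp add: Suc_le_eq lcm_pos_nat)
      have "lcm q g \<le> q * g" using q g by (intro dvd_imp_le) auto
      also have "\<dots> \<le> X * g" using q by simp
      finally have "real (lcm q g) \<le> real X * real g" by (metis of_nat_le_iff of_nat_mult)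
      then have "real (lcm q g) powr \<sigma> \<le> (real X * real g) powr \<sigma>"
        using \<sigma> by (intro powr_mono2) auto
      then have le: "real (lcm q g) powr \<sigma> \<le> real X powr \<sigma> * real g powr \<sigma>" by (simp add: powr_mult)
      have "(\<Sum>l\<in>?A (lcm q g). ?d l ^ b) \<le> C1 * real L * (real X powr \<sigma>) * (real (lcm q g) powr \<sigma>) / real (lcm q g)"
        using IH[OF X lpos] .
      also have "\<dots> \<le> K / real (lcm q g)"
        unfolding K_def using le C1 by (intro divide_right_mono mult_left_mono) auto
      finally show "(\<Sum>l\<in>?A (lcm q g). ?d l ^ b) \<le> K * (1 / real (lcm q g))" by simp
    qed
    also have "\<dots> = K * (\<Sum>q\<in>{1..X}. 1 / real (lcm q g))" by (simp add: sum_distrib_left)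
    also have "\<dots> \<le> K * (real (card {d. d dvd g}) / real g * (\<Sum>r\<in>{1..X}. 1 / real r))"
      using K by (intro mult_left_mono sum_inverse_lcm_le g)
    also have "\<dots> \<le> K * ((C2 * real g powr \<sigma>) / real g * (C3 * real X powr \<sigma>))"
      using K C2(2)[of g] g sum_inverse_le_powr[OF \<sigma> X] C2(1)
      by (intro mult_left_mono mult_mono divide_right_mono) (auto simp: C3_def intro!: sum_nonneg)
    also have "\<dots> = C1 * C2 * C3 * real L * (real X powr (\<sigma> + \<sigma> + \<sigma>)) * (real g powr (\<sigma> + \<sigma>)) / real g"
      unfolding K_def powr_add by (simp only: times_divide_eq_left times_divide_eq_right mult_ac)
    also have "\<dots> \<le> C1 * C2 * C3 * real L * (real X powr \<tau>) * (real g powr \<tau>) / real g"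
    proof -
      have "real X powr (\<sigma> + \<sigma> + \<sigma>) \<le> real X powr \<tau>" "real g powr (\<sigma> + \<sigma>) \<le> real g powr \<tau>"
        using X g Suc.prems by (intro powr_mono; simp add: \<sigma>_def)+
      moreover have "0 \<le> C1 * C2 * C3 * real L" using C1 C2(1) C3 by simp
      ultimately have "C1 * C2 * C3 * real L * (real X powr (\<sigma> + \<sigma> + \<sigma>) * real g powr (\<sigma> + \<sigma>)) / real g
          \<le> C1 * C2 * C3 * real L * (real X powr \<tau> * real g powr \<tau>) / real g"
        by (intro divide_right_mono mult_left_mono mult_mono) simp_all
      then show ?thesis by (simp only: mult.assoc)
    qed
    finally show "(\<Sum>l\<in>?A g. ?d l ^ Suc b) \<le> C1 * C2 * C3 * real L * (real X powr \<tau>) * (real g powr \<tau>) / real g" .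
  qed
qed

section \<open>Cauchy-Schwarz and Weyl differencing\<close>

lemma norm_sum_mult_square_le:
  fixes f g :: "'i \<Rightarrow> complex"
  shows "(cmod (\<Sum>i\<in>A. f i * g i))\<^sup>2 \<le> (\<Sum>i\<in>A. (cmod (f i))\<^sup>2) * (\<Sum>i\<in>A. (cmod (g i))\<^sup>2)"
proof -
  have "cmod (\<Sum>i\<in>A. f i * g i) \<le> (\<Sum>i\<in>A. \<bar>cmod (f i)\<bar> * \<bar>cmod (g i)\<bar>)"
    by (rule sum_norm_le) (simp add: norm_mult)
  also have "\<dots> \<le> L2_set (\<lambda>i. cmod (f i)) A * L2_set (\<lambda>i. cmod (g i)) A"
    by (rule L2_set_mult_ineq)
  finally have "(cmod (\<Sum>i\<in>A. f i * g i))\<^sup>2 \<le> (L2_set (\<lambda>i. cmod (f i)) A * L2_set (\<lambda>i. cmod (g i)) A)\<^sup>2"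
    by (intro power_mono) auto
  then show ?thesis by (simp add: power_mult_distrib L2_set_def sum_nonneg)
qed

lemma norm_sum_square_le:
  fixes f :: "'i \<Rightarrow> complex"
  shows "(cmod (\<Sum>i\<in>A. f i))\<^sup>2 \<le> real (card A) * (\<Sum>i\<in>A. (cmod (f i))\<^sup>2)"
  using norm_sum_mult_square_le[of "\<lambda>_. 1" f A] by simp

abbreviation window :: "nat \<Rightarrow> int set" where
  "window N \<equiv> {- int N..int N}"

text \<open>
Sorting the pairs of the expanded square by the difference \<open>h\<close> of their entries.
\<close>

lemma weyl_differencing:
  fixes f :: "int \<Rightarrow> complex"
  assumes S: "S \<subseteq> window N"
  shows "complex_of_real ((cmod (\<Sum>n\<in>S. f n))\<^sup>2)
    = (\<Sum>h\<in>window (2 * N). \<Sum>n\<in>{n\<in>S. n + h \<in> S}. f (n + h) * cnj (f n))"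
proof -
  have fin: "finite S" using S by (rule finite_subset) simp
  have "complex_of_real ((cmod (\<Sum>n\<in>S. f n))\<^sup>2) = (\<Sum>(m, n)\<in>S \<times> S. f m * cnj (f n))"
    by (simp only: cmod_square_cnj cnj_sum sum_product sum.cartesian_product)
  also have "\<dots> = (\<Sum>(h, n)\<in>(SIGMA h:window (2 * N). {n\<in>S. n + h \<in> S}). f (n + h) * cnj (f n))"
  proof (rule sum.reindex_bij_witness[where i = "\<lambda>(h, n). (n + h, n)" and j = "\<lambda>(m, n). (m - n, n)"])
    fix p assume "p \<in> S \<times> S"
    then obtain m n where p: "p = (m, n)" "m \<in> S" "n \<in> S" by auto
    then have "m \<in> {- int N..int N}" "n \<in> {- int N..int N}" using S by auto
    then show "(case p of (m, n) \<Rightarrow> (m - n, n)) \<in> (SIGMA h:window (2 * N). {n\<in>S. n + h \<in> S})"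
      using p by auto
  qed auto
  also have "\<dots> = (\<Sum>h\<in>window (2 * N). \<Sum>n\<in>{n\<in>S. n + h \<in> S}. f (n + h) * cnj (f n))"
    using fin by (subst sum.Sigma) auto
  finally show ?thesis .
qed

section \<open>The fourth moment\<close>

lemma int_divisors_finite: "m \<noteq> 0 \<Longrightarrow> finite {h::int. h dvd m}"
  and card_int_divisors_le: "m \<noteq> 0 \<Longrightarrow> card {h::int. h dvd m} \<le> 2 * card {d::nat. d dvd nat \<bar>m\<bar>}"
proof -
  assume m: "m \<noteq> 0"
  let ?D = "{d::nat. d dvd nat \<bar>m\<bar>}"
  have fin: "finite ?D" by (rule finite_divisors_nat) (use m in simp)
  have sub: "{h::int. h dvd m} \<subseteq> int ` ?D \<union> (\<lambda>d. - int d) ` ?D"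
  proof
    fix h assume "h \<in> {h::int. h dvd m}"
    then have "nat \<bar>h\<bar> \<in> ?D" by (simp add: nat_dvd_iff)
    moreover have "h = int (nat \<bar>h\<bar>) \<or> h = - int (nat \<bar>h\<bar>)" by auto
    ultimately show "h \<in> int ` ?D \<union> (\<lambda>d. - int d) ` ?D" by blast
  qed
  then show "finite {h::int. h dvd m}" using fin finite_subset by blast
  have "card {h::int. h dvd m} \<le> card (int ` ?D \<union> (\<lambda>d. - int d) ` ?D)"
    using sub fin by (intro card_mono) auto
  also have "\<dots> \<le> card (int ` ?D) + card ((\<lambda>d. - int d) ` ?D)" by (rule card_Un_le)
  also have "\<dots> \<le> card ?D + card ?D" using fin by (intro add_mono card_image_le)
  finally show "card {h::int. h dvd m} \<le> 2 * card ?D" by simp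
qed

lemma int_divisors_bound:
  fixes \<epsilon> B :: real
  assumes "\<epsilon> > 0" "B \<ge> 1"
  obtains C where "C \<ge> 1"
    "\<And>N m. N \<ge> 1 \<Longrightarrow> m \<noteq> 0 \<Longrightarrow> \<bar>real_of_int m\<bar> \<le> B * real N ^ k \<Longrightarrow>
       real (card {h::int. h dvd m}) \<le> C * real N powr \<epsilon>"
proof -
  \<comment> \<open>dividing by \<open>k + 1\<close> instead of \<open>k\<close> admits \<open>k = 0\<close>\<close>
  define \<delta> where "\<delta> = \<epsilon> / real (k + 1)"
  have \<delta>: "\<delta> > 0" using assms by (simp add: \<delta>_def)
  obtain C where C: "C \<ge> 1" "\<And>n::nat. n > 0 \<Longrightarrow> real (card {d. d dvd n}) \<le> C * real n powr \<delta>"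
    using divisor_bound[OF \<delta>] by blast
  show thesis
  proof (rule that[of "2 * C * B powr \<delta>"])
    have "1 * 1 \<le> C * B powr \<delta>" using C assms \<delta> by (intro mult_mono ge_one_powr_ge_zero) auto
    then show "2 * C * B powr \<delta> \<ge> 1" by simp
    fix N :: nat and m :: int assume N: "N \<ge> 1" and m: "m \<noteq> 0" "\<bar>real_of_int m\<bar> \<le> B * real N ^ k"
    have "real (nat \<bar>m\<bar>) powr \<delta> \<le> (B * real N ^ k) powr \<delta>"
      using m \<delta> by (intro powr_mono2) auto
    also have "\<dots> = B powr \<delta> * real N powr (real k * \<delta>)"
      using N assms by (simp add: powr_mult powr_powr flip: powr_realpow)
    also have "\<dots> \<le> B powr \<delta> * real N powr \<epsilon>"
      using N assms by (intro mult_left_mono powr_mono) (auto simp: \<delta>_def field_simps)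
    finally have 1: "real (nat \<bar>m\<bar>) powr \<delta> \<le> B powr \<delta> * real N powr \<epsilon>" .
    have "real (card {h::int. h dvd m}) \<le> 2 * real (card {d::nat. d dvd nat \<bar>m\<bar>})"
      using card_int_divisors_le[OF m(1)] by linarith
    also have "\<dots> \<le> 2 * (C * real (nat \<bar>m\<bar>) powr \<delta>)"
      using C(2)[of "nat \<bar>m\<bar>"] m by simp
    also have "\<dots> \<le> 2 * (C * (B powr \<delta> * real N powr \<epsilon>))"
      using 1 C by simp
    finally show "real (card {h::int. h dvd m}) \<le> 2 * C * B powr \<delta> * real N powr \<epsilon>" by simp
  qed
qed

lemma poly_growth_real:
  fixes p :: "int poly"
  obtains C :: real where "C \<ge> 1"
    "\<And>x N. N \<ge> 1 \<Longrightarrow> \<bar>x\<bar> \<le> int N \<Longrightarrow> \<bar>real_of_int (poly p x)\<bar> \<le> C * real N ^ degree p"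
proof -
  obtain C where C: "C \<ge> 1" "\<And>x N. N \<ge> 1 \<Longrightarrow> \<bar>x\<bar> \<le> int N \<Longrightarrow> \<bar>poly p x\<bar> \<le> C * int N ^ degree p"
    using poly_growth[of p] by blast
  show thesis
  proof (rule that[of "real_of_int C"])
    fix x and N :: nat assume "N \<ge> 1" "\<bar>x\<bar> \<le> int N"
    then have "real_of_int \<bar>poly p x\<bar> \<le> real_of_int (C * int N ^ degree p)"
      using C(2) by (simp only: of_int_le_iff)
    then show "\<bar>real_of_int (poly p x)\<bar> \<le> real_of_int C * real N ^ degree p" by simp
  qed (use C in simp)
qed

text \<open>
The part of \<open>\<parallel>a\<parallel>\<^sup>2\<close> that the extension operator sees.
\<close>

definition mass :: "nat \<Rightarrow> (int \<Rightarrow> complex) \<Rightarrow> real" where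
  "mass N a = (\<Sum>n\<in>window N. (cmod (a n))\<^sup>2)"

lemma mass_nonneg: "mass N a \<ge> 0"
  by (simp add: mass_def sum_nonneg)

text \<open>
The difference \<open>h\<close> of the two arguments divides \<open>m\<close>, which leaves \<open>O(N powr \<epsilon>)\<close> choices; for given
\<open>h\<close> the equation is a nonconstant polynomial equation of degree \<open>degree \<phi> - 1\<close>.
\<close>

lemma card_difference_fiber:
  fixes \<phi> :: "int poly" and \<epsilon> :: real
  assumes "degree \<phi> \<ge> 2" "\<epsilon> > 0"
  obtains C where "C \<ge> 1"
    "\<And>N m. N \<ge> 1 \<Longrightarrow> m \<noteq> 0 \<Longrightarrow>
      real (card {p \<in> window N \<times> window N. poly \<phi> (fst p) - poly \<phi> (snd p) = m}) \<le> C * real N powr \<epsilon>"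
proof -
  obtain B where B: "B \<ge> 1"
    "\<And>x N. N \<ge> 1 \<Longrightarrow> \<bar>x\<bar> \<le> int N \<Longrightarrow> \<bar>real_of_int (poly \<phi> x)\<bar> \<le> B * real N ^ degree \<phi>"
    using poly_growth_real[of \<phi>] by blast
  have "2 * B \<ge> 1" using B by simp
  obtain C where C: "C \<ge> 1"
    "\<And>N m. N \<ge> 1 \<Longrightarrow> m \<noteq> 0 \<Longrightarrow> \<bar>real_of_int m\<bar> \<le> 2 * B * real N ^ degree \<phi> \<Longrightarrow>
       real (card {h::int. h dvd m}) \<le> C * real N powr \<epsilon>"
    using int_divisors_bound[OF assms(2) \<open>2 * B \<ge> 1\<close>] by blast
  show thesis
  proof (rule that[of "real (degree \<phi>) * C"])
    have "1 * 1 \<le> real (degree \<phi>) * C" using assms C by (intro mult_mono) auto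
    then show "real (degree \<phi>) * C \<ge> 1" by simp
    fix N :: nat and m :: int assume N: "N \<ge> 1" and m: "m \<noteq> 0"
    let ?A = "{p \<in> window N \<times> window N. poly \<phi> (fst p) - poly \<phi> (snd p) = m}"
    show "real (card ?A) \<le> real (degree \<phi>) * C * real N powr \<epsilon>"
    proof (cases "?A = {}")
      case True
      show ?thesis unfolding True using C by simp
    next
      case False
      then obtain x y where xy: "x \<in> window N" "y \<in> window N" "poly \<phi> x - poly \<phi> y = m" by auto
      have "\<bar>real_of_int (poly \<phi> x)\<bar> \<le> B * real N ^ degree \<phi>" "\<bar>real_of_int (poly \<phi> y)\<bar> \<le> B * real N ^ degree \<phi>"
        using xy N by (auto intro!: B(2))
      moreover have "real_of_int m = real_of_int (poly \<phi> x) - real_of_int (poly \<phi> y)" using xy by simp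
      ultimately have mb: "\<bar>real_of_int m\<bar> \<le> 2 * B * real N ^ degree \<phi>" by linarith
      let ?D = "{h::int. h dvd m}"
      let ?R = "SIGMA h:?D. {n. poly (shift_diff h \<phi>) n = m}"
      have deg: "degree (shift_diff h \<phi>) = degree \<phi> - 1" if "h \<in> ?D" for h
        using degree_shift_diff(1)[of \<phi> "degree \<phi> - 1" h] assms that m by auto
      have fib: "finite {n. poly (shift_diff h \<phi>) n = m}" "card {n. poly (shift_diff h \<phi>) n = m} \<le> degree \<phi>"
        if "h \<in> ?D" for h
      proof -
        have d: "degree (shift_diff h \<phi>) \<ge> 1" "degree (shift_diff h \<phi>) \<le> degree \<phi>"
          using deg[OF that] assms by auto
        show "finite {n. poly (shift_diff h \<phi>) n = m}" "card {n. poly (shift_diff h \<phi>) n = m} \<le> degree \<phi>"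
          using card_poly_fiber[OF d(1), of m] d(2) by linarith+
      qed
      have fin: "finite ?R"
        using fib by (intro finite_SigmaI int_divisors_finite m)
      have "?A \<subseteq> (\<lambda>(h, n). (n + h, n)) ` ?R"
      proof
        fix p assume p: "p \<in> ?A"
        then have "(fst p - snd p, snd p) \<in> ?R" using poly_diff_dvd[of "fst p" "snd p" \<phi>] by (auto simp: poly_shift_diff)
        then show "p \<in> (\<lambda>(h, n). (n + h, n)) ` ?R" by (rule rev_image_eqI) auto
      qed
      then have "card ?A \<le> card ?R" using fin by (meson card_image_le card_mono finite_imageI le_trans)
      also have "\<dots> = (\<Sum>h\<in>?D. card {n. poly (shift_diff h \<phi>) n = m})"
        using fib by (intro card_SigmaI int_divisors_finite m) auto
      also have "\<dots> \<le> (\<Sum>h\<in>?D. degree \<phi>)"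
        by (intro sum_mono fib)
      finally have "real (card ?A) \<le> real (card ?D * degree \<phi>)"
        by (intro of_nat_mono) simp
      also have "\<dots> = real (degree \<phi>) * real (card ?D)" by simp
      also have "\<dots> \<le> real (degree \<phi>) * (C * real N powr \<epsilon>)"
        using C(2)[OF N m mb] by (intro mult_left_mono) auto
      finally show ?thesis by (simp add: mult.assoc)
    qed
  qed
qed

lemma sum_weights_on_level_pairs:
  fixes f :: "int \<Rightarrow> real" and \<phi> :: "int poly"
  assumes "degree \<phi> \<ge> 1" "\<And>n. f n \<ge> 0" "finite I"
  shows "(\<Sum>p\<in>{p \<in> I \<times> I. poly \<phi> (fst p) = poly \<phi> (snd p)}. f (fst p)) \<le> real (degree \<phi>) * (\<Sum>n\<in>I. f n)"
proof -
  have eq: "{p \<in> I \<times> I. poly \<phi> (fst p) = poly \<phi> (snd p)} = (SIGMA i:I. {j\<in>I. poly \<phi> j = poly \<phi> i})"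
    by auto
  have "(\<Sum>p\<in>{p \<in> I \<times> I. poly \<phi> (fst p) = poly \<phi> (snd p)}. f (fst p))
      = (\<Sum>i\<in>I. \<Sum>j\<in>{j\<in>I. poly \<phi> j = poly \<phi> i}. f i)"
    unfolding eq using assms(3) by (subst sum.Sigma) (auto simp: case_prod_unfold)
  also have "\<dots> \<le> (\<Sum>i\<in>I. real (degree \<phi>) * f i)"
  proof (rule sum_mono)
    fix i
    have "card {j\<in>I. poly \<phi> j = poly \<phi> i} \<le> card {j. poly \<phi> j = poly \<phi> i}"
      using card_poly_fiber(1)[OF assms(1)] by (intro card_mono) auto
    also have "\<dots> \<le> degree \<phi>" using card_poly_fiber(2)[OF assms(1)] .
    finally show "(\<Sum>j\<in>{j\<in>I. poly \<phi> j = poly \<phi> i}. f i) \<le> real (degree \<phi>) * f i"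
      using assms(2) by (simp add: mult_right_mono)
  qed
  finally show ?thesis by (simp add: sum_distrib_left)
qed

lemma trig_sum_cmod_square:
  "complex_of_real ((cmod (trig_sum I c f x))\<^sup>2)
    = trig_sum (I \<times> I) (\<lambda>p. c (fst p) * cnj (c (snd p))) (\<lambda>p. f (fst p) - f (snd p)) x"
  by (simp only: cmod_square_cnj trig_sum_mult_cnj case_prod_unfold)

lemma cmod_pow4_eq:
  "cmod (trig_sum I c f x) ^ 4
    = (cmod (trig_sum (I \<times> I) (\<lambda>p. c (fst p) * cnj (c (snd p))) (\<lambda>p. f (fst p) - f (snd p)) x))\<^sup>2"
  unfolding trig_sum_cmod_square[symmetric] by (simp add: norm_power)

text \<open>
By Parseval the fourth moment is a sum over frequencies \<open>m\<close>.  For \<open>m \<noteq> 0\<close> the Cauchy-Schwarz inequality costs the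
number of representations of \<open>m\<close>; for \<open>m = 0\<close> the inequality between the arithmetic and the geometric mean
suffices, since every argument has at most \<open>degree \<phi>\<close> partners.
\<close>

lemma L4_estimate:
  fixes \<phi> :: "int poly" and \<epsilon> :: real
  assumes "degree \<phi> \<ge> 2" "\<epsilon> > 0"
  obtains C where "C \<ge> 1"
    "\<And>N a. N \<ge> 1 \<Longrightarrow> (\<integral>x. cmod (extension_op N \<phi> a x) ^ 4 \<partial>circle) \<le> C * real N powr \<epsilon> * (mass N a)\<^sup>2"
proof -
  obtain C where C: "C \<ge> 1"
    "\<And>N m. N \<ge> 1 \<Longrightarrow> m \<noteq> 0 \<Longrightarrow>
      real (card {p \<in> window N \<times> window N. poly \<phi> (fst p) - poly \<phi> (snd p) = m}) \<le> C * real N powr \<epsilon>"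
    using card_difference_fiber[OF assms] by blast
  define k where "k = real (degree \<phi>)"
  have k: "k \<ge> 1" using assms by (simp add: k_def)
  show thesis
  proof (rule that[of "k\<^sup>2 + C"])
    show "k\<^sup>2 + C \<ge> 1" using C by (simp add: add_increasing)
    fix N :: nat and a :: "int \<Rightarrow> complex" assume N: "N \<ge> 1"
    let ?P = "window N \<times> window N"
    let ?c = "\<lambda>p. a (fst p) * cnj (a (snd p))" and ?f = "\<lambda>p. poly \<phi> (fst p) - poly \<phi> (snd p)"
    let ?Q = "\<lambda>m. {p \<in> ?P. ?f p = m}"
    have fin: "finite ?P" by simp
    have tot: "(\<Sum>p\<in>?P. (cmod (?c p))\<^sup>2) = (mass N a)\<^sup>2"
      by (simp add: mass_def power2_eq_square[of "sum _ _"] sum_product sum.cartesian_product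
          norm_mult power_mult_distrib case_prod_unfold)
    have level: "(cmod (\<Sum>p\<in>?Q m. ?c p))\<^sup>2
       \<le> (if m = 0 then k\<^sup>2 * (mass N a)\<^sup>2 else 0) + C * real N powr \<epsilon> * (\<Sum>p\<in>?Q m. (cmod (?c p))\<^sup>2)" for m
    proof (cases "m = 0")
      case False
      have "(cmod (\<Sum>p\<in>?Q m. ?c p))\<^sup>2 \<le> real (card (?Q m)) * (\<Sum>p\<in>?Q m. (cmod (?c p))\<^sup>2)"
        by (rule norm_sum_square_le)
      also have "\<dots> \<le> C * real N powr \<epsilon> * (\<Sum>p\<in>?Q m. (cmod (?c p))\<^sup>2)"
        using C(2)[OF N False] by (intro mult_right_mono sum_nonneg) auto
      finally show ?thesis using False by simp
    next
      case True
      \<comment> \<open>for \<open>m = 0\<close> the condition is symmetric in the two arguments\<close>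
      have sw: "(\<Sum>p\<in>?Q 0. (cmod (a (snd p)))\<^sup>2) = (\<Sum>p\<in>?Q 0. (cmod (a (fst p)))\<^sup>2)"
        by (rule sum.reindex_bij_witness[where i = prod.swap and j = prod.swap]) auto
      have eqQ: "?Q 0 = {p \<in> ?P. poly \<phi> (fst p) = poly \<phi> (snd p)}" by auto
      have "cmod (\<Sum>p\<in>?Q 0. ?c p) \<le> (\<Sum>p\<in>?Q 0. ((cmod (a (fst p)))\<^sup>2 + (cmod (a (snd p)))\<^sup>2) / 2)"
      proof (rule sum_norm_le)
        fix p
        have "0 \<le> (cmod (a (fst p)) - cmod (a (snd p)))\<^sup>2" by simp
        then show "cmod (?c p) \<le> ((cmod (a (fst p)))\<^sup>2 + (cmod (a (snd p)))\<^sup>2) / 2"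
          by (simp add: norm_mult power2_diff)
      qed
      also have "\<dots> = (\<Sum>p\<in>?Q 0. (cmod (a (fst p)))\<^sup>2)"
        using sw by (simp add: sum.distrib flip: sum_divide_distrib)
      also have "\<dots> \<le> k * mass N a"
        unfolding eqQ k_def mass_def using assms by (intro sum_weights_on_level_pairs) auto
      finally have "(cmod (\<Sum>p\<in>?Q 0. ?c p))\<^sup>2 \<le> (k * mass N a)\<^sup>2" by (intro power_mono) auto
      moreover have "0 \<le> C * real N powr \<epsilon> * (\<Sum>p\<in>?Q m. (cmod (?c p))\<^sup>2)"
        using C by (intro mult_nonneg_nonneg sum_nonneg) auto
      ultimately show ?thesis using True by (simp add: power_mult_distrib)
    qed
    have "(\<integral>x. cmod (extension_op N \<phi> a x) ^ 4 \<partial>circle) = (\<Sum>m\<in>?f ` ?P. (cmod (\<Sum>p\<in>?Q m. ?c p))\<^sup>2)"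
      unfolding extension_op_eq_trig_sum cmod_pow4_eq by (rule parseval_trig_sum[OF fin])
    also have "\<dots> \<le> (\<Sum>m\<in>?f ` ?P. (if m = 0 then k\<^sup>2 * (mass N a)\<^sup>2 else 0) + C * real N powr \<epsilon> * (\<Sum>p\<in>?Q m. (cmod (?c p))\<^sup>2))"
      by (intro sum_mono level)
    also have "\<dots> = (\<Sum>m\<in>?f ` ?P. if m = 0 then k\<^sup>2 * (mass N a)\<^sup>2 else 0)
        + C * real N powr \<epsilon> * (\<Sum>m\<in>?f ` ?P. \<Sum>p\<in>?Q m. (cmod (?c p))\<^sup>2)"
      by (simp only: sum.distrib sum_distrib_left)
    also have "(\<Sum>m\<in>?f ` ?P. \<Sum>p\<in>?Q m. (cmod (?c p))\<^sup>2) = (mass N a)\<^sup>2"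
      unfolding tot[symmetric] by (rule sum.image_gen[OF fin, symmetric])
    also have "(\<Sum>m\<in>?f ` ?P. if m = 0 then k\<^sup>2 * (mass N a)\<^sup>2 else 0) \<le> k\<^sup>2 * (mass N a)\<^sup>2"
      by (subst sum.delta) auto
    also have "k\<^sup>2 * (mass N a)\<^sup>2 + C * real N powr \<epsilon> * (mass N a)\<^sup>2 \<le> (k\<^sup>2 + C) * real N powr \<epsilon> * (mass N a)\<^sup>2"
    proof -
      have "1 \<le> real N powr \<epsilon>" using N assms by (intro ge_one_powr_ge_zero) auto
      then have "k\<^sup>2 * (mass N a)\<^sup>2 * 1 \<le> k\<^sup>2 * (mass N a)\<^sup>2 * real N powr \<epsilon>" by (intro mult_left_mono) auto
      then show ?thesis by (simp add: algebra_simps)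
    qed
    finally show "(\<integral>x. cmod (extension_op N \<phi> a x) ^ 4 \<partial>circle) \<le> (k\<^sup>2 + C) * real N powr \<epsilon> * (mass N a)\<^sup>2"
      by simp
  qed
qed

lemma second_difference_e_char:
  fixes \<phi> :: "int poly" and x :: real
  defines "f \<equiv> \<lambda>h n. e_char (x * poly \<phi> (n + h)) * cnj (e_char (x * poly \<phi> n))"
  shows "f h (n + l) * cnj (f h n) = e_char (x * of_int (poly (shift_diff l (shift_diff h \<phi>)) n))"
proof -
  have "f h n = e_char (x * of_int (poly (shift_diff h \<phi>) n))" for n
    by (simp add: f_def e_char_diff[symmetric] poly_shift_diff right_diff_distrib)
  then show ?thesis
    by (simp add: e_char_diff[symmetric] poly_shift_diff right_diff_distrib)
qed

section \<open>The eighth moment of an indicator function\<close>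

text \<open>
The four arguments \<open>n, n + h, n + l, n + l + h\<close> of a second difference have to lie in \<open>S\<close>.  The step
\<open>h = 0\<close> is split off beforehand, whereas \<open>l = 0\<close> stays and is counted among the zeros of the phase.
\<close>

definition hua_index :: "nat \<Rightarrow> int set \<Rightarrow> (int \<times> int \<times> int) set" where
  "hua_index N S = (SIGMA h:window (2 * N) - {0}. SIGMA l:window (2 * N).
      {n\<in>S. n + h \<in> S \<and> n + l \<in> S \<and> n + l + h \<in> S})"

definition hua_phase :: "int poly \<Rightarrow> int \<times> int \<times> int \<Rightarrow> int" where
  "hua_phase \<phi> = (\<lambda>(h, l, n). poly (shift_diff l (shift_diff h \<phi>)) n)"

lemma finite_hua_index: "finite S \<Longrightarrow> finite (hua_index N S)"
  unfolding hua_index_def by (intro finite_SigmaI) auto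

text \<open>
The first differencing separates the diagonal \<open>h = 0\<close>, which contributes \<open>card S\<close>; the \<open>4 * N\<close> remaining
values of \<open>h\<close> are handled by the Cauchy-Schwarz inequality and a second differencing.
\<close>

lemma hua_pointwise:
  fixes \<phi> :: "int poly"
  assumes S: "S \<subseteq> window N"
  shows "cmod (trig_sum S (\<lambda>_. 1) (poly \<phi>) x) ^ 4
     \<le> 2 * (real (card S))\<^sup>2 + 8 * real N * Re (trig_sum (hua_index N S) (\<lambda>_. 1) (hua_phase \<phi>) x)"
proof -
  let ?F = "trig_sum S (\<lambda>_. 1) (poly \<phi>) x"
  let ?H = "window (2 * N) - {0}"
  have fin: "finite S" using S by (rule finite_subset) simp
  define f where "f = (\<lambda>h n. e_char (x * poly \<phi> (n + h)) * cnj (e_char (x * poly \<phi> n)))"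
  define G where "G h = (\<Sum>n\<in>{n\<in>S. n + h \<in> S}. f h n)" for h
  have "complex_of_real ((cmod ?F)\<^sup>2) = (\<Sum>h\<in>window (2 * N). G h)"
    unfolding trig_sum_def G_def f_def mult_1_left by (rule weyl_differencing[OF S])
  also have "\<dots> = G 0 + (\<Sum>h\<in>?H. G h)"
    by (rule sum.remove) auto
  also have "G 0 = of_real (real (card S))"
    by (simp add: G_def f_def cmod_square_cnj[symmetric])
  finally have eq: "complex_of_real ((cmod ?F)\<^sup>2) = of_real (real (card S)) + (\<Sum>h\<in>?H. G h)" .
  have "(cmod ?F)\<^sup>2 = cmod (complex_of_real ((cmod ?F)\<^sup>2))" by (simp del: of_real_power)
  also have "\<dots> \<le> real (card S) + cmod (\<Sum>h\<in>?H. G h)"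
    unfolding eq by (rule order_trans[OF norm_triangle_ineq]) simp
  finally have "((cmod ?F)\<^sup>2)\<^sup>2 \<le> (real (card S) + cmod (\<Sum>h\<in>?H. G h))\<^sup>2"
    by (intro power_mono) auto
  also have "\<dots> \<le> 2 * (real (card S))\<^sup>2 + 2 * (cmod (\<Sum>h\<in>?H. G h))\<^sup>2"
    using sum_squares_bound[of "real (card S)" "cmod (\<Sum>h\<in>?H. G h)"] by (simp add: power2_sum)
  also have "(cmod (\<Sum>h\<in>?H. G h))\<^sup>2 \<le> real (card ?H) * (\<Sum>h\<in>?H. (cmod (G h))\<^sup>2)"
    by (rule norm_sum_square_le)
  also have "real (card ?H) = 4 * real N" by (simp add: card_Diff_singleton)
  also have "(\<Sum>h\<in>?H. (cmod (G h))\<^sup>2) = Re (trig_sum (hua_index N S) (\<lambda>_. 1) (hua_phase \<phi>) x)"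
  proof -
    have "complex_of_real (\<Sum>h\<in>?H. (cmod (G h))\<^sup>2)
        = (\<Sum>h\<in>?H. \<Sum>l\<in>window (2 * N). \<Sum>n\<in>{n\<in>S. n + h \<in> S \<and> n + l \<in> S \<and> n + l + h \<in> S}.
              e_char (x * of_int (hua_phase \<phi> (h, l, n))))"
      unfolding of_real_sum
    proof (rule sum.cong)
      fix h
      have "complex_of_real ((cmod (G h))\<^sup>2)
        = (\<Sum>l\<in>window (2 * N). \<Sum>n\<in>{n \<in> {n\<in>S. n + h \<in> S}. n + l \<in> {n\<in>S. n + h \<in> S}}. f h (n + l) * cnj (f h n))"
        unfolding G_def by (rule weyl_differencing) (use S in auto)
      also have "\<dots> = (\<Sum>l\<in>window (2 * N). \<Sum>n\<in>{n\<in>S. n + h \<in> S \<and> n + l \<in> S \<and> n + l + h \<in> S}.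
              e_char (x * of_int (hua_phase \<phi> (h, l, n))))"
        unfolding f_def second_difference_e_char
        by (intro sum.cong) (auto simp: hua_phase_def)
      finally show "complex_of_real ((cmod (G h))\<^sup>2)
        = (\<Sum>l\<in>window (2 * N). \<Sum>n\<in>{n\<in>S. n + h \<in> S \<and> n + l \<in> S \<and> n + l + h \<in> S}.
              e_char (x * of_int (hua_phase \<phi> (h, l, n))))" .
    qed simp
    also have "\<dots> = trig_sum (hua_index N S) (\<lambda>_. 1) (hua_phase \<phi>) x"
      using fin by (simp add: trig_sum_def hua_index_def sum.Sigma case_prod_unfold)
    finally have E: "complex_of_real (\<Sum>h\<in>?H. (cmod (G h))\<^sup>2) = trig_sum (hua_index N S) (\<lambda>_. 1) (hua_phase \<phi>) x" .
    show ?thesis by (simp only: E[symmetric] Re_complex_of_real)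
  qed
  finally show ?thesis by (simp add: power2_eq_square[of "_\<^sup>2"] power4_eq_xxxx power2_eq_square mult_ac)
qed

lemma degree_second_difference:
  fixes \<phi> :: "int poly"
  assumes "degree \<phi> \<ge> 3" "h \<noteq> 0" "l \<noteq> 0"
  shows "degree (shift_diff l (shift_diff h \<phi>)) = degree \<phi> - 2"
proof -
  have "degree (shift_diff h \<phi>) = degree \<phi> - 1"
    using degree_shift_diff(1)[of \<phi> "degree \<phi> - 1" h] assms by simp
  then show ?thesis
    using degree_shift_diff(1)[of "shift_diff h \<phi>" "degree \<phi> - 2" l] assms by simp
qed

text \<open>
The pair \<open>(n + h, n)\<close> ranges over pairs of distinct elements of \<open>S\<close>.  For a given pair the phase vanishes
only if \<open>n + l\<close> lies in one fiber of a nonconstant polynomial.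
\<close>

lemma card_hua_phase_zero:
  fixes \<phi> :: "int poly"
  assumes "degree \<phi> \<ge> 3" "finite S"
  shows "card {w \<in> hua_index N S. hua_phase \<phi> w = 0} \<le> degree \<phi> * (card S)\<^sup>2"
proof -
  let ?q = "\<lambda>p. shift_diff (fst p - snd p) \<phi>"
  let ?D = "{p \<in> S \<times> S. fst p \<noteq> snd p}"
  let ?B = "\<lambda>p. {y. poly (?q p) y = poly (?q p) (snd p)}"
  have fib: "finite (?B p)" "card (?B p) \<le> degree \<phi>" if "p \<in> ?D" for p
  proof -
    have "degree (?q p) = degree \<phi> - 1"
      using degree_shift_diff(1)[of \<phi> "degree \<phi> - 1" "fst p - snd p"] assms that by simp
    then have d: "degree (?q p) \<ge> 1" "degree (?q p) \<le> degree \<phi>" using assms by auto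
    show "finite (?B p)" "card (?B p) \<le> degree \<phi>"
      using card_poly_fiber[OF d(1), of "poly (?q p) (snd p)"] d(2) by linarith+
  qed
  have finD: "finite ?D" by (rule finite_subset[of _ "S \<times> S"]) (use assms in auto)
  have fin: "finite (Sigma ?D ?B)" using finD fib by (intro finite_SigmaI)
  have "{w \<in> hua_index N S. hua_phase \<phi> w = 0} \<subseteq> (\<lambda>(p, y). (fst p - snd p, y - snd p, snd p)) ` Sigma ?D ?B"
  proof
    fix w assume "w \<in> {w \<in> hua_index N S. hua_phase \<phi> w = 0}"
    then obtain h l n where w: "w = (h, l, n)" "h \<noteq> 0" "n \<in> S" "n + h \<in> S"
      "poly (shift_diff l (shift_diff h \<phi>)) n = 0"
      by (auto simp: hua_index_def hua_phase_def)
    then have "((n + h, n), n + l) \<in> Sigma ?D ?B"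
      by (simp add: poly_shift_diff[of l])
    then show "w \<in> (\<lambda>(p, y). (fst p - snd p, y - snd p, snd p)) ` Sigma ?D ?B"
      by (rule rev_image_eqI) (simp add: w)
  qed
  then have "card {w \<in> hua_index N S. hua_phase \<phi> w = 0} \<le> card (Sigma ?D ?B)"
    using fin by (meson card_image_le card_mono finite_imageI le_trans)
  also have "\<dots> = (\<Sum>p\<in>?D. card (?B p))" using finD fib by (intro card_SigmaI) auto
  also have "\<dots> \<le> (\<Sum>p\<in>?D. degree \<phi>)" by (intro sum_mono fib)
  also have "\<dots> = degree \<phi> * card ?D" by simp
  also have "\<dots> \<le> degree \<phi> * card (S \<times> S)"
    using assms by (intro mult_left_mono card_mono) auto
  finally show ?thesis by (simp add: power2_eq_square card_cartesian_product)
qed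

text \<open>
Both \<open>h\<close> and \<open>l\<close> divide the phase, and for given \<open>h\<close> and \<open>l\<close> the phase is a polynomial of degree
\<open>degree \<phi> - 2\<close> in \<open>n\<close>; this is where \<open>degree \<phi> \<ge> 3\<close> is needed.
\<close>

lemma card_hua_phase_nonzero:
  fixes \<phi> :: "int poly" and \<epsilon> :: real
  assumes "degree \<phi> \<ge> 3" "\<epsilon> > 0"
  obtains C where "C \<ge> 1"
    "\<And>N S m. N \<ge> 1 \<Longrightarrow> S \<subseteq> window N \<Longrightarrow> m \<noteq> 0 \<Longrightarrow>
      real (card {w \<in> hua_index N S. hua_phase \<phi> w = m}) \<le> C * real N powr \<epsilon>"
proof -
  obtain B where B: "B \<ge> 1"
    "\<And>x N. N \<ge> 1 \<Longrightarrow> \<bar>x\<bar> \<le> int N \<Longrightarrow> \<bar>real_of_int (poly \<phi> x)\<bar> \<le> B * real N ^ degree \<phi>"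
    using poly_growth_real[of \<phi>] by blast
  have B4: "4 * B \<ge> 1" using B by simp
  have e2: "\<epsilon> / 2 > 0" using assms by simp
  obtain C where C: "C \<ge> 1"
    "\<And>N m. N \<ge> 1 \<Longrightarrow> m \<noteq> 0 \<Longrightarrow> \<bar>real_of_int m\<bar> \<le> 4 * B * real N ^ degree \<phi> \<Longrightarrow>
       real (card {h::int. h dvd m}) \<le> C * real N powr (\<epsilon> / 2)"
    using int_divisors_bound[OF e2 B4] by blast
  define k where "k = real (degree \<phi>)"
  have k: "k \<ge> 1" using assms by (simp add: k_def)
  show thesis
  proof (rule that[of "k * C\<^sup>2"])
    have "1 * 1 \<le> k * C\<^sup>2" using k C by (intro mult_mono) auto
    then show "k * C\<^sup>2 \<ge> 1" by simp
    fix N :: nat and S :: "int set" and m :: int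
    assume N: "N \<ge> 1" and S: "S \<subseteq> window N" and m: "m \<noteq> 0"
    let ?A = "{w \<in> hua_index N S. hua_phase \<phi> w = m}"
    let ?D = "{h::int. h dvd m}"
    let ?p = "\<lambda>hl. shift_diff (snd hl) (shift_diff (fst hl) \<phi>)"
    let ?R = "SIGMA hl:?D \<times> ?D. {n. poly (?p hl) n = m}"
    show "real (card ?A) \<le> k * C\<^sup>2 * real N powr \<epsilon>"
    proof (cases "?A = {}")
      case True
      show ?thesis unfolding True using C k by simp
    next
      case False
      then obtain h l n where w: "n \<in> S" "n + h \<in> S" "n + l \<in> S" "n + l + h \<in> S"
        "poly (shift_diff l (shift_diff h \<phi>)) n = m"
        by (auto simp: hua_index_def hua_phase_def)
      have "\<bar>real_of_int (poly \<phi> y)\<bar> \<le> B * real N ^ degree \<phi>" if "y \<in> S" for y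
      proof -
        have "y \<in> window N" using S that by auto
        then show ?thesis using N by (intro B(2)) auto
      qed
      from this[OF w(1)] this[OF w(2)] this[OF w(3)] this[OF w(4)]
      have "\<bar>real_of_int (poly \<phi> (n + l + h)) - real_of_int (poly \<phi> (n + l))
          - (real_of_int (poly \<phi> (n + h)) - real_of_int (poly \<phi> n))\<bar> \<le> 4 * (B * real N ^ degree \<phi>)"
        by linarith
      moreover have "real_of_int m = real_of_int (poly \<phi> (n + l + h)) - real_of_int (poly \<phi> (n + l))
          - (real_of_int (poly \<phi> (n + h)) - real_of_int (poly \<phi> n))"
        unfolding w(5)[symmetric] by (simp add: poly_shift_diff)
      ultimately have mb: "\<bar>real_of_int m\<bar> \<le> 4 * B * real N ^ degree \<phi>" by simp
      have finD: "finite (?D \<times> ?D)" using int_divisors_finite[OF m] by simp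
      have fib: "finite {n. poly (?p hl) n = m}" "card {n. poly (?p hl) n = m} \<le> degree \<phi>"
        if "hl \<in> ?D \<times> ?D" for hl
      proof -
        have "fst hl \<noteq> 0" "snd hl \<noteq> 0" using that m by auto
        then have "degree (?p hl) = degree \<phi> - 2" by (intro degree_second_difference assms)
        then have d: "degree (?p hl) \<ge> 1" "degree (?p hl) \<le> degree \<phi>" using assms by auto
        show "finite {n. poly (?p hl) n = m}" "card {n. poly (?p hl) n = m} \<le> degree \<phi>"
          using card_poly_fiber[OF d(1), of m] d(2) by linarith+
      qed
      have fin: "finite ?R" by (rule finite_SigmaI[OF finD fib(1)])
      have "?A \<subseteq> (\<lambda>(hl, n). (fst hl, snd hl, n)) ` ?R"
      proof
        fix w assume "w \<in> ?A"
        then have "hua_phase \<phi> w = m" by simp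
        moreover obtain h l n where w: "w = (h, l, n)" by (cases w) auto
        ultimately have pm: "poly (shift_diff l (shift_diff h \<phi>)) n = m"
          by (simp add: hua_phase_def)
        have "l dvd m"
          using poly_diff_dvd[of "n + l" n "shift_diff h \<phi>"] pm by (simp add: poly_shift_diff[of l])
        moreover have "h dvd m"
        proof -
          have "h dvd poly \<phi> (n + l + h) - poly \<phi> (n + l)" "h dvd poly \<phi> (n + h) - poly \<phi> n"
            using poly_diff_dvd[of "n + l + h" "n + l" \<phi>] poly_diff_dvd[of "n + h" n \<phi>] by simp_all
          then show ?thesis unfolding pm[symmetric] poly_shift_diff by (rule dvd_diff)
        qed
        ultimately have "((h, l), n) \<in> ?R" using pm by simp
        then show "w \<in> (\<lambda>(hl, n). (fst hl, snd hl, n)) ` ?R" by (rule rev_image_eqI) (simp add: w)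
      qed
      then have "card ?A \<le> card ?R" using fin by (meson card_image_le card_mono finite_imageI le_trans)
      also have "\<dots> = (\<Sum>hl\<in>?D \<times> ?D. card {n. poly (?p hl) n = m})"
        using fib by (intro card_SigmaI finD) blast
      also have "\<dots> \<le> (\<Sum>hl\<in>?D \<times> ?D. degree \<phi>)" by (intro sum_mono fib)
      also have "\<dots> = degree \<phi> * (card ?D)\<^sup>2" by (simp add: card_cartesian_product power2_eq_square)
      finally have "real (card ?A) \<le> real (degree \<phi> * (card ?D)\<^sup>2)" by (rule of_nat_mono)
      also have "\<dots> = k * (real (card ?D))\<^sup>2" by (simp add: k_def)
      also have "\<dots> \<le> k * (C * real N powr (\<epsilon> / 2))\<^sup>2"
        using C(2)[OF N m mb] k by (intro mult_left_mono power_mono) auto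
      also have "\<dots> = k * C\<^sup>2 * real N powr \<epsilon>"
        by (simp add: power_mult_distrib power2_eq_square[of "_ powr _"] flip: powr_add)
      finally show ?thesis .
    qed
  qed
qed

lemma char_cmod4:
  "complex_of_real (cmod (trig_sum S (\<lambda>_. 1) f x) ^ 4)
    = trig_sum ((S \<times> S) \<times> (S \<times> S)) (\<lambda>_. 1) (\<lambda>q. (f (fst (fst q)) - f (snd (fst q))) - (f (fst (snd q)) - f (snd (snd q)))) x"
  unfolding cmod_pow4_eq trig_sum_cmod_square by simp

lemma trig_sum_indicator:
  assumes "S \<subseteq> I" "finite I"
  shows "trig_sum I (\<lambda>n. if n \<in> S then c n else 0) f = trig_sum S c f"
proof
  fix x
  show "trig_sum I (\<lambda>n. if n \<in> S then c n else 0) f x = trig_sum S c f x"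
    unfolding trig_sum_def using assms by (intro sum.mono_neutral_cong_right) auto
qed

text \<open>
Multiplying the pointwise bound for \<open>cmod (F x) ^ 4\<close> by \<open>cmod (F x) ^ 4\<close> and integrating leaves the fourth moment
and the number of coincidences between second differences and the frequencies \<open>?g q\<close> of
\<open>cmod (F x) ^ 4\<close>.  Quadruples with \<open>?g q = 0\<close> are rare, as they are counted by the fourth moment, and
compensate for the many zeros of the phase.
\<close>

lemma L8_characteristic:
  fixes \<phi> :: "int poly" and \<epsilon> :: real
  assumes "degree \<phi> \<ge> 3" "\<epsilon> > 0"
  obtains C where "C \<ge> 1"
    "\<And>N S. N \<ge> 1 \<Longrightarrow> S \<subseteq> window N \<Longrightarrow>
       (\<integral>x. cmod (trig_sum S (\<lambda>_. 1) (poly \<phi>) x) ^ 8 \<partial>circle) \<le> C * real N powr (1 + \<epsilon>) * real (card S) ^ 4"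
proof -
  have d2: "degree \<phi> \<ge> 2" using assms by simp
  obtain C4 where C4: "C4 \<ge> 1"
    "\<And>N a. N \<ge> 1 \<Longrightarrow> (\<integral>x. cmod (extension_op N \<phi> a x) ^ 4 \<partial>circle) \<le> C4 * real N powr \<epsilon> * (mass N a)\<^sup>2"
    using L4_estimate[OF d2 assms(2)] by blast
  obtain C where C: "C \<ge> 1"
    "\<And>N S m. N \<ge> 1 \<Longrightarrow> S \<subseteq> window N \<Longrightarrow> m \<noteq> 0 \<Longrightarrow>
      real (card {w \<in> hua_index N S. hua_phase \<phi> w = m}) \<le> C * real N powr \<epsilon>"
    using card_hua_phase_nonzero[OF assms] by blast
  define k where "k = real (degree \<phi>)"
  have k: "k \<ge> 1" using assms by (simp add: k_def)
  show thesis
  proof (rule that[of "2 * C4 + 8 * (C4 * k + C)"])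
    show "2 * C4 + 8 * (C4 * k + C) \<ge> 1" using C4 C k by (simp add: add_increasing2)
    fix N :: nat and S :: "int set" assume N: "N \<ge> 1" and S: "S \<subseteq> window N"
    have fin: "finite S" using S by (rule finite_subset) simp
    define s where "s = real (card S)"
    let ?F = "trig_sum S (\<lambda>_. 1) (poly \<phi>)"
    let ?W = "hua_index N S" and ?\<psi> = "hua_phase \<phi>"
    let ?Q = "(S \<times> S) \<times> (S \<times> S)"
    let ?g = "\<lambda>q. (poly \<phi> (fst (fst q)) - poly \<phi> (snd (fst q))) - (poly \<phi> (fst (snd q)) - poly \<phi> (snd (snd q)))"
    let ?tW = "trig_sum ?W (\<lambda>_. 1) ?\<psi>"
    have finQ: "finite ?Q" and finW: "finite ?W" using fin finite_hua_index by auto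
    define I4 where "I4 = (\<integral>x. cmod (?F x) ^ 4 \<partial>circle)"
    have I4: "I4 \<le> C4 * real N powr \<epsilon> * s\<^sup>2"
    proof -
      have "extension_op N \<phi> (\<lambda>n. if n \<in> S then 1 else 0) = ?F"
        unfolding extension_op_eq_trig_sum by (rule trig_sum_indicator[OF S]) simp
      moreover have "mass N (\<lambda>n. if n \<in> S then 1 else 0) = s"
      proof -
        have "mass N (\<lambda>n. if n \<in> S then 1 else 0) = (\<Sum>n\<in>window N. if n \<in> S then 1 else 0)"
          unfolding mass_def by (intro sum.cong) auto
        also have "\<dots> = real (card (window N \<inter> S))" by (simp add: sum.If_cases)
        also have "window N \<inter> S = S" using S by auto
        finally show ?thesis by (simp add: s_def)
      qed
      ultimately show ?thesis using C4(2)[OF N, of "\<lambda>n. if n \<in> S then 1 else 0"] by (simp add: I4_def)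
    qed
    have I4_card: "I4 = real (card {q \<in> ?Q. ?g q = 0})"
    proof -
      have "complex_of_real I4 = (\<integral>x. complex_of_real (cmod (?F x) ^ 4) \<partial>circle)"
        unfolding I4_def by (rule integral_complex_of_real[symmetric])
      also have "\<dots> = of_nat (card {q \<in> ?Q. ?g q = 0})"
        unfolding char_cmod4 integral_trig_sum[OF finQ] by simp
      finally have "complex_of_real I4 = complex_of_real (real (card {q \<in> ?Q. ?g q = 0}))"
        by (simp only: of_real_of_nat_eq)
      then show ?thesis by (simp only: of_real_eq_iff)
    qed
    have cross: "(\<integral>x. Re (?tW x) * cmod (?F x) ^ 4 \<partial>circle) \<le> (C4 * k + C) * real N powr \<epsilon> * s ^ 4"
    proof -
      let ?Z = "{z \<in> ?W \<times> ?Q. ?\<psi> (fst z) + ?g (snd z) = 0}"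
      have prod: "?tW x * complex_of_real (cmod (?F x) ^ 4)
          = trig_sum (?W \<times> ?Q) (\<lambda>_. 1) (\<lambda>z. ?\<psi> (fst z) + ?g (snd z)) x" for x
        unfolding char_cmod4 trig_sum_mult by (simp add: case_prod_unfold)
      have int: "integrable circle (trig_sum (?W \<times> ?Q) (\<lambda>_. 1) (\<lambda>z. ?\<psi> (fst z) + ?g (snd z)))"
        by (rule integrable_circle_bounded[OF _ norm_trig_sum_le]) (rule measurable_circleI, measurable)
      have "(\<integral>x. Re (?tW x) * cmod (?F x) ^ 4 \<partial>circle)
          = (\<integral>x. Re (trig_sum (?W \<times> ?Q) (\<lambda>_. 1) (\<lambda>z. ?\<psi> (fst z) + ?g (snd z)) x) \<partial>circle)"
        unfolding prod[symmetric] by (simp add: Re_complex_of_real times_complex.simps)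
      also have "\<dots> = Re (\<integral>x. trig_sum (?W \<times> ?Q) (\<lambda>_. 1) (\<lambda>z. ?\<psi> (fst z) + ?g (snd z)) x \<partial>circle)"
        by (rule integral_Re[OF int])
      also have "\<dots> = real (card ?Z)"
        using finW finQ by (subst integral_trig_sum) auto
      also have "card ?Z \<le> (\<Sum>q\<in>?Q. card {w\<in>?W. ?\<psi> w = - ?g q})"
      proof -
        have "?Z \<subseteq> prod.swap ` (SIGMA q:?Q. {w\<in>?W. ?\<psi> w = - ?g q})"
        proof
          fix z assume "z \<in> ?Z"
          then have "prod.swap z \<in> (SIGMA q:?Q. {w\<in>?W. ?\<psi> w = - ?g q})" by (cases z) auto
          then show "z \<in> prod.swap ` (SIGMA q:?Q. {w\<in>?W. ?\<psi> w = - ?g q})"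
            by (rule rev_image_eqI) simp
        qed
        moreover have finS: "finite (SIGMA q:?Q. {w\<in>?W. ?\<psi> w = - ?g q})"
          by (rule finite_SigmaI[OF finQ]) (use finW in auto)
        ultimately have "card ?Z \<le> card (SIGMA q:?Q. {w\<in>?W. ?\<psi> w = - ?g q})"
          by (meson card_image_le card_mono finite_imageI le_trans)
        also have "\<dots> = (\<Sum>q\<in>?Q. card {w\<in>?W. ?\<psi> w = - ?g q})"
          by (rule card_SigmaI) (use fin finW in auto)
        finally show ?thesis .
      qed
      also have "real (\<Sum>q\<in>?Q. card {w\<in>?W. ?\<psi> w = - ?g q})
          \<le> (\<Sum>q\<in>?Q. (if ?g q = 0 then k * s\<^sup>2 else 0) + C * real N powr \<epsilon>)"
        unfolding of_nat_sum
      proof (rule sum_mono)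
        fix q
        show "real (card {w\<in>?W. ?\<psi> w = - ?g q}) \<le> (if ?g q = 0 then k * s\<^sup>2 else 0) + C * real N powr \<epsilon>"
        proof (cases "?g q = 0")
          case True
          have "real (card {w\<in>?W. ?\<psi> w = 0}) \<le> real (degree \<phi> * (card S)\<^sup>2)"
            using card_hua_phase_zero[OF assms(1) fin, of N] by (rule of_nat_mono)
          also have "\<dots> = k * s\<^sup>2" by (simp add: k_def s_def)
          finally show ?thesis using True C by (simp add: add_increasing2)
        next
          case False
          then have "- ?g q \<noteq> 0" by simp
          from C(2)[OF N S this] False show ?thesis by simp
        qed
      qed
      also have "\<dots> = I4 * (k * s\<^sup>2) + C * real N powr \<epsilon> * s ^ 4"
        using finQ unfolding I4_card sum.distrib
        by (simp add: sum.If_cases card_cartesian_product s_def power4_eq_xxxx Int_def)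
      also have "\<dots> \<le> (C4 * real N powr \<epsilon> * s\<^sup>2) * (k * s\<^sup>2) + C * real N powr \<epsilon> * s ^ 4"
        using I4 k by (intro add_right_mono mult_right_mono) auto
      also have "\<dots> = (C4 * k + C) * real N powr \<epsilon> * s ^ 4"
        by (simp add: algebra_simps power4_eq_xxxx power2_eq_square)
      finally show ?thesis by simp
    qed
    have int1: "integrable circle (\<lambda>x. Re (?tW x) * cmod (?F x) ^ 4)"
    proof (rule integrable_circle_bounded)
      show "(\<lambda>x. Re (?tW x) * cmod (?F x) ^ 4) \<in> borel_measurable circle"
        by (rule measurable_circleI) measurable
      fix x
      have "\<bar>Re (?tW x)\<bar> \<le> (\<Sum>i\<in>?W. cmod 1)"
        using abs_Re_le_cmod norm_trig_sum_le order_trans by blast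
      moreover have "cmod (?F x) ^ 4 \<le> (\<Sum>i\<in>S. cmod 1) ^ 4"
        by (intro power_mono norm_trig_sum_le) simp
      ultimately show "norm (Re (?tW x) * cmod (?F x) ^ 4) \<le> (\<Sum>i\<in>?W. cmod 1) * (\<Sum>i\<in>S. cmod 1) ^ 4"
        by (simp only: real_norm_def abs_mult abs_of_nonneg[of "_ ^ 4"] zero_le_power norm_ge_zero)
           (intro mult_mono, auto)
    qed
    have "(\<integral>x. cmod (?F x) ^ 8 \<partial>circle) \<le> (\<integral>x. 2 * s\<^sup>2 * cmod (?F x) ^ 4 + 8 * real N * (Re (?tW x) * cmod (?F x) ^ 4) \<partial>circle)"
    proof (rule integral_mono)
      fix x
      have "cmod (?F x) ^ 4 * cmod (?F x) ^ 4 \<le> (2 * s\<^sup>2 + 8 * real N * Re (?tW x)) * cmod (?F x) ^ 4"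
        using hua_pointwise[OF S, of \<phi> x] by (intro mult_right_mono) (auto simp: s_def)
      then show "cmod (?F x) ^ 8 \<le> 2 * s\<^sup>2 * cmod (?F x) ^ 4 + 8 * real N * (Re (?tW x) * cmod (?F x) ^ 4)"
        by (simp add: algebra_simps flip: power_add)
    qed (intro integrable_trig_sum_power Bochner_Integration.integrable_add integrable_mult_right int1)+
    also have "\<dots> = 2 * s\<^sup>2 * I4 + 8 * real N * (\<integral>x. Re (?tW x) * cmod (?F x) ^ 4 \<partial>circle)"
      unfolding I4_def using int1 integrable_trig_sum_power
      by (subst Bochner_Integration.integral_add) auto
    also have "\<dots> \<le> 2 * s\<^sup>2 * (C4 * real N powr \<epsilon> * s\<^sup>2) + 8 * real N * ((C4 * k + C) * real N powr \<epsilon> * s ^ 4)"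
      by (intro add_mono mult_left_mono I4 cross) auto
    also have "\<dots> \<le> 2 * s\<^sup>2 * (real N * (C4 * real N powr \<epsilon> * s\<^sup>2)) + 8 * real N * ((C4 * k + C) * real N powr \<epsilon> * s ^ 4)"
    proof -
      have "1 * (C4 * real N powr \<epsilon> * s\<^sup>2) \<le> real N * (C4 * real N powr \<epsilon> * s\<^sup>2)"
        using N C4 by (intro mult_right_mono) auto
      then show ?thesis by (intro add_right_mono mult_left_mono) auto
    qed
    also have "\<dots> = (2 * C4 + 8 * (C4 * k + C)) * (real N * real N powr \<epsilon>) * s ^ 4"
      by (simp add: algebra_simps power4_eq_xxxx power2_eq_square)
    also have "real N * real N powr \<epsilon> = real N powr (1 + \<epsilon>)"
      using N by (simp add: powr_add)
    finally show "(\<integral>x. cmod (?F x) ^ 8 \<partial>circle)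
        \<le> (2 * C4 + 8 * (C4 * k + C)) * real N powr (1 + \<epsilon>) * real (card S) ^ 4"
      by (simp add: s_def)
  qed
qed

section \<open>The eighth moment for general coefficients\<close>

lemma cmod_pow8_eq:
  "cmod (trig_sum I c f x) ^ 8
    = (cmod (trig_sum ((I \<times> I) \<times> (I \<times> I))
        (\<lambda>q. (c (fst (fst q)) * cnj (c (snd (fst q)))) * cnj (c (fst (snd q)) * cnj (c (snd (snd q)))))
        (\<lambda>q. (f (fst (fst q)) - f (snd (fst q))) - (f (fst (snd q)) - f (snd (snd q)))) x))\<^sup>2"
proof -
  let ?T = "trig_sum (I \<times> I) (\<lambda>p. c (fst p) * cnj (c (snd p))) (\<lambda>p. f (fst p) - f (snd p))"
  have "cmod (trig_sum I c f x) ^ 8 = (cmod (trig_sum I c f x) ^ 4)\<^sup>2"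
    by (simp flip: power_mult)
  also have "\<dots> = cmod (?T x) ^ 4"
    unfolding cmod_pow4_eq[of I] by (simp flip: power_mult)
  also have "\<dots> = (cmod (trig_sum ((I \<times> I) \<times> (I \<times> I))
        (\<lambda>q. (c (fst (fst q)) * cnj (c (snd (fst q)))) * cnj (c (fst (snd q)) * cnj (c (snd (snd q)))))
        (\<lambda>q. (f (fst (fst q)) - f (snd (fst q))) - (f (fst (snd q)) - f (snd (snd q)))) x))\<^sup>2"
    by (rule cmod_pow4_eq)
  finally show ?thesis .
qed

lemma trig_sum_scale: "trig_sum I (\<lambda>i. b * c i) f x = b * trig_sum I c f x"
  by (simp add: trig_sum_def sum_distrib_left mult.assoc)

text \<open>
The eighth power is the square of a trigonometric sum over quadruples, to which the majorant
principle applies.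
\<close>

lemma L8_bounded_coefficients:
  assumes "finite S" "\<Lambda> \<ge> 0" "\<And>n. n \<in> S \<Longrightarrow> cmod (a n) \<le> \<Lambda>"
  shows "(\<integral>x. cmod (trig_sum S a f x) ^ 8 \<partial>circle) \<le> \<Lambda> ^ 8 * (\<integral>x. cmod (trig_sum S (\<lambda>_. 1) f x) ^ 8 \<partial>circle)"
proof -
  let ?Q = "(S \<times> S) \<times> (S \<times> S)"
  let ?c = "\<lambda>q. (a (fst (fst q)) * cnj (a (snd (fst q)))) * cnj (a (fst (snd q)) * cnj (a (snd (snd q))))"
  let ?g = "\<lambda>q. (f (fst (fst q)) - f (snd (fst q))) - (f (fst (snd q)) - f (snd (snd q)))"
  have "(\<integral>x. cmod (trig_sum S a f x) ^ 8 \<partial>circle) = (\<integral>x. (cmod (trig_sum ?Q ?c ?g x))\<^sup>2 \<partial>circle)"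
    by (simp only: cmod_pow8_eq)
  also have "\<dots> \<le> (\<integral>x. (cmod (trig_sum ?Q (\<lambda>_. of_real (\<Lambda> ^ 4)) ?g x))\<^sup>2 \<partial>circle)"
  proof (rule trig_sum_majorant)
    fix q assume "q \<in> ?Q"
    then have "cmod (a (fst (fst q))) * cmod (a (snd (fst q))) * (cmod (a (fst (snd q))) * cmod (a (snd (snd q)))) \<le> \<Lambda> * \<Lambda> * (\<Lambda> * \<Lambda>)"
      using assms by (intro mult_mono mult_nonneg_nonneg) auto
    then show "cmod (?c q) \<le> \<Lambda> ^ 4"
      by (simp add: norm_mult power4_eq_xxxx mult_ac)
  qed (use assms in auto)
  also have "\<dots> = (\<integral>x. \<Lambda> ^ 8 * (cmod (trig_sum ?Q (\<lambda>_. 1) ?g x))\<^sup>2 \<partial>circle)"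
  proof (rule Bochner_Integration.integral_cong)
    fix x
    have "trig_sum ?Q (\<lambda>_. of_real (\<Lambda> ^ 4)) ?g x = of_real (\<Lambda> ^ 4) * trig_sum ?Q (\<lambda>_. 1) ?g x"
      using trig_sum_scale[of ?Q "of_real (\<Lambda> ^ 4)" "\<lambda>_. 1"] by simp
    then show "(cmod (trig_sum ?Q (\<lambda>_. of_real (\<Lambda> ^ 4)) ?g x))\<^sup>2 = \<Lambda> ^ 8 * (cmod (trig_sum ?Q (\<lambda>_. 1) ?g x))\<^sup>2"
      by (simp add: norm_mult norm_power power_mult_distrib flip: power_mult)
  qed simp
  also have "\<dots> = \<Lambda> ^ 8 * (\<integral>x. (cmod (trig_sum ?Q (\<lambda>_. 1) ?g x))\<^sup>2 \<partial>circle)"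
    by simp
  also have "(\<integral>x. (cmod (trig_sum ?Q (\<lambda>_. 1) ?g x))\<^sup>2 \<partial>circle) = (\<integral>x. cmod (trig_sum S (\<lambda>_. 1) f x) ^ 8 \<partial>circle)"
    unfolding cmod_pow8_eq by simp
  finally show ?thesis .
qed

lemma sum_power_le:
  fixes x :: "'i \<Rightarrow> real"
  assumes "finite I" "I \<noteq> {}" "\<And>i. i \<in> I \<Longrightarrow> x i \<ge> 0"
  shows "(\<Sum>i\<in>I. x i) ^ k \<le> real (card I) ^ k * (\<Sum>i\<in>I. x i ^ k)"
proof -
  have "Max (x ` I) \<in> x ` I" using assms by (intro Max_in) auto
  then obtain m where m: "m \<in> I" "Max (x ` I) = x m" by auto
  have le: "x i \<le> x m" if "i \<in> I" for i
    unfolding m(2)[symmetric] using assms that by (intro Max_ge) auto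
  have "(\<Sum>i\<in>I. x i) ^ k \<le> (\<Sum>i\<in>I. x m) ^ k"
    using le assms by (intro power_mono sum_mono sum_nonneg) auto
  also have "\<dots> = real (card I) ^ k * x m ^ k" by (simp add: power_mult_distrib)
  also have "\<dots> \<le> real (card I) ^ k * (\<Sum>i\<in>I. x i ^ k)"
    using assms m by (intro mult_left_mono member_le_sum) auto
  finally show ?thesis .
qed

lemma cmod_le_sqrt_mass: "n \<in> window N \<Longrightarrow> cmod (a n) \<le> sqrt (mass N a)"
  unfolding mass_def by (rule real_le_rsqrt) (rule member_le_sum, auto)

text \<open>
If \<open>cmod (a n)\<close> varies by a factor of at most \<open>\<rho>\<close> on \<open>S\<close>, then \<open>card S * \<Lambda>\<^sup>2\<close> is at most \<open>\<rho>\<^sup>2\<close> times the mass,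
and nothing else is lost by passing to the indicator function.
\<close>

lemma L8_level_set:
  fixes \<phi> :: "int poly"
  assumes C: "C \<ge> 0" "\<And>S. S \<subseteq> window N \<Longrightarrow>
       (\<integral>x. cmod (trig_sum S (\<lambda>_. 1) (poly \<phi>) x) ^ 8 \<partial>circle) \<le> C * real (card S) ^ 4"
    and S: "S \<subseteq> window N" "\<Lambda> \<ge> 0" "\<rho> \<ge> 0"
    and a: "\<And>n. n \<in> S \<Longrightarrow> cmod (a n) \<le> \<Lambda>" "\<And>n. n \<in> S \<Longrightarrow> \<Lambda> \<le> \<rho> * cmod (a n)"
  shows "(\<integral>x. cmod (trig_sum S a (poly \<phi>) x) ^ 8 \<partial>circle) \<le> C * \<rho> ^ 8 * mass N a ^ 4"
proof -
  have fin: "finite S" using S(1) by (rule finite_subset) simp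
  have "real (card S) * \<Lambda>\<^sup>2 = (\<Sum>n\<in>S. \<Lambda>\<^sup>2)" by simp
  also have "\<dots> \<le> (\<Sum>n\<in>S. (\<rho> * cmod (a n))\<^sup>2)"
    using a S by (intro sum_mono power_mono) auto
  also have "\<dots> = \<rho>\<^sup>2 * (\<Sum>n\<in>S. (cmod (a n))\<^sup>2)" by (simp add: power_mult_distrib sum_distrib_left)
  also have "\<dots> \<le> \<rho>\<^sup>2 * mass N a"
    unfolding mass_def using S by (intro mult_left_mono sum_mono2) auto
  finally have le: "real (card S) * \<Lambda>\<^sup>2 \<le> \<rho>\<^sup>2 * mass N a" .
  have "(\<integral>x. cmod (trig_sum S a (poly \<phi>) x) ^ 8 \<partial>circle)
      \<le> \<Lambda> ^ 8 * (\<integral>x. cmod (trig_sum S (\<lambda>_. 1) (poly \<phi>) x) ^ 8 \<partial>circle)"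
    by (rule L8_bounded_coefficients[OF fin S(2) a(1)])
  also have "\<dots> \<le> \<Lambda> ^ 8 * (C * real (card S) ^ 4)"
    by (intro mult_left_mono C S) simp
  also have "\<dots> = C * (real (card S) * \<Lambda>\<^sup>2) ^ 4"
    by (simp add: power_mult_distrib flip: power_mult)
  also have "\<dots> \<le> C * (\<rho>\<^sup>2 * mass N a) ^ 4"
    using le C by (intro mult_left_mono power_mono) auto
  also have "\<dots> = C * \<rho> ^ 8 * mass N a ^ 4"
    by (simp add: power_mult_distrib flip: power_mult)
  finally show ?thesis .
qed

text \<open>
The function \<open>lev\<close> sorts the window into \<open>J\<close> levels on which \<open>cmod (a n)\<close> varies by a factor
\<open>N powr \<delta>\<close>, and a rest where \<open>cmod (a n)\<close> is at most \<open>A / N\<close>, so that the trivial bound suffices.  As \<open>J\<close> depends only on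
\<open>\<epsilon>\<close>, the pieces may be added with a constant loss.
\<close>

lemma L8_estimate:
  fixes \<phi> :: "int poly" and \<epsilon> :: real
  assumes "degree \<phi> \<ge> 3" "\<epsilon> > 0"
  obtains C where "C \<ge> 1"
    "\<And>N a. N \<ge> 1 \<Longrightarrow> (\<integral>x. cmod (extension_op N \<phi> a x) ^ 8 \<partial>circle) \<le> C * real N powr (1 + \<epsilon>) * mass N a ^ 4"
proof -
  have e2: "\<epsilon> / 2 > 0" using assms by simp
  obtain C0 where C0: "C0 \<ge> 1"
    "\<And>N S. N \<ge> 1 \<Longrightarrow> S \<subseteq> window N \<Longrightarrow>
       (\<integral>x. cmod (trig_sum S (\<lambda>_. 1) (poly \<phi>) x) ^ 8 \<partial>circle) \<le> C0 * real N powr (1 + \<epsilon> / 2) * real (card S) ^ 4"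
    using L8_characteristic[OF assms(1) e2] by blast
  \<comment> \<open>the eighth power of the ratio \<open>N powr \<delta>\<close> costs \<open>N powr (\<epsilon> / 2)\<close>; the other half is spent on indicator functions\<close>
  define \<delta> where "\<delta> = \<epsilon> / 16"
  have \<delta>: "\<delta> > 0" using assms by (simp add: \<delta>_def)
  define J where "J = nat \<lceil>1 / \<delta>\<rceil>"
  have J: "\<delta> * real J \<ge> 1"
  proof -
    have "1 / \<delta> \<le> real J" unfolding J_def by linarith
    then show ?thesis using \<delta> by (simp add: field_simps)
  qed
  show thesis
  proof (rule that[of "real (J + 1) ^ 8 * (real (J + 1) * (C0 + 3 ^ 8))"])
    have "1 * (1 * 1) \<le> real (J + 1) ^ 8 * (real (J + 1) * (C0 + 3 ^ 8))"
      using C0 by (intro mult_mono one_le_power) auto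
    then show "1 \<le> real (J + 1) ^ 8 * (real (J + 1) * (C0 + 3 ^ 8))" by simp
    fix N :: nat and a :: "int \<Rightarrow> complex" assume N: "N \<ge> 1"
    define A where "A = sqrt (mass N a)"
    have A: "A \<ge> 0" "A ^ 8 = mass N a ^ 4"
    proof -
      show "A \<ge> 0" by (simp add: A_def mass_nonneg)
      have "A ^ 8 = (A\<^sup>2) ^ 4" by (simp flip: power_mult)
      then show "A ^ 8 = mass N a ^ 4" by (simp add: A_def mass_nonneg)
    qed
    define \<Lambda> where "\<Lambda> j = A * real N powr (- (\<delta> * real j))" for j
    have \<Lambda>: "\<Lambda> j \<ge> 0" for j using A by (simp add: \<Lambda>_def)
    have \<Lambda>_Suc: "\<Lambda> j = real N powr \<delta> * \<Lambda> (Suc j)" for j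
      by (simp add: \<Lambda>_def algebra_simps flip: powr_add)
    define lev where "lev n = (if cmod (a n) \<le> \<Lambda> J then J else LEAST j. \<Lambda> (Suc j) \<le> cmod (a n))" for n
    define S where "S j = {n \<in> window N. lev n = j}" for j
    have SW: "S j \<subseteq> window N" for j by (auto simp: S_def)
    have lev: "lev n < J \<and> \<Lambda> (Suc (lev n)) \<le> cmod (a n) \<and> cmod (a n) \<le> \<Lambda> (lev n)"
      if n: "n \<in> window N" and big: "\<not> cmod (a n) \<le> \<Lambda> J" for n
    proof -
      have "cmod (a n) \<le> \<Lambda> 0" using cmod_le_sqrt_mass[OF n, of a] N by (simp add: \<Lambda>_def A_def)
      then have "J \<noteq> 0" using big by (cases "J = 0") auto
      then obtain J' where J': "J = Suc J'" by (cases J) auto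
      have ex: "\<Lambda> (Suc J') \<le> cmod (a n)" using big J' by simp
      have l: "lev n = (LEAST j. \<Lambda> (Suc j) \<le> cmod (a n))" using big by (simp add: lev_def)
      have "lev n \<le> J'" unfolding l using ex by (rule Least_le)
      moreover have "\<Lambda> (Suc (lev n)) \<le> cmod (a n)" unfolding l using ex by (rule LeastI)
      moreover have "cmod (a n) \<le> \<Lambda> (lev n)"
      proof (cases "lev n")
        case 0
        then show ?thesis using \<open>cmod (a n) \<le> \<Lambda> 0\<close> by simp
      next
        case (Suc i)
        then have "\<not> \<Lambda> (Suc i) \<le> cmod (a n)" unfolding l by (metis lessI not_less_Least)
        then show ?thesis using Suc by simp
      qed
      ultimately show ?thesis using J' by simp
    qed
    have levJ: "lev n \<in> {..J}" if "n \<in> window N" for n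
      using lev[OF that] by (cases "cmod (a n) \<le> \<Lambda> J") (auto simp: lev_def)
    let ?t = "\<lambda>j x. trig_sum (S j) a (poly \<phi>) x"
    have split: "extension_op N \<phi> a x = (\<Sum>j\<in>{..J}. ?t j x)" for x
      unfolding extension_op_eq_trig_sum trig_sum_def S_def
      by (rule sum.group[symmetric]) (use levJ in auto)
    have NN: "1 \<le> real N powr (1 + \<epsilon>)" using N assms by (intro ge_one_powr_ge_zero) auto
    have piece: "(\<integral>x. cmod (?t j x) ^ 8 \<partial>circle) \<le> (C0 + 3 ^ 8) * real N powr (1 + \<epsilon>) * A ^ 8"
      if "j \<in> {..J}" for j
    proof (cases "j = J")
      case False
      have bd: "cmod (a n) \<le> \<Lambda> j" "\<Lambda> j \<le> real N powr \<delta> * cmod (a n)" if "n \<in> S j" for n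
      proof -
        have n: "n \<in> window N" "lev n = j" using that by (auto simp: S_def)
        have "\<not> cmod (a n) \<le> \<Lambda> J" using n False by (auto simp: lev_def)
        from lev[OF n(1) this] n have *: "\<Lambda> (Suc j) \<le> cmod (a n)" "cmod (a n) \<le> \<Lambda> j" by auto
        show "cmod (a n) \<le> \<Lambda> j" by fact
        show "\<Lambda> j \<le> real N powr \<delta> * cmod (a n)"
          unfolding \<Lambda>_Suc[of j] using * by (intro mult_left_mono) auto
      qed
      have "(\<integral>x. cmod (?t j x) ^ 8 \<partial>circle) \<le> (C0 * real N powr (1 + \<epsilon> / 2)) * (real N powr \<delta>) ^ 8 * mass N a ^ 4"
        by (rule L8_level_set[OF _ C0(2)[OF N] SW \<Lambda> _ bd]) (use C0 in auto)
      also have "(real N powr \<delta>) ^ 8 = real N powr (\<epsilon> / 2)"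
        using N by (simp add: \<delta>_def powr_powr flip: powr_realpow)
      also have "C0 * real N powr (1 + \<epsilon> / 2) * real N powr (\<epsilon> / 2) * mass N a ^ 4 = C0 * real N powr (1 + \<epsilon>) * A ^ 8"
        by (simp add: A(2) add.commute flip: powr_add)
      also have "\<dots> \<le> (C0 + 3 ^ 8) * real N powr (1 + \<epsilon>) * A ^ 8"
        using A by (intro mult_right_mono) auto
      finally show ?thesis .
    next
      case True
      have small: "cmod (a n) \<le> A / real N" if "n \<in> S J" for n
      proof -
        have "cmod (a n) \<le> \<Lambda> J"
          using that lev[of n] by (cases "cmod (a n) \<le> \<Lambda> J") (auto simp: S_def)
        also have "\<dots> \<le> A * real N powr (- 1)"
          unfolding \<Lambda>_def using J A N by (intro mult_left_mono powr_mono) auto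
        finally show ?thesis using N by (simp add: powr_minus_divide)
      qed
      have sup: "cmod (?t J x) \<le> 3 * A" for x
      proof -
        have "cmod (?t J x) \<le> (\<Sum>n\<in>S J. cmod (a n))" by (rule norm_trig_sum_le)
        also have "\<dots> \<le> (\<Sum>n\<in>S J. A / real N)" by (intro sum_mono small)
        also have "\<dots> \<le> (\<Sum>n\<in>window N. A / real N)"
          using SW A by (intro sum_mono2) auto
        also have "\<dots> = real (2 * N + 1) * (A / real N)" by (simp add: nat_add_distrib)
        also have "\<dots> \<le> real (3 * N) * (A / real N)"
          using N A by (intro mult_right_mono) auto
        also have "\<dots> = 3 * A" using N by simp
        finally show ?thesis .
      qed
      have "(\<integral>x. cmod (?t J x) ^ 8 \<partial>circle) \<le> (\<integral>x. (3 * A) ^ 8 \<partial>circle)"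
        by (intro integral_mono integrable_trig_sum_power power_mono sup) auto
      also have "\<dots> = 3 ^ 8 * 1 * A ^ 8" by (simp add: power_mult_distrib)
      also have "\<dots> \<le> (C0 + 3 ^ 8) * real N powr (1 + \<epsilon>) * A ^ 8"
        using NN C0 A by (intro mult_right_mono mult_mono) auto
      finally show ?thesis using True by simp
    qed
    have "(\<integral>x. cmod (extension_op N \<phi> a x) ^ 8 \<partial>circle)
        \<le> (\<integral>x. real (J + 1) ^ 8 * (\<Sum>j\<in>{..J}. cmod (?t j x) ^ 8) \<partial>circle)"
    proof (rule integral_mono)
      show "integrable circle (\<lambda>x. cmod (extension_op N \<phi> a x) ^ 8)"
        unfolding extension_op_eq_trig_sum by (rule integrable_trig_sum_power)
      show "integrable circle (\<lambda>x. real (J + 1) ^ 8 * (\<Sum>j\<in>{..J}. cmod (?t j x) ^ 8))"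
        by (intro integrable_mult_right Bochner_Integration.integrable_sum integrable_trig_sum_power)
      fix x
      have "cmod (extension_op N \<phi> a x) ^ 8 \<le> (\<Sum>j\<in>{..J}. cmod (?t j x)) ^ 8"
        unfolding split by (intro power_mono norm_sum) auto
      also have "\<dots> \<le> real (J + 1) ^ 8 * (\<Sum>j\<in>{..J}. cmod (?t j x) ^ 8)"
        using sum_power_le[of "{..J}" "\<lambda>j. cmod (?t j x)" 8] by auto
      finally show "cmod (extension_op N \<phi> a x) ^ 8 \<le> real (J + 1) ^ 8 * (\<Sum>j\<in>{..J}. cmod (?t j x) ^ 8)" .
    qed
    also have "\<dots> = real (J + 1) ^ 8 * (\<Sum>j\<in>{..J}. \<integral>x. cmod (?t j x) ^ 8 \<partial>circle)"
      by (simp add: Bochner_Integration.integral_sum integrable_trig_sum_power)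
    also have "\<dots> \<le> real (J + 1) ^ 8 * (\<Sum>j\<in>{..J}. (C0 + 3 ^ 8) * real N powr (1 + \<epsilon>) * A ^ 8)"
      by (intro mult_left_mono sum_mono piece) auto
    also have "\<dots> = real (J + 1) ^ 8 * (real (J + 1) * (C0 + 3 ^ 8)) * real N powr (1 + \<epsilon>) * mass N a ^ 4"
      by (simp add: A(2))
    finally show "(\<integral>x. cmod (extension_op N \<phi> a x) ^ 8 \<partial>circle)
       \<le> real (J + 1) ^ 8 * (real (J + 1) * (C0 + 3 ^ 8)) * real N powr (1 + \<epsilon>) * mass N a ^ 4" .
  qed
qed

section \<open>Weyl sums and near-resonant differences\<close>

text \<open>
The distance to the nearest integer, usually written \<open>\<parallel>x\<parallel>\<close>.
\<close>

definition ndist :: "real \<Rightarrow> real" where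
  "ndist x = \<bar>x - of_int (round x)\<bar>"

lemma ndist_le: "ndist x \<le> \<bar>x - of_int k\<bar>"
  unfolding ndist_def by (rule round_diff_minimal)

lemma ndist_le_half: "ndist x \<le> 1 / 2"
  unfolding ndist_def using of_int_round_abs_le[of x] by (simp add: abs_minus_commute)

text \<open>
\<open>sin x - x / 2\<close> increases up to \<open>pi / 3\<close> and decreases afterwards, so it suffices to look at the two end points.
\<close>

lemma sin_ge_half_arg:
  fixes x :: real
  assumes "0 \<le> x" "x \<le> pi / 2"
  shows "x / 2 \<le> sin x"
proof (cases "x \<le> pi / 3")
  case True
  have "sin 0 - 0 / 2 \<le> sin x - x / 2"
  proof (rule DERIV_nonneg_imp_nondecreasing[OF assms(1)])
    fix t assume t: "0 \<le> t" "t \<le> x"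
    have "cos (pi / 3) \<le> cos t" using t True assms by (intro cos_monotone_0_pi_le) auto
    then have "0 \<le> cos t - 1 / 2" by (simp add: cos_60)
    then show "\<exists>y. ((\<lambda>x. sin x - x / 2) has_real_derivative y) (at t) \<and> 0 \<le> y"
      by (intro exI[of _ "cos t - 1 / 2"]) (auto intro!: derivative_eq_intros)
  qed
  then show ?thesis by simp
next
  case False
  have "sin (pi / 2) - (pi / 2) / 2 \<le> sin x - x / 2"
  proof (rule DERIV_nonpos_imp_nonincreasing[OF assms(2)])
    fix t assume t: "x \<le> t" "t \<le> pi / 2"
    have "cos t \<le> cos (pi / 3)" using t False assms pi_gt_zero by (intro cos_monotone_0_pi_le) auto
    then have "cos t - 1 / 2 \<le> 0" by (simp add: cos_60)
    then show "\<exists>y. ((\<lambda>x. sin x - x / 2) has_real_derivative y) (at t) \<and> y \<le> 0"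
      by (intro exI[of _ "cos t - 1 / 2"]) (auto intro!: derivative_eq_intros)
  qed
  then show ?thesis using pi_less_4 by simp
qed

lemma cmod_e_char_minus_one: "cmod (e_char t - 1) = 2 * \<bar>sin (pi * t)\<bar>"
proof -
  have "(cmod (e_char t - 1))\<^sup>2 = (cos (2 * (pi * t)) - 1)\<^sup>2 + (sin (2 * (pi * t)))\<^sup>2"
    by (simp add: e_char_cis cmod_power2 mult.assoc)
  also have "\<dots> = 2 - 2 * cos (2 * (pi * t))"
    using sin_cos_squared_add[of "2 * (pi * t)"] by (simp add: power2_diff algebra_simps)
  also have "\<dots> = (2 * \<bar>sin (pi * t)\<bar>)\<^sup>2"
    by (simp add: cos_double_sin power_mult_distrib)
  finally show ?thesis by (rule power2_eq_imp_eq) auto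
qed

lemma cmod_e_char_minus_one_ge: "2 * ndist x \<le> cmod (e_char x - 1)"
proof -
  define t where "t = x - of_int (round x)"
  have t: "\<bar>t\<bar> = ndist x" by (simp add: t_def ndist_def)
  have "e_char x = e_char t"
    using e_char_add[of t "of_int (round x)"] by (simp add: t_def)
  then have "cmod (e_char x - 1) = 2 * \<bar>sin (pi * t)\<bar>" by (simp add: cmod_e_char_minus_one)
  also have "\<bar>sin (pi * t)\<bar> = \<bar>sin (pi * \<bar>t\<bar>)\<bar>" by (simp add: abs_if)
  finally have "2 * sin (pi * \<bar>t\<bar>) \<le> cmod (e_char x - 1)" by linarith
  moreover have "pi * \<bar>t\<bar> / 2 \<le> sin (pi * \<bar>t\<bar>)"
    using ndist_le_half[of x] t by (intro sin_ge_half_arg) auto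
  moreover have "2 * \<bar>t\<bar> \<le> pi * \<bar>t\<bar>" using pi_gt3 by (intro mult_right_mono) auto
  ultimately show ?thesis using t by linarith
qed

lemma geometric_e_char_le:
  fixes A B :: int
  assumes "ndist \<gamma> > 0"
  shows "cmod (\<Sum>n\<in>{A..B}. e_char (\<gamma> * of_int n)) \<le> 1 / ndist \<gamma>"
proof (cases "A \<le> B")
  case False
  then show ?thesis using assms by simp
next
  case True
  let ?s = "\<Sum>n\<in>{A..B}. e_char (\<gamma> * of_int n)"
  have "e_char \<gamma> * ?s = (\<Sum>n\<in>{A..B}. e_char (\<gamma> * of_int (n + 1)))"
    by (simp add: sum_distrib_left distrib_left e_char_add mult.commute)
  also have "\<dots> = (\<Sum>n\<in>{A+1..B+1}. e_char (\<gamma> * of_int n))"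
    by (rule sum.reindex_bij_witness[where i = "\<lambda>n. n - 1" and j = "\<lambda>n. n + 1"]) auto
  finally have 1: "e_char \<gamma> * ?s = (\<Sum>n\<in>{A+1..B+1}. e_char (\<gamma> * of_int n))" .
  have "{A..B+1} = insert A {A+1..B+1}" "{A..B+1} = insert (B+1) {A..B}" using True by auto
  then have "e_char (\<gamma> * of_int A) + (\<Sum>n\<in>{A+1..B+1}. e_char (\<gamma> * of_int n)) = e_char (\<gamma> * of_int (B+1)) + ?s"
    by (metis (no_types, lifting) atLeastAtMost_iff finite_atLeastAtMost_int linorder_not_le sum.insert zless_add1_eq less_irrefl)
  then have "(e_char \<gamma> - 1) * ?s = e_char (\<gamma> * of_int (B+1)) - e_char (\<gamma> * of_int A)"
    unfolding left_diff_distrib 1 by (simp add: algebra_simps)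
  then have "cmod (e_char \<gamma> - 1) * cmod ?s \<le> 2"
    by (metis norm_e_char norm_mult norm_triangle_ineq4 one_add_one)
  moreover have "2 * ndist \<gamma> * cmod ?s \<le> cmod (e_char \<gamma> - 1) * cmod ?s"
    using cmod_e_char_minus_one_ge by (intro mult_right_mono) auto
  ultimately show ?thesis using assms by (simp add: field_simps)
qed

lemma second_difference_cubic:
  fixes \<phi> :: "int poly"
  assumes "degree \<phi> = 3"
  obtains r where "\<And>n. poly (shift_diff l (shift_diff h \<phi>)) n = 6 * lead_coeff \<phi> * h * l * n + r"
proof (cases "h = 0 \<or> l = 0")
  case True
  then have "poly (shift_diff l (shift_diff h \<phi>)) n = 0" for n
    by (auto simp: poly_shift_diff)
  then show thesis using that[of 0] True by auto
next
  case False
  let ?p = "shift_diff l (shift_diff h \<phi>)"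
  have d1: "degree (shift_diff h \<phi>) = Suc (Suc 0)" "lead_coeff (shift_diff h \<phi>) = 3 * h * lead_coeff \<phi>"
    using degree_shift_diff[of \<phi> 2 h] assms False by auto
  have d2: "degree ?p = Suc 0" "lead_coeff ?p = 2 * l * (3 * h * lead_coeff \<phi>)"
    using degree_shift_diff[of "shift_diff h \<phi>" "Suc 0" l] d1 False by auto
  have "poly ?p n = coeff ?p 0 + lead_coeff ?p * n" for n
    unfolding poly_altdef using d2(1) by simp
  then show thesis using that[of "coeff ?p 0"] d2(2) by (simp add: algebra_simps)
qed

definition weyl_sum :: "nat \<Rightarrow> int poly \<Rightarrow> real \<Rightarrow> complex" where
  "weyl_sum N \<phi> x = (\<Sum>n\<in>window N. e_char (x * of_int (poly \<phi> n)))"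

text \<open>
The pairs of steps for which the twice differenced Weyl sum, a geometric sum with ratio
\<open>e_char (x * c * h * l)\<close> for \<open>c = 6 * lead_coeff \<phi>\<close>, may fail to be small.
\<close>

definition near_resonant :: "nat \<Rightarrow> int \<Rightarrow> real \<Rightarrow> real \<Rightarrow> (int \<times> int) set" where
  "near_resonant N c x \<eta> = {(h, l). h \<in> window (2 * N) \<and> l \<in> window (2 * N) \<and> ndist (x * of_int (c * (h * l))) < \<eta>}"

text \<open>
Two differencings make the phase of a cubic linear, so the inner sums are geometric: they are at
most \<open>1 / \<eta>\<close> unless the pair of steps is near-resonant, in which case the length \<open>2 * N + 1\<close> of the sum is used.
\<close>

lemma weyl_fourth_power:
  fixes \<phi> :: "int poly"
  assumes "degree \<phi> = 3" "\<eta> > 0"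
  shows "cmod (weyl_sum N \<phi> x) ^ 4
    \<le> real (4 * N + 1) * (real (2 * N + 1) * real (card (near_resonant N (6 * lead_coeff \<phi>) x \<eta>)) + real (4 * N + 1) ^ 2 / \<eta>)"
proof -
  let ?w = "window (2 * N)"
  define c where "c = 6 * lead_coeff \<phi>"
  define f where "f = (\<lambda>h n. e_char (x * poly \<phi> (n + h)) * cnj (e_char (x * poly \<phi> n)))"
  define D where "D = (\<lambda>h l. {n \<in> {n\<in>window N. n + h \<in> window N}. n + l \<in> {n\<in>window N. n + h \<in> window N}})"
  define G where "G h = (\<Sum>n\<in>{n\<in>window N. n + h \<in> window N}. f h n)" for h
  define inn where "inn h l = (\<Sum>n\<in>D h l. e_char (x * of_int (poly (shift_diff l (shift_diff h \<phi>)) n)))" for h l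
  have cw: "card ?w = 4 * N + 1" by (simp add: nat_add_distrib)
  have Gsq: "complex_of_real ((cmod (G h))\<^sup>2) = (\<Sum>l\<in>?w. inn h l)" for h
  proof -
    have "complex_of_real ((cmod (G h))\<^sup>2) = (\<Sum>l\<in>?w. \<Sum>n\<in>D h l. f h (n + l) * cnj (f h n))"
      unfolding G_def D_def by (rule weyl_differencing) auto
    also have "\<dots> = (\<Sum>l\<in>?w. inn h l)"
      unfolding f_def second_difference_e_char inn_def ..
    finally show ?thesis .
  qed
  have Dint: "D h l = {max (max (- int N) (- int N - h)) (max (- int N - l) (- int N - h - l))
      .. min (min (int N) (int N - h)) (min (int N - l) (int N - h - l))}" for h l
    unfolding D_def by auto
  have inn_triv: "cmod (inn h l) \<le> real (2 * N + 1)" for h l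
  proof -
    have "cmod (inn h l) \<le> (\<Sum>n\<in>D h l. 1)" unfolding inn_def by (rule sum_norm_le) simp
    also have "\<dots> \<le> (\<Sum>n\<in>window N. 1)" by (intro sum_mono2) (auto simp: D_def)
    finally show ?thesis by (simp add: nat_add_distrib)
  qed
  have inn_geo: "cmod (inn h l) \<le> 1 / \<eta>" if nd: "ndist (x * of_int (c * (h * l))) \<ge> \<eta>" for h l
  proof -
    obtain r where r: "\<And>n. poly (shift_diff l (shift_diff h \<phi>)) n = c * h * l * n + r"
      using second_difference_cubic[OF assms(1)] unfolding c_def by blast
    let ?\<gamma> = "x * of_int (c * (h * l))"
    have "inn h l = e_char (x * of_int r) * (\<Sum>n\<in>D h l. e_char (?\<gamma> * of_int n))"
      unfolding inn_def r sum_distrib_left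
      by (intro sum.cong) (simp_all add: e_char_add[symmetric] algebra_simps)
    then have "cmod (inn h l) = cmod (\<Sum>n\<in>D h l. e_char (?\<gamma> * of_int n))"
      by (simp add: norm_mult)
    also have "\<dots> \<le> 1 / ndist ?\<gamma>"
      unfolding Dint by (rule geometric_e_char_le) (use nd assms in linarith)
    also have "\<dots> \<le> 1 / \<eta>" using nd assms by (intro divide_left_mono) auto
    finally show ?thesis .
  qed
  have inn: "cmod (inn h l) \<le> (if (h, l) \<in> near_resonant N c x \<eta> then real (2 * N + 1) else 0) + 1 / \<eta>"
    if "h \<in> ?w" "l \<in> ?w" for h l
  proof (cases "(h, l) \<in> near_resonant N c x \<eta>")
    case True
    then show ?thesis using inn_triv[of h l] assms by (simp add: add_increasing2)
  next
    case False
    then have "ndist (x * of_int (c * (h * l))) \<ge> \<eta>" using that by (auto simp: near_resonant_def)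
    then show ?thesis using inn_geo[of h l] False by simp
  qed
  have "cmod (weyl_sum N \<phi> x) ^ 4 = (cmod (complex_of_real ((cmod (weyl_sum N \<phi> x))\<^sup>2)))\<^sup>2"
    by (simp add: norm_power flip: power_mult)
  also have "complex_of_real ((cmod (weyl_sum N \<phi> x))\<^sup>2) = (\<Sum>h\<in>?w. G h)"
    unfolding weyl_sum_def G_def f_def by (rule weyl_differencing) simp
  also have "(cmod (\<Sum>h\<in>?w. G h))\<^sup>2 \<le> real (card ?w) * (\<Sum>h\<in>?w. (cmod (G h))\<^sup>2)"
    by (rule norm_sum_square_le)
  also have "\<dots> \<le> real (card ?w) * (\<Sum>h\<in>?w. \<Sum>l\<in>?w. (if (h, l) \<in> near_resonant N c x \<eta> then real (2 * N + 1) else 0) + 1 / \<eta>)"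
  proof (intro mult_left_mono sum_mono)
    fix h assume h: "h \<in> ?w"
    have "(cmod (G h))\<^sup>2 = cmod (complex_of_real ((cmod (G h))\<^sup>2))" by (simp del: of_real_power)
    also have "\<dots> \<le> (\<Sum>l\<in>?w. (if (h, l) \<in> near_resonant N c x \<eta> then real (2 * N + 1) else 0) + 1 / \<eta>)"
      unfolding Gsq using h by (intro sum_norm_le inn)
    finally show "(cmod (G h))\<^sup>2 \<le> (\<Sum>l\<in>?w. (if (h, l) \<in> near_resonant N c x \<eta> then real (2 * N + 1) else 0) + 1 / \<eta>)" .
  qed simp
  also have "(\<Sum>h\<in>?w. \<Sum>l\<in>?w. (if (h, l) \<in> near_resonant N c x \<eta> then real (2 * N + 1) else 0) + 1 / \<eta>)
     = real (2 * N + 1) * real (card (near_resonant N c x \<eta>)) + real (4 * N + 1) ^ 2 / \<eta>"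
  proof -
    have "(\<Sum>h\<in>?w. \<Sum>l\<in>?w. (if (h, l) \<in> near_resonant N c x \<eta> then real (2 * N + 1) else 0) + 1 / \<eta>)
      = (\<Sum>p\<in>?w \<times> ?w. (if p \<in> near_resonant N c x \<eta> then real (2 * N + 1) else 0) + 1 / \<eta>)"
      by (simp add: sum.cartesian_product case_prod_unfold)
    also have "\<dots> = real (2 * N + 1) * real (card (?w \<times> ?w \<inter> near_resonant N c x \<eta>)) + real (card (?w \<times> ?w)) / \<eta>"
      by (simp add: sum.distrib sum.If_cases)
    also have "?w \<times> ?w \<inter> near_resonant N c x \<eta> = near_resonant N c x \<eta>"
      by (auto simp: near_resonant_def)
    also have "real (card (?w \<times> ?w)) = real (4 * N + 1) ^ 2"
      unfolding card_cartesian_product cw by (simp only: of_nat_mult power2_eq_square)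
    finally show ?thesis .
  qed
  finally show ?thesis unfolding cw c_def .
qed

text \<open>
Relative to one solution \<open>m0\<close>, the integer \<open>a * (m - m0)\<close> differs from a multiple of \<open>q\<close> by some \<open>r m\<close> with
\<open>\<bar>r m\<bar> \<le> 2 * \<eta> * q + 1\<close>, and \<open>r\<close> is injective on a block of length \<open>q\<close> because \<open>a\<close> is invertible modulo \<open>q\<close>.
\<close>

lemma card_near_multiples_block:
  fixes a q u :: int
  assumes "coprime a q" "q > 0" "\<bar>x - of_int a / of_int q\<bar> \<le> 1 / (of_int q)\<^sup>2" "\<eta> > 0"
  shows "real (card {m \<in> {u..<u + q}. ndist (x * of_int m) < \<eta>}) \<le> 4 * \<eta> * of_int q + 3"
proof (cases "{m \<in> {u..<u + q}. ndist (x * of_int m) < \<eta>} = {}")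
  case True
  show ?thesis unfolding True using assms by simp
next
  case False
  let ?A = "{m \<in> {u..<u + q}. ndist (x * of_int m) < \<eta>}"
  obtain m0 where m0: "m0 \<in> ?A" using False by blast
  \<comment> \<open>twice \<open>\<eta>\<close> from subtracting two solutions, one unit from replacing \<open>x\<close> by \<open>a / q\<close>\<close>
  define R where "R = \<lfloor>2 * \<eta> * of_int q + 1\<rfloor>"
  define r where "r m = a * (m - m0) - q * round (of_int (a * (m - m0)) / of_int q :: real)" for m
  have qpos: "real_of_int q > 0" using assms by simp
  have rR: "r m \<in> {- R..R}" if m: "m \<in> ?A" for m
  proof -
    define j where "j = m - m0"
    have j: "\<bar>real_of_int j\<bar> \<le> of_int q" using m m0 by (auto simp: j_def)
    define k where "k = round (x * of_int m) - round (x * of_int m0)"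
    have xj: "\<bar>x * of_int j - of_int k\<bar> \<le> 2 * \<eta>"
      using m m0 by (simp add: j_def k_def ndist_def algebra_simps abs_le_iff abs_less_iff)
    have "\<bar>of_int j * (x - of_int a / of_int q)\<bar> \<le> of_int q * (1 / (of_int q)\<^sup>2)"
      unfolding abs_mult using j assms by (intro mult_mono) auto
    also have "\<dots> = 1 / of_int q" using qpos by (simp add: power2_eq_square)
    finally have "\<bar>x * of_int j - of_int (a * j) / of_int q\<bar> \<le> 1 / of_int q"
      by (simp add: algebra_simps)
    then have near: "\<bar>of_int (a * j) / of_int q - of_int k\<bar> \<le> 2 * \<eta> + 1 / real_of_int q"
      using xj by linarith
    have "\<bar>of_int (r m)\<bar> = of_int q * ndist (of_int (a * j) / of_int q)"
    proof -
      have r: "r m = a * j - q * round (of_int (a * j) / of_int q :: real)"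
        unfolding r_def j_def ..
      have "real_of_int (r m) = of_int q * (of_int (a * j) / of_int q - of_int (round (of_int (a * j) / of_int q :: real)))"
        unfolding r using qpos by (simp add: right_diff_distrib)
      then show ?thesis using qpos by (simp add: abs_mult ndist_def)
    qed
    also have "\<dots> \<le> of_int q * (2 * \<eta> + 1 / real_of_int q)"
      using qpos order_trans[OF ndist_le near] by (intro mult_left_mono) auto
    also have "\<dots> = 2 * \<eta> * of_int q + 1" using qpos by (simp add: distrib_left)
    finally have "real_of_int \<bar>r m\<bar> \<le> 2 * \<eta> * of_int q + 1" by simp
    then have "\<bar>r m\<bar> \<le> R" unfolding R_def by (simp only: le_floor_iff)
    then show ?thesis by auto
  qed
  have inj: "inj_on r ?A"
  proof (rule inj_onI)
    fix m m' assume m: "m \<in> ?A" "m' \<in> ?A" and eq: "r m = r m'"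
    have "q dvd a * (m - m0) - r m" "q dvd a * (m' - m0) - r m'" by (simp_all add: r_def)
    then have "q dvd (a * (m - m0) - r m) - (a * (m' - m0) - r m')" by (rule dvd_diff)
    then have "q dvd a * (m - m')" using eq by (simp add: algebra_simps)
    then have "q dvd m - m'" using assms(1) by (simp add: coprime_commute coprime_dvd_mult_right_iff)
    moreover have "\<bar>m - m'\<bar> < q" using m by auto
    ultimately have "m - m' = 0" using dvd_imp_le_int[of "m - m'" q] by fastforce
    then show "m = m'" by simp
  qed
  have "card ?A \<le> card {- R..R}"
    using rR inj by (intro card_inj_on_le[of r]) auto
  moreover have "R \<ge> 0" using assms qpos by (simp add: R_def)
  ultimately have "int (card ?A) \<le> 2 * R + 1" by simp
  then have "real (card ?A) \<le> 2 * of_int R + 1" by linarith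
  also have "of_int R \<le> 2 * \<eta> * of_int q + 1" unfolding R_def by (rule of_int_floor_le)
  finally show ?thesis by (simp add: algebra_simps)
qed

lemma card_near_multiples:
  fixes a q M :: int
  assumes "coprime a q" "q > 0" "\<bar>x - of_int a / of_int q\<bar> \<le> 1 / (of_int q)\<^sup>2" "\<eta> > 0" "M \<ge> 0"
  shows "real (card {m \<in> {- M..M}. ndist (x * of_int m) < \<eta>}) \<le> (2 * of_int M / of_int q + 1) * (4 * \<eta> * of_int q + 3)"
proof -
  let ?B = "\<lambda>i. {m \<in> {- M + i * q..<- M + i * q + q}. ndist (x * of_int m) < \<eta>}"
  let ?I = "{0..2 * M div q}"
  have "{m \<in> {- M..M}. ndist (x * of_int m) < \<eta>} \<subseteq> (\<Union>i\<in>?I. ?B i)"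
  proof
    fix m assume m: "m \<in> {m \<in> {- M..M}. ndist (x * of_int m) < \<eta>}"
    define i where "i = (m + M) div q"
    have "i \<in> ?I" using m assms by (auto simp: i_def pos_imp_zdiv_nonneg_iff intro!: zdiv_mono1)
    moreover have "m + M = i * q + (m + M) mod q" "0 \<le> (m + M) mod q" "(m + M) mod q < q"
      using assms by (simp_all add: i_def)
    then have "m \<in> ?B i" using m by auto
    ultimately show "m \<in> (\<Union>i\<in>?I. ?B i)" by blast
  qed
  then have "card {m \<in> {- M..M}. ndist (x * of_int m) < \<eta>} \<le> card (\<Union>i\<in>?I. ?B i)"
    by (intro card_mono finite_UN_I finite_subset[of "?B _" "{_..<_}"]) auto
  also have "\<dots> \<le> (\<Sum>i\<in>?I. card (?B i))" by (rule card_UN_le) simp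
  finally have "real (card {m \<in> {- M..M}. ndist (x * of_int m) < \<eta>}) \<le> real (\<Sum>i\<in>?I. card (?B i))"
    by (rule of_nat_mono)
  also have "\<dots> = (\<Sum>i\<in>?I. real (card (?B i)))" by (rule of_nat_sum)
  also have "\<dots> \<le> (\<Sum>i\<in>?I. 4 * \<eta> * of_int q + 3)"
    by (intro sum_mono card_near_multiples_block[OF assms(1-4)])
  also have "\<dots> = real (nat (2 * M div q + 1)) * (4 * \<eta> * of_int q + 3)" by simp
  also have "\<dots> \<le> (2 * of_int M / of_int q + 1) * (4 * \<eta> * of_int q + 3)"
  proof (rule mult_right_mono)
    have "2 * M div q \<ge> 0" using assms by (simp add: pos_imp_zdiv_nonneg_iff)
    moreover have "real_of_int (2 * M div q) \<le> real_of_int (2 * M) / real_of_int q"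
      by (metis of_int_floor_le floor_divide_of_int_eq)
    ultimately show "real (nat (2 * M div q + 1)) \<le> 2 * of_int M / of_int q + 1" by simp
  qed (use assms in simp)
  finally show ?thesis .
qed

section \<open>Weyl inequality for cubic polynomials\<close>

text \<open>
The condition depends only on the product \<open>t = h * l\<close>.  A nonzero product has \<open>O(N powr \<epsilon>)\<close>
factorisations, and \<open>c * t\<close> ranges over integers of size \<open>O(N ^ 2)\<close>, which are counted in blocks of
length \<open>q\<close>.
\<close>

lemma card_near_resonant:
  fixes c :: int and \<epsilon> :: real
  assumes "c \<noteq> 0" "\<epsilon> > 0"
  obtains C where "C \<ge> 1"
    "\<And>N x a q \<eta>. N \<ge> 1 \<Longrightarrow> coprime a q \<Longrightarrow> q > 0 \<Longrightarrow> \<bar>x - of_int a / of_int q\<bar> \<le> 1 / (of_int q)\<^sup>2 \<Longrightarrow> \<eta> > 0 \<Longrightarrow>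
      real (card (near_resonant N c x \<eta>)) \<le> C * real N powr \<epsilon> * (real N + (real N ^ 2 / of_int q + 1) * (\<eta> * of_int q + 1))"
proof -
  have four: "(4::real) \<ge> 1" by simp
  obtain C1 where C1: "C1 \<ge> 1"
    "\<And>N m. N \<ge> 1 \<Longrightarrow> m \<noteq> 0 \<Longrightarrow> \<bar>real_of_int m\<bar> \<le> 4 * real N ^ 2 \<Longrightarrow>
       real (card {h::int. h dvd m}) \<le> C1 * real N powr \<epsilon>"
    using int_divisors_bound[OF assms(2) four, of 2] by blast
  define c' where "c' = real_of_int \<bar>c\<bar>"
  have c': "c' \<ge> 1" using assms(1) unfolding c'_def by linarith
  show thesis
  proof (rule that[of "10 + C1 * (32 * c')"])
    show "10 + C1 * (32 * c') \<ge> 1" using C1 c' by (simp add: add_increasing2)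
    fix N :: nat and x \<eta> :: real and a q :: int
    assume N: "N \<ge> 1" and aq: "coprime a q" "q > 0" "\<bar>x - of_int a / of_int q\<bar> \<le> 1 / (of_int q)\<^sup>2" "\<eta> > 0"
    have qpos: "real_of_int q > 0" using aq by simp
    let ?w = "window (2 * N)"
    let ?A = "near_resonant N c x \<eta>"
    let ?Z = "{0} \<times> ?w \<union> ?w \<times> {0}"
    define M where "M = 4 * \<bar>c\<bar> * int N ^ 2"
    define T where "T = {t. t \<noteq> 0 \<and> \<bar>t\<bar> \<le> 4 * int N ^ 2 \<and> ndist (x * of_int (c * t)) < \<eta>}"
    let ?B = "{m \<in> {- M..M}. ndist (x * of_int m) < \<eta>}"
    let ?F = "\<lambda>t. (\<lambda>h. (h, t div h)) ` {h::int. h dvd t}"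
    have finB: "finite ?B" by (rule finite_subset[of _ "{- M..M}"]) auto
    have TB: "(\<lambda>t. c * t) ` T \<subseteq> ?B"
    proof
      fix m assume "m \<in> (\<lambda>t. c * t) ` T"
      then obtain t where t: "m = c * t" "\<bar>t\<bar> \<le> 4 * int N ^ 2" "ndist (x * of_int m) < \<eta>" by (auto simp: T_def)
      have "\<bar>c\<bar> * \<bar>t\<bar> \<le> \<bar>c\<bar> * (4 * int N ^ 2)" using t by (intro mult_left_mono) auto
      then have "\<bar>m\<bar> \<le> M" unfolding t(1) M_def abs_mult by (simp add: mult_ac)
      then show "m \<in> ?B" using t by auto
    qed
    have injT: "inj_on (\<lambda>t. c * t) T" using assms by (auto simp: inj_on_def)
    have finT: "finite T" using finite_subset[OF TB finB] injT by (rule finite_imageD)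
    have cardT: "real (card T) \<le> (2 * of_int M / of_int q + 1) * (4 * \<eta> * of_int q + 3)"
    proof -
      have "card T \<le> card ?B" using TB injT finB by (intro card_inj_on_le)
      then have "real (card T) \<le> real (card ?B)" by (rule of_nat_mono)
      also have "\<dots> \<le> (2 * of_int M / of_int q + 1) * (4 * \<eta> * of_int q + 3)"
        by (rule card_near_multiples[OF aq]) (simp add: M_def)
      finally show ?thesis .
    qed
    note cardT
    also have "(2 * of_int M / of_int q + 1) * (4 * \<eta> * of_int q + 3)
       \<le> (8 * c' * (real N ^ 2 / of_int q + 1)) * (4 * (\<eta> * of_int q + 1))"
    proof (rule mult_mono)
      have "real_of_int M = 4 * c' * real N ^ 2" by (simp add: M_def c'_def)
      then show "2 * of_int M / of_int q + 1 \<le> 8 * c' * (real N ^ 2 / real_of_int q + 1)"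
        using c' by (simp add: distrib_left)
    qed (use aq c' in auto)
    also have "\<dots> = 32 * c' * ((real N ^ 2 / of_int q + 1) * (\<eta> * of_int q + 1))" by simp
    finally have cardT': "real (card T) \<le> 32 * c' * ((real N ^ 2 / of_int q + 1) * (\<eta> * of_int q + 1))" .
    have "?A \<subseteq> ?Z \<union> (\<Union>t\<in>T. ?F t)"
    proof
      fix p assume p: "p \<in> ?A"
      obtain h l where hl: "p = (h, l)" by (cases p) auto
      have w: "h \<in> ?w" "l \<in> ?w" "ndist (x * of_int (c * (h * l))) < \<eta>"
        using p unfolding hl near_resonant_def by auto
      show "p \<in> ?Z \<union> (\<Union>t\<in>T. ?F t)"
      proof (cases "h = 0 \<or> l = 0")
        case True
        then show ?thesis using w hl by auto
      next
        case False
        have "\<bar>h\<bar> * \<bar>l\<bar> \<le> (2 * int N) * (2 * int N)" using w by (intro mult_mono) auto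
        \<comment> \<open>steps are at most \<open>2 * N\<close>, so products are at most \<open>4 * N\<^sup>2\<close>\<close>
        then have "h * l \<in> T" using False w(3) by (simp add: T_def abs_mult power2_eq_square)
        moreover have "p \<in> ?F (h * l)" using False hl by auto
        ultimately show ?thesis by blast
      qed
    qed
    moreover have finU: "finite (\<Union>t\<in>T. ?F t)"
      using finT int_divisors_finite by (auto simp: T_def)
    ultimately have "card ?A \<le> card (?Z \<union> (\<Union>t\<in>T. ?F t))" by (intro card_mono) auto
    also have "\<dots> \<le> card ?Z + card (\<Union>t\<in>T. ?F t)" by (rule card_Un_le)
    also have "card ?Z \<le> card ({0::int} \<times> ?w) + card (?w \<times> {0::int})" by (rule card_Un_le)
    also have "card ({0::int} \<times> ?w) + card (?w \<times> {0::int}) = 2 * (4 * N + 1)"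
      by (simp add: card_cartesian_product nat_add_distrib)
    also have "card (\<Union>t\<in>T. ?F t) \<le> (\<Sum>t\<in>T. card (?F t))" by (rule card_UN_le[OF finT])
    finally have "real (card ?A) \<le> real (2 * (4 * N + 1) + (\<Sum>t\<in>T. card (?F t)))"
      by (intro of_nat_mono) simp
    also have "\<dots> = real (2 * (4 * N + 1)) + (\<Sum>t\<in>T. real (card (?F t)))"
      by (simp only: of_nat_add of_nat_sum)
    also have "(\<Sum>t\<in>T. real (card (?F t))) \<le> (\<Sum>t\<in>T. C1 * real N powr \<epsilon>)"
    proof (rule sum_mono)
      fix t assume t: "t \<in> T"
      then have t0: "t \<noteq> 0" "\<bar>t\<bar> \<le> 4 * int N ^ 2" by (auto simp: T_def)
      then have "real_of_int \<bar>t\<bar> \<le> real_of_int (4 * int N ^ 2)" by (simp only: of_int_le_iff)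
      then have tb: "\<bar>real_of_int t\<bar> \<le> 4 * real N ^ 2" by simp
      have "card (?F t) \<le> card {h::int. h dvd t}"
        using int_divisors_finite[OF t0(1)] by (rule card_image_le)
      then have "real (card (?F t)) \<le> real (card {h::int. h dvd t})" by (rule of_nat_mono)
      also have "\<dots> \<le> C1 * real N powr \<epsilon>" by (rule C1(2)[OF N t0(1) tb])
      finally show "real (card (?F t)) \<le> C1 * real N powr \<epsilon>" .
    qed
    also have "(\<Sum>t\<in>T. C1 * real N powr \<epsilon>) = C1 * real N powr \<epsilon> * real (card T)" by simp
    also have "\<dots> \<le> C1 * real N powr \<epsilon> * (32 * c' * ((real N ^ 2 / of_int q + 1) * (\<eta> * of_int q + 1)))"
      using C1 by (intro mult_left_mono cardT') auto
    also have "real (2 * (4 * N + 1)) + C1 * real N powr \<epsilon> * (32 * c' * ((real N ^ 2 / of_int q + 1) * (\<eta> * of_int q + 1)))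
      \<le> (10 + C1 * (32 * c')) * real N powr \<epsilon> * (real N + (real N ^ 2 / of_int q + 1) * (\<eta> * of_int q + 1))"
    proof -
      define Y where "Y = (real N ^ 2 / of_int q + 1) * (\<eta> * of_int q + 1)"
      have Y: "Y \<ge> 0" using qpos aq by (simp add: Y_def)
      have P: "1 \<le> real N powr \<epsilon>" using N assms by (intro ge_one_powr_ge_zero) auto
      have "real (2 * (4 * N + 1)) \<le> 10 * real N * 1" using N by simp
      also have "\<dots> \<le> 10 * real N * real N powr \<epsilon>" using P by (intro mult_left_mono) auto
      finally have 1: "real (2 * (4 * N + 1)) \<le> 10 * real N powr \<epsilon> * real N" by (simp add: mult_ac)
      have 2: "0 \<le> 10 * real N powr \<epsilon> * Y" "0 \<le> C1 * (32 * c') * real N powr \<epsilon> * real N"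
        using Y C1 c' by auto
      have "(10 + C1 * (32 * c')) * real N powr \<epsilon> * (real N + Y)
        = 10 * real N powr \<epsilon> * real N + 10 * real N powr \<epsilon> * Y
          + C1 * (32 * c') * real N powr \<epsilon> * real N + C1 * (32 * c') * real N powr \<epsilon> * Y"
        by (simp add: algebra_simps)
      moreover have "C1 * real N powr \<epsilon> * (32 * c' * Y) = C1 * (32 * c') * real N powr \<epsilon> * Y" by simp
      ultimately show ?thesis unfolding Y_def[symmetric] using 1 2 by linarith
    qed
    finally show "real (card ?A) \<le> (10 + C1 * (32 * c')) * real N powr \<epsilon> * (real N + (real N ^ 2 / of_int q + 1) * (\<eta> * of_int q + 1))"
      by simp
  qed
qed

text \<open>
The parameter \<open>\<eta>\<close> is left free, because the two applications, to minor arcs and to complete sums, choose it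
differently.
\<close>

lemma weyl_inequality:
  fixes \<phi> :: "int poly" and \<epsilon> :: real
  assumes "degree \<phi> = 3" "\<epsilon> > 0"
  obtains C where "C \<ge> 1"
    "\<And>N x a q \<eta>. N \<ge> 1 \<Longrightarrow> coprime a q \<Longrightarrow> q > 0 \<Longrightarrow> \<bar>x - of_int a / of_int q\<bar> \<le> 1 / (of_int q)\<^sup>2 \<Longrightarrow> \<eta> > 0 \<Longrightarrow>
      cmod (weyl_sum N \<phi> x) ^ 4 \<le> C * real N powr (2 + \<epsilon>) *
        (real N + (real N ^ 2 / of_int q + 1) * (\<eta> * of_int q + 1) + real N / \<eta>)"
proof -
  define c where "c = 6 * lead_coeff \<phi>"
  have "\<phi> \<noteq> 0" using assms by auto
  then have c: "c \<noteq> 0" by (simp add: c_def)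
  obtain C1 where C1: "C1 \<ge> 1"
    "\<And>N x a q \<eta>. N \<ge> 1 \<Longrightarrow> coprime a q \<Longrightarrow> q > 0 \<Longrightarrow> \<bar>x - of_int a / of_int q\<bar> \<le> 1 / (of_int q)\<^sup>2 \<Longrightarrow> \<eta> > 0 \<Longrightarrow>
      real (card (near_resonant N c x \<eta>)) \<le> C1 * real N powr \<epsilon> * (real N + (real N ^ 2 / of_int q + 1) * (\<eta> * of_int q + 1))"
    using card_near_resonant[OF c assms(2)] by metis
  show thesis
  proof (rule that[of "15 * C1 + 125"])
    show "15 * C1 + 125 \<ge> 1" using C1 by simp
    fix N :: nat and x \<eta> :: real and a q :: int
    assume N: "N \<ge> 1" and aq: "coprime a q" "q > 0" "\<bar>x - of_int a / of_int q\<bar> \<le> 1 / (of_int q)\<^sup>2" "\<eta> > 0"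
    have qpos: "real_of_int q > 0" using aq by simp
    define Y where "Y = real N + (real N ^ 2 / of_int q + 1) * (\<eta> * of_int q + 1)"
    have Y: "Y \<ge> 0" using qpos aq by (simp add: Y_def)
    have P: "1 \<le> real N powr \<epsilon>" using N assms by (intro ge_one_powr_ge_zero) auto
    have N2: "real N powr (2 + \<epsilon>) = real N ^ 2 * real N powr \<epsilon>"
      using N by (simp add: powr_add powr_numeral)
    have "cmod (weyl_sum N \<phi> x) ^ 4 \<le> real (4 * N + 1) * (real (2 * N + 1) * real (card (near_resonant N c x \<eta>)) + real (4 * N + 1) ^ 2 / \<eta>)"
      using weyl_fourth_power[OF assms(1) aq(4)] by (simp add: c_def)
    also have "\<dots> \<le> (5 * real N) * ((3 * real N) * (C1 * real N powr \<epsilon> * Y) + (5 * real N) ^ 2 / \<eta>)"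
      using N aq C1(2)[OF N aq] unfolding Y_def[symmetric]
      by (intro mult_mono add_mono divide_right_mono power_mono add_nonneg_nonneg divide_nonneg_nonneg mult_nonneg_nonneg) auto
    also have "\<dots> = 15 * C1 * (real N ^ 2 * real N powr \<epsilon> * Y) + 125 * (real N ^ 2 * (real N / \<eta>))"
      by (simp add: power2_eq_square algebra_simps)
    also have "\<dots> \<le> 15 * C1 * (real N ^ 2 * real N powr \<epsilon> * (Y + real N / \<eta>)) + 125 * (real N ^ 2 * real N powr \<epsilon> * (Y + real N / \<eta>))"
    proof (intro add_mono mult_left_mono)
      show "real N ^ 2 * (real N / \<eta>) \<le> real N ^ 2 * real N powr \<epsilon> * (Y + real N / \<eta>)"
      proof -
        have "real N ^ 2 * 1 * (real N / \<eta>) \<le> real N ^ 2 * real N powr \<epsilon> * (Y + real N / \<eta>)"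
          using P Y aq by (intro mult_mono) auto
        then show ?thesis by simp
      qed
    qed (use C1 aq in auto)
    also have "\<dots> = (15 * C1 + 125) * real N powr (2 + \<epsilon>) * (Y + real N / \<eta>)"
      unfolding N2 by (simp add: algebra_simps)
    finally show "cmod (weyl_sum N \<phi> x) ^ 4 \<le> (15 * C1 + 125) * real N powr (2 + \<epsilon>) *
        (real N + (real N ^ 2 / of_int q + 1) * (\<eta> * of_int q + 1) + real N / \<eta>)"
      unfolding Y_def .
  qed
qed

text \<open>
With \<open>\<eta> = N powr (- 3/4)\<close> every term in the Weyl inequality is at most \<open>N powr (7/4)\<close> up to constants, which saves
a fixed power of \<open>N\<close>.
\<close>

lemma weyl_minor_arc:
  fixes \<phi> :: "int poly"
  assumes "degree \<phi> = 3"
  obtains C where "C \<ge> 1"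
    "\<And>N x a q. N \<ge> 1 \<Longrightarrow> coprime a q \<Longrightarrow> real N powr (1 / 2) \<le> of_int q \<Longrightarrow> of_int q \<le> real N powr (5 / 2) \<Longrightarrow>
      \<bar>x - of_int a / of_int q\<bar> \<le> 1 / (of_int q)\<^sup>2 \<Longrightarrow>
      cmod (weyl_sum N \<phi> x) \<le> C * real N powr (31 / 32)"
proof -
  have "(1 / 8 :: real) > 0" by simp
  then obtain C where C: "C \<ge> 1"
    "\<And>N x a q \<eta>. N \<ge> 1 \<Longrightarrow> coprime a q \<Longrightarrow> q > 0 \<Longrightarrow> \<bar>x - of_int a / of_int q\<bar> \<le> 1 / (of_int q)\<^sup>2 \<Longrightarrow> \<eta> > 0 \<Longrightarrow>
      cmod (weyl_sum N \<phi> x) ^ 4 \<le> C * real N powr (2 + 1 / 8) *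
        (real N + (real N ^ 2 / of_int q + 1) * (\<eta> * of_int q + 1) + real N / \<eta>)"
    using weyl_inequality[OF assms] by metis
  show thesis
  proof (rule that[of "6 * C"])
    show "6 * C \<ge> 1" using C by simp
    fix N :: nat and x :: real and a q :: int
    assume N: "N \<ge> 1" and aq: "coprime a q" and q: "real N powr (1 / 2) \<le> of_int q" "of_int q \<le> real N powr (5 / 2)"
      and x: "\<bar>x - of_int a / of_int q\<bar> \<le> 1 / (of_int q)\<^sup>2"
    have N1: "real N \<ge> 1" using N by simp
    have "1 \<le> real N powr (1 / 2)" using N1 by (intro ge_one_powr_ge_zero) auto
    then have qpos: "real_of_int q > 0" using q by linarith
    define \<eta> where "\<eta> = real N powr (- 3 / 4)"
    have \<eta>: "\<eta> > 0" using N by (simp add: \<eta>_def)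
    have pw: "real N powr s \<le> real N powr (7 / 4)" if "s \<le> 7 / 4" for s
      using N1 that by (intro powr_mono) auto
    have N2: "real N ^ 2 = real N powr 2" using N by (simp add: powr_numeral)
    have t1: "real N \<le> real N powr (7 / 4)" using pw[of 1] N by simp
    have t2: "real N / \<eta> \<le> real N powr (7 / 4)"
    proof -
      have "real N / \<eta> = real N powr (1 - - 3 / 4)" unfolding \<eta>_def powr_diff using N by simp
      then show ?thesis by simp
    qed
    have "(real N ^ 2 / of_int q + 1) * (\<eta> * of_int q + 1) = real N ^ 2 * \<eta> + real N ^ 2 / of_int q + \<eta> * of_int q + 1"
      using qpos by (simp add: field_simps)
    also have "\<dots> \<le> 4 * real N powr (7 / 4)"
    proof -
      have "real N ^ 2 * \<eta> = real N powr (2 + - 3 / 4)" unfolding N2 \<eta>_def powr_add ..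
      then have 1: "real N ^ 2 * \<eta> \<le> real N powr (7 / 4)" using pw[of "2 + - 3 / 4"] by simp
      have "real N ^ 2 / of_int q \<le> real N ^ 2 / real N powr (1 / 2)"
        using q qpos N1 by (intro divide_left_mono mult_pos_pos) auto
      also have "\<dots> = real N powr (2 - 1 / 2)" unfolding N2 powr_diff ..
      also have "\<dots> \<le> real N powr (7 / 4)" by (rule pw) simp
      finally have 2: "real N ^ 2 / of_int q \<le> real N powr (7 / 4)" .
      have "\<eta> * of_int q \<le> \<eta> * real N powr (5 / 2)" using q \<eta> by (intro mult_left_mono) auto
      also have "\<dots> = real N powr (- 3 / 4 + 5 / 2)" unfolding \<eta>_def powr_add ..
      finally have 3: "\<eta> * of_int q \<le> real N powr (7 / 4)" by simp
      have 4: "1 \<le> real N powr (7 / 4)" using N1 by (intro ge_one_powr_ge_zero) auto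
      show ?thesis using 1 2 3 4 by linarith
    qed
    finally have t3: "(real N ^ 2 / of_int q + 1) * (\<eta> * of_int q + 1) \<le> 4 * real N powr (7 / 4)" .
    have "cmod (weyl_sum N \<phi> x) ^ 4 \<le> C * real N powr (2 + 1 / 8) *
        (real N + (real N ^ 2 / of_int q + 1) * (\<eta> * of_int q + 1) + real N / \<eta>)"
      using qpos by (intro C(2)[OF N aq _ x \<eta>]) simp
    also have "\<dots> \<le> C * real N powr (2 + 1 / 8) * (6 * real N powr (7 / 4))"
      using t1 t2 t3 C by (intro mult_left_mono) auto
    also have "\<dots> = 6 * C * real N powr (2 + 1 / 8 + 7 / 4)" by (simp only: powr_add mult_ac)
    also have "\<dots> = 6 * C * (real N powr (31 / 32)) ^ 4"
      using N by (simp add: powr_powr flip: powr_realpow)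
    also have "\<dots> \<le> (6 * C) ^ 4 * (real N powr (31 / 32)) ^ 4"
    proof (rule mult_right_mono)
      show "6 * C \<le> (6 * C) ^ 4" using C by (intro self_le_power) auto
    qed simp
    finally have "cmod (weyl_sum N \<phi> x) ^ 4 \<le> (6 * C * real N powr (31 / 32)) ^ 4"
      by (simp only: power_mult_distrib)
    then show "cmod (weyl_sum N \<phi> x) \<le> 6 * C * real N powr (31 / 32)"
      by (subst (asm) power_mono_iff) (use C in auto)
  qed
qed

definition complete_sum :: "int poly \<Rightarrow> int \<Rightarrow> nat \<Rightarrow> complex" where
  "complete_sum \<phi> a q = (\<Sum>n\<in>{0..<int q}. e_char (of_int a / real q * of_int (poly \<phi> n)))"

lemma e_char_rational_periodic:
  fixes q :: nat
  assumes "q > 0" "x mod int q = y mod int q"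
  shows "e_char (of_int a / real q * of_int (poly \<phi> x)) = e_char (of_int a / real q * of_int (poly \<phi> y))"
proof -
  have "int q dvd x - y" using assms(2) by (simp add: mod_eq_dvd_iff)
  then have "int q dvd poly \<phi> x - poly \<phi> y" using poly_diff_dvd[of x y \<phi>] by (rule dvd_trans)
  then obtain k where k: "poly \<phi> x - poly \<phi> y = int q * k" by (elim dvdE)
  have "of_int a / real q * of_int (poly \<phi> x) = of_int a / real q * of_int (poly \<phi> y) + of_int (a * k)"
  proof -
    have "real_of_int (poly \<phi> x) = real_of_int (poly \<phi> y) + real q * of_int k"
      using arg_cong[OF k, of real_of_int] by simp
    then show ?thesis using assms(1) by (simp add: distrib_left)
  qed
  then show ?thesis by (simp add: e_char_add del: of_int_mult)
qed

text \<open>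
The summand is periodic modulo \<open>q\<close>, so every block of length \<open>q\<close> gives the same sum.
\<close>

lemma complete_sum_block:
  fixes q :: nat
  assumes "q > 0"
  shows "(\<Sum>n\<in>{u..<u + int q}. e_char (of_int a / real q * of_int (poly \<phi> n))) = complete_sum \<phi> a q"
  unfolding complete_sum_def
proof (rule sum.reindex_bij_witness[where i = "\<lambda>n. u + (n - u) mod int q" and j = "\<lambda>n. n mod int q"])
  fix n assume n: "n \<in> {u..<u + int q}"
  have "(n mod int q - u) mod int q = (n - u) mod int q" by (simp add: mod_diff_left_eq)
  also have "\<dots> = n - u" using n by simp
  finally show "u + (n mod int q - u) mod int q = n" by simp
  show "n mod int q \<in> {0..<int q}" using assms by simp
  show "e_char (of_int a / real q * of_int (poly \<phi> (n mod int q))) = e_char (of_int a / real q * of_int (poly \<phi> n))"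
    by (rule e_char_rational_periodic[OF assms]) simp
next
  fix n assume n: "n \<in> {0..<int q}"
  have "(u + (n - u) mod int q) mod int q = (u + (n - u)) mod int q" by (rule mod_add_right_eq)
  then show "(u + (n - u) mod int q) mod int q = n" using n by simp
  show "u + (n - u) mod int q \<in> {u..<u + int q}" using assms by simp
qed

section \<open>Complete sums and major arcs\<close>

lemma sum_consecutive_blocks:
  fixes f :: "int \<Rightarrow> 'a::comm_monoid_add"
  shows "(\<Sum>n\<in>{u..<u + int J * int q}. f n) = (\<Sum>j<J. \<Sum>n\<in>{u + int j * int q..<u + int j * int q + int q}. f n)"
proof (induction J)
  case 0
  then show ?case by simp
next
  case (Suc J)
  have "{u..<u + int (Suc J) * int q} = {u..<u + int J * int q} \<union> {u + int J * int q..<u + int J * int q + int q}"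
    by (subst ivl_disj_un_two(3)) (simp_all add: algebra_simps)
  then show ?case
    using Suc by (simp add: sum.union_disjoint)
qed

text \<open>
The Weyl sum at \<open>a / q\<close> of length \<open>N = q\<^sup>2\<close> consists of \<open>2 * q\<close> complete blocks and one further
term.  For this \<open>N\<close> the loss \<open>N powr \<epsilon>\<close> in the Weyl inequality is only a small power of \<open>q\<close>.
\<close>

lemma complete_sum_bound:
  fixes \<phi> :: "int poly" and \<epsilon> :: real
  assumes "degree \<phi> = 3" "\<epsilon> > 0"
  obtains C where "C \<ge> 1"
    "\<And>a q. q \<ge> 1 \<Longrightarrow> coprime a (int q) \<Longrightarrow> cmod (complete_sum \<phi> a q) \<le> C * real q powr (3 / 4 + \<epsilon>)"
proof -
  have e2: "2 * \<epsilon> > 0" using assms by simp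
  obtain C where C: "C \<ge> 1"
    "\<And>N x a q \<eta>. N \<ge> 1 \<Longrightarrow> coprime a q \<Longrightarrow> q > 0 \<Longrightarrow> \<bar>x - of_int a / of_int q\<bar> \<le> 1 / (of_int q)\<^sup>2 \<Longrightarrow> \<eta> > 0 \<Longrightarrow>
      cmod (weyl_sum N \<phi> x) ^ 4 \<le> C * real N powr (2 + 2 * \<epsilon>) *
        (real N + (real N ^ 2 / of_int q + 1) * (\<eta> * of_int q + 1) + real N / \<eta>)"
    using weyl_inequality[OF assms(1) e2] by metis
  show thesis
  proof (rule that[of "7 * C"])
    show "7 * C \<ge> 1" using C by simp
    fix a :: int and q :: nat assume q: "q \<ge> 1" and a: "coprime a (int q)"
    have q1: "real q \<ge> 1" using q by simp
    \<comment> \<open>long enough for the term \<open>N / q\<close> to dominate, short enough to be a fixed power of \<open>q\<close>\<close>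
    define N where "N = q * q"
    have N: "N \<ge> 1" using q by (simp add: N_def Suc_le_eq)
    let ?x = "of_int a / real q"
    let ?f = "\<lambda>n. e_char (?x * of_int (poly \<phi> n))"
    let ?S = "complete_sum \<phi> a q"
    have "cmod (weyl_sum N \<phi> ?x) ^ 4 \<le> C * real N powr (2 + 2 * \<epsilon>) *
        (real N + (real N ^ 2 / of_int (int q) + 1) * ((1 / real q) * of_int (int q) + 1) + real N / (1 / real q))"
      using q by (intro C(2)[OF N a]) auto
    also have "\<dots> \<le> C * real N powr (2 + 2 * \<epsilon>) * (6 * real q ^ 3)"
    proof (rule mult_left_mono)
      have N2: "real N = real q ^ 2" by (simp add: N_def power2_eq_square)
      have "real q ^ 2 \<le> real q ^ 3" using q1 by (intro power_increasing) auto
      moreover have "1 \<le> real q ^ 3" using q1 by (intro one_le_power)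
      ultimately have le: "real q ^ 2 + (real q ^ 3 + 1) * 2 + real q ^ 3 \<le> 6 * real q ^ 3" by simp
      have "real N + (real N ^ 2 / of_int (int q) + 1) * ((1 / real q) * of_int (int q) + 1) + real N / (1 / real q)
          = real q ^ 2 + (real q ^ 3 + 1) * 2 + real q ^ 3"
        unfolding N2 using q1 by (simp add: power2_eq_square power3_eq_cube)
      also note le
      finally show "real N + (real N ^ 2 / of_int (int q) + 1) * ((1 / real q) * of_int (int q) + 1) + real N / (1 / real q) \<le> 6 * real q ^ 3" .
    qed (use C in simp)
    also have "\<dots> = 6 * C * (real q powr (7 / 4 + \<epsilon>)) ^ 4"
    proof -
      have "real N powr (2 + 2 * \<epsilon>) = real q powr (2 * (2 + 2 * \<epsilon>))"
        by (simp add: N_def powr_mult powr_add[symmetric] algebra_simps)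
      moreover have "real q ^ 3 = real q powr 3" using q1 by (simp add: powr_numeral)
      moreover have "(real q powr (7 / 4 + \<epsilon>)) ^ 4 = real q powr (4 * (7 / 4 + \<epsilon>))"
        using q1 by (simp add: powr_powr mult.commute flip: powr_realpow)
      moreover have "real q powr (2 * (2 + 2 * \<epsilon>)) * real q powr 3 = real q powr (4 * (7 / 4 + \<epsilon>))"
        unfolding powr_add[symmetric] by (rule arg_cong[where f = "\<lambda>s. real q powr s"]) simp
      ultimately show ?thesis by simp
    qed
    also have "\<dots> \<le> (6 * C) ^ 4 * (real q powr (7 / 4 + \<epsilon>)) ^ 4"
    proof (rule mult_right_mono)
      show "6 * C \<le> (6 * C) ^ 4" using C by (intro self_le_power) auto
    qed simp
    finally have "cmod (weyl_sum N \<phi> ?x) ^ 4 \<le> (6 * C * real q powr (7 / 4 + \<epsilon>)) ^ 4"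
      by (simp only: power_mult_distrib)
    then have K: "cmod (weyl_sum N \<phi> ?x) \<le> 6 * C * real q powr (7 / 4 + \<epsilon>)"
      by (subst (asm) power_mono_iff) (use C in auto)
    have "window N = insert (int N) {- int N..<- int N + int (2 * q) * int q}"
      by (auto simp: N_def)
    then have "weyl_sum N \<phi> ?x = ?f (int N) + (\<Sum>n\<in>{- int N..<- int N + int (2 * q) * int q}. ?f n)"
      unfolding weyl_sum_def by (simp add: N_def)
    also have "(\<Sum>n\<in>{- int N..<- int N + int (2 * q) * int q}. ?f n) = of_nat (2 * q) * ?S"
    proof -
      have "(\<Sum>n\<in>{u..<u + int q}. ?f n) = ?S" for u using q by (intro complete_sum_block) simp
      then show ?thesis unfolding sum_consecutive_blocks by simp
    qed
    finally have "of_nat (2 * q) * ?S = weyl_sum N \<phi> ?x - ?f (int N)" by simp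
    then have "cmod (of_nat (2 * q) * ?S) \<le> cmod (weyl_sum N \<phi> ?x) + cmod (?f (int N))"
      by (simp only: norm_triangle_ineq4)
    then have "2 * real q * cmod ?S \<le> cmod (weyl_sum N \<phi> ?x) + 1"
      by (simp add: norm_mult)
    also have "\<dots> \<le> 6 * C * real q powr (7 / 4 + \<epsilon>) + C * real q powr (7 / 4 + \<epsilon>)"
    proof -
      have "1 * 1 \<le> C * real q powr (7 / 4 + \<epsilon>)"
        using C q1 assms by (intro mult_mono ge_one_powr_ge_zero) auto
      then show ?thesis using K by linarith
    qed
    also have "\<dots> = 7 * C * real q powr (3 / 4 + \<epsilon>) * real q"
    proof -
      have "real q powr (7 / 4 + \<epsilon>) = real q powr ((3 / 4 + \<epsilon>) + 1)" by (simp add: algebra_simps)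
      also have "\<dots> = real q powr (3 / 4 + \<epsilon>) * real q" using q1 by (simp only: powr_add) simp
      finally show ?thesis by simp
    qed
    finally have "(2 * cmod ?S) * real q \<le> 7 * C * real q powr (3 / 4 + \<epsilon>) * real q" by (simp add: mult_ac)
    then have "2 * cmod ?S \<le> 7 * C * real q powr (3 / 4 + \<epsilon>)" using q1 by simp
    then show "cmod ?S \<le> 7 * C * real q powr (3 / 4 + \<epsilon>)" using norm_ge_zero[of ?S] by linarith
  qed
qed

lemma real_poly_growth:
  fixes p :: "real poly"
  obtains C where "C \<ge> 1" "\<And>t N. N \<ge> 1 \<Longrightarrow> \<bar>t\<bar> \<le> 2 * real N \<Longrightarrow> \<bar>poly p t\<bar> \<le> C * real N ^ degree p"
proof (rule that[of "1 + (\<Sum>i\<le>degree p. \<bar>coeff p i\<bar> * 2 ^ i)"])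
  show "1 + (\<Sum>i\<le>degree p. \<bar>coeff p i\<bar> * 2 ^ i) \<ge> 1" by (simp add: sum_nonneg)
  fix t :: real and N :: nat assume N: "N \<ge> 1" and t: "\<bar>t\<bar> \<le> 2 * real N"
  have "\<bar>poly p t\<bar> \<le> (\<Sum>i\<le>degree p. \<bar>coeff p i\<bar> * \<bar>t\<bar> ^ i)"
    unfolding poly_altdef by (rule order_trans[OF sum_abs]) (simp add: abs_mult power_abs)
  also have "\<dots> \<le> (\<Sum>i\<le>degree p. \<bar>coeff p i\<bar> * (2 ^ i * real N ^ degree p))"
  proof (intro sum_mono mult_left_mono)
    fix i assume "i \<in> {..degree p}"
    then have "real N ^ i \<le> real N ^ degree p" using N by (intro power_increasing) auto
    moreover have "\<bar>t\<bar> ^ i \<le> (2 * real N) ^ i" using t by (intro power_mono) auto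
    moreover have "(2 * real N) ^ i = 2 ^ i * real N ^ i" by (rule power_mult_distrib)
    ultimately show "\<bar>t\<bar> ^ i \<le> 2 ^ i * real N ^ degree p"
      by (smt (verit) mult_left_mono zero_le_power)
  qed auto
  also have "\<dots> \<le> (1 + (\<Sum>i\<le>degree p. \<bar>coeff p i\<bar> * 2 ^ i)) * real N ^ degree p"
    by (simp add: sum_distrib_right distrib_right mult.assoc)
  finally show "\<bar>poly p t\<bar> \<le> (1 + (\<Sum>i\<le>degree p. \<bar>coeff p i\<bar> * 2 ^ i)) * real N ^ degree p" .
qed

lemma poly_map_of_int: "poly (map_poly real_of_int p) (of_int n) = of_int (poly p n)"
  by (induction p) (auto simp: map_poly_pCons)

lemma cmod_e_char_diff_le: "cmod (e_char x - e_char y) \<le> 2 * pi * \<bar>x - y\<bar>"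
proof -
  have "e_char x - e_char y = e_char y * (e_char (x - y) - 1)"
    using e_char_add[of y "x - y"] by (simp add: algebra_simps)
  then have "cmod (e_char x - e_char y) = 2 * \<bar>sin (pi * (x - y))\<bar>"
    by (simp add: norm_mult cmod_e_char_minus_one)
  also have "\<dots> \<le> 2 * \<bar>pi * (x - y)\<bar>" using abs_sin_x_le_abs_x[of "pi * (x - y)"] by simp
  finally show ?thesis by (simp add: abs_mult)
qed

text \<open>
On a block of one period \<open>g\<close> may be replaced by its mean value.
\<close>

lemma periodic_times_slowly_varying_block:
  fixes f :: "int \<Rightarrow> complex" and g :: "real \<Rightarrow> complex"
  assumes q: "q > 0" and f: "\<And>n. cmod (f n) \<le> 1"
    and g: "continuous_on UNIV g"
    and lip: "\<And>n t. n \<in> {u..<u + int q} \<Longrightarrow> t \<in> {of_int u..of_int u + real q} \<Longrightarrow> cmod (g (of_int n) - g t) \<le> V"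
  shows "cmod ((\<Sum>n\<in>{u..<u + int q}. f n * g (of_int n))
      - (\<Sum>n\<in>{u..<u + int q}. f n) / of_nat q * integral {of_int u..of_int u + real q} g) \<le> real q * V"
proof -
  let ?B = "{u..<u + int q}" and ?I = "{of_int u..of_int u + real q}"
  have int: "g integrable_on ?I"
    by (intro integrable_continuous_interval continuous_on_subset[OF g]) simp
  have qz: "complex_of_nat q \<noteq> 0" using q by simp
  have "(\<Sum>n\<in>?B. f n * g (of_int n)) - (\<Sum>n\<in>?B. f n) / of_nat q * integral ?I g
     = (\<Sum>n\<in>?B. f n * (g (of_int n) - integral ?I g / of_nat q))"
    by (simp add: right_diff_distrib sum_subtractf sum_distrib_right sum_divide_distrib)
  moreover have "cmod (\<Sum>n\<in>?B. f n * (g (of_int n) - integral ?I g / of_nat q)) \<le> (\<Sum>n\<in>?B. V)"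
  proof (rule sum_norm_le)
    fix n assume n: "n \<in> ?B"
    have c: "integral ?I (\<lambda>t. g (of_int n)) = of_nat q * g (of_int n)"
      by (simp add: scaleR_conv_of_real)
    have "integral ?I (\<lambda>t. g (of_int n) - g t) = of_nat q * g (of_int n) - integral ?I g"
      using int by (subst Henstock_Kurzweil_Integration.integral_diff) (auto simp: scaleR_conv_of_real)
    then have "g (of_int n) - integral ?I g / of_nat q = integral ?I (\<lambda>t. g (of_int n) - g t) / of_nat q"
      using qz by (simp add: diff_divide_distrib)
    then have "cmod (g (of_int n) - integral ?I g / of_nat q) = cmod (integral ?I (\<lambda>t. g (of_int n) - g t)) / real q"
      by (simp add: norm_divide)
    also have "cmod (integral ?I (\<lambda>t. g (of_int n) - g t)) \<le> V * (of_int u + real q - of_int u)"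
    proof (rule integral_bound)
      show "continuous_on ?I (\<lambda>t. g (of_int n) - g t)"
        by (intro continuous_intros continuous_on_subset[OF g]) simp
    qed (use lip[OF n] in auto)
    also have "V * (of_int u + real q - of_int u) / real q = V" using q by simp
    finally have 1: "cmod (g (of_int n) - integral ?I g / of_nat q) \<le> V"
      using q by (simp add: divide_right_mono)
    have "cmod (f n) * cmod (g (of_int n) - integral ?I g / of_nat q) \<le> 1 * V"
      using 1 f by (intro mult_mono) auto
    then show "cmod (f n * (g (of_int n) - integral ?I g / of_nat q)) \<le> V" by (simp add: norm_mult)
  qed
  ultimately show ?thesis by simp
qed

text \<open>
Cutting the window into blocks of length \<open>q\<close> separates the complete sum from the integral of the
slowly varying factor.  The integral ends where the last complete block ends; where that is does not matter,
as integrals over all intervals satisfy the same estimate.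
\<close>

lemma major_arc_approximation:
  fixes \<phi> :: "int poly"
  assumes "degree \<phi> = 3"
  obtains C where "C \<ge> 1"
    "\<And>N a q \<theta>. N \<ge> 1 \<Longrightarrow> q \<ge> 1 \<Longrightarrow>
      \<exists>b. b \<le> 2 * real N \<and> cmod (weyl_sum N \<phi> (of_int a / real q + \<theta>))
      \<le> cmod (complete_sum \<phi> a q) / real q * cmod (integral {- real N..b} (\<lambda>t. e_char (\<theta> * poly (map_poly real_of_int \<phi>) t)))
        + C * (real q * (1 + real N ^ 3 * \<bar>\<theta>\<bar>))"
proof -
  define \<psi> :: "real poly" where "\<psi> = map_poly real_of_int \<phi>"
  have deg: "degree (pderiv \<psi>) = 2"
    using assms by (simp add: \<psi>_def degree_pderiv degree_map_poly)
  obtain L where L: "L \<ge> 1" "\<And>t N. N \<ge> 1 \<Longrightarrow> \<bar>t\<bar> \<le> 2 * real N \<Longrightarrow> \<bar>poly (pderiv \<psi>) t\<bar> \<le> L * real N ^ 2"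
    using real_poly_growth[of "pderiv \<psi>"] unfolding deg by metis
  show thesis
  proof (rule that[of "1 + 6 * pi * L"])
    show "1 + 6 * pi * L \<ge> 1" using L by simp
    fix N :: nat and a :: int and q :: nat and \<theta> :: real assume N: "N \<ge> 1" and q: "q \<ge> 1"
    define f where "f n = e_char (of_int a / real q * of_int (poly \<phi> n))" for n
    define g where "g t = e_char (\<theta> * poly \<psi> t)" for t
    have cg: "continuous_on S g" for S
      unfolding g_def by (intro continuous_intros)
    define J where "J = (2 * N + 1) div q"
    define V where "V = 2 * pi * \<bar>\<theta>\<bar> * (L * real N ^ 2) * real q"
    have V: "V \<ge> 0" using L by (simp add: V_def)
    have Jq: "J * q \<le> 2 * N + 1" unfolding J_def by (rule div_times_less_eq_dividend)
    define u where "u j = - int N + int j * int q" for j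
    define b where "b = - real N + real J * real q"
    have b: "b \<le> 2 * real N"
    proof -
      have "real (J * q) \<le> real (2 * N + 1)" using Jq by (rule of_nat_mono)
      then show ?thesis using N by (simp add: b_def)
    qed
    have lipg: "cmod (g s - g t) \<le> 2 * pi * \<bar>\<theta>\<bar> * (L * real N ^ 2) * \<bar>s - t\<bar>"
      if "\<bar>s\<bar> \<le> 2 * real N" "\<bar>t\<bar> \<le> 2 * real N" for s t
    proof -
      have "\<bar>poly \<psi> s - poly \<psi> t\<bar> \<le> L * real N ^ 2 * \<bar>s - t\<bar>"
      proof -
        have "norm (poly \<psi> s - poly \<psi> t) \<le> L * real N ^ 2 * norm (s - t)"
        proof (rule field_differentiable_bound)
          show "convex {- (2 * real N)..2 * real N}" by simp
          fix z assume "z \<in> {- (2 * real N)..2 * real N}"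
          then show "norm (poly (pderiv \<psi>) z) \<le> L * real N ^ 2" using L(2)[OF N, of z] by auto
          show "(poly \<psi> has_field_derivative poly (pderiv \<psi>) z) (at z within {- (2 * real N)..2 * real N})"
            by (rule has_field_derivative_at_within[OF poly_DERIV])
        qed (use that in auto)
        then show ?thesis by simp
      qed
      then have "2 * pi * (\<bar>\<theta>\<bar> * \<bar>poly \<psi> s - poly \<psi> t\<bar>) \<le> 2 * pi * (\<bar>\<theta>\<bar> * (L * real N ^ 2 * \<bar>s - t\<bar>))"
        by (intro mult_left_mono) auto
      moreover have "\<bar>\<theta> * poly \<psi> s - \<theta> * poly \<psi> t\<bar> = \<bar>\<theta>\<bar> * \<bar>poly \<psi> s - poly \<psi> t\<bar>"
        by (simp add: abs_mult flip: right_diff_distrib)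
      then have "cmod (g s - g t) \<le> 2 * pi * (\<bar>\<theta>\<bar> * \<bar>poly \<psi> s - poly \<psi> t\<bar>)"
        unfolding g_def using cmod_e_char_diff_le[of "\<theta> * poly \<psi> s" "\<theta> * poly \<psi> t"] by simp
      ultimately have "cmod (g s - g t) \<le> 2 * pi * (\<bar>\<theta>\<bar> * (L * real N ^ 2 * \<bar>s - t\<bar>))"
        by (rule order_trans[rotated])
      then show ?thesis by (simp only: mult.assoc)
    qed
    have fg: "e_char ((of_int a / real q + \<theta>) * of_int (poly \<phi> n)) = f n * g (of_int n)" for n
      unfolding f_def g_def \<psi>_def by (simp add: poly_map_of_int distrib_right e_char_add)
    have blk: "cmod ((\<Sum>n\<in>{u j..<u j + int q}. f n * g (of_int n))
      - complete_sum \<phi> a q / of_nat q * integral {of_int (u j)..of_int (u j) + real q} g) \<le> real q * V"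
      if j: "j < J" for j
    proof -
      have top: "of_int (u j) + real q \<le> real N + 1"
      proof -
        have "(j + 1) * q \<le> J * q" using j by (intro mult_right_mono) auto
        then have "real ((j + 1) * q) \<le> real (2 * N + 1)" using Jq by (intro of_nat_mono) simp
        then show ?thesis by (simp add: u_def distrib_right)
      qed
      have bot: "real_of_int (u j) \<ge> - real N" by (simp add: u_def)
      have "(\<Sum>n\<in>{u j..<u j + int q}. f n) = complete_sum \<phi> a q"
        unfolding f_def using q by (intro complete_sum_block) simp
      moreover have "cmod ((\<Sum>n\<in>{u j..<u j + int q}. f n * g (of_int n))
        - (\<Sum>n\<in>{u j..<u j + int q}. f n) / of_nat q * integral {of_int (u j)..of_int (u j) + real q} g) \<le> real q * V"
      proof (rule periodic_times_slowly_varying_block)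
        fix n t assume n: "n \<in> {u j..<u j + int q}" and t: "t \<in> {of_int (u j)..of_int (u j) + real q}"
        have n': "real_of_int n \<ge> of_int (u j)" "real_of_int n \<le> of_int (u j) + real q" using n by auto
        have "cmod (g (of_int n) - g t) \<le> 2 * pi * \<bar>\<theta>\<bar> * (L * real N ^ 2) * \<bar>of_int n - t\<bar>"
          using n' t top bot N by (intro lipg) (auto simp: abs_le_iff)
        also have "\<dots> \<le> 2 * pi * \<bar>\<theta>\<bar> * (L * real N ^ 2) * real q"
          using n' t L by (intro mult_left_mono) (auto simp: abs_le_iff)
        finally show "cmod (g (of_int n) - g t) \<le> V" by (simp add: V_def)
      qed (use q cg in \<open>auto simp: f_def\<close>)
      ultimately show ?thesis by simp
    qed
    have intg: "(\<Sum>j<k. integral {of_int (u j)..of_int (u j) + real q} g) = integral {- real N..- real N + real k * real q} g" for k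
    proof (induction k)
      case 0
      then show ?case by simp
    next
      case (Suc k)
      define s where "s = - real N + real k * real q"
      have e: "- real N + real (Suc k) * real q = s + real q" by (simp add: s_def distrib_right)
      have "integral {- real N..s} g + integral {s..s + real q} g = integral {- real N..s + real q} g"
        by (rule Henstock_Kurzweil_Integration.integral_combine)
           (auto intro: integrable_continuous_interval cg simp: s_def)
      moreover have "of_int (u k) = s" by (simp add: u_def s_def)
      ultimately show ?case using Suc unfolding e by (simp add: s_def)
    qed
    have main: "cmod ((\<Sum>n\<in>{- int N..<- int N + int J * int q}. f n * g (of_int n))
        - complete_sum \<phi> a q / of_nat q * integral {- real N..b} g) \<le> real J * (real q * V)"
    proof -
      have "(\<Sum>n\<in>{- int N..<- int N + int J * int q}. f n * g (of_int n))
        - complete_sum \<phi> a q / of_nat q * integral {- real N..b} g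
        = (\<Sum>j<J. (\<Sum>n\<in>{u j..<u j + int q}. f n * g (of_int n))
      - complete_sum \<phi> a q / of_nat q * integral {of_int (u j)..of_int (u j) + real q} g)"
        unfolding sum_consecutive_blocks b_def intg[symmetric] sum_distrib_left sum_subtractf u_def ..
      moreover have "cmod \<dots> \<le> (\<Sum>j<J. real q * V)"
        by (rule sum_norm_le) (use blk in auto)
      ultimately show ?thesis by simp
    qed
    let ?rest = "{- int N + int J * int q..int N}"
    have "J * q + q > 2 * N + 1" unfolding J_def using q
      by (metis add.commute div_mult_mod_eq mod_less_divisor nat_add_left_cancel_less less_le_trans zero_less_one)
    then have cardr: "card ?rest \<le> q" by (simp add: algebra_simps flip: of_nat_mult of_nat_add)
    have "weyl_sum N \<phi> (of_int a / real q + \<theta>) = (\<Sum>n\<in>window N. f n * g (of_int n))"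
      unfolding weyl_sum_def fg ..
    also have "window N = {- int N..<- int N + int J * int q} \<union> ?rest"
    proof -
      define m where "m = int J * int q"
      have "int (J * q) \<le> int (2 * N + 1)" using Jq by (simp only: of_nat_le_iff)
      then have "0 \<le> m" "m \<le> 2 * int N + 1" by (simp_all add: m_def)
      then show ?thesis unfolding m_def[symmetric] by auto
    qed
    also have "(\<Sum>n\<in>{- int N..<- int N + int J * int q} \<union> ?rest. f n * g (of_int n))
       = (\<Sum>n\<in>{- int N..<- int N + int J * int q}. f n * g (of_int n)) + (\<Sum>n\<in>?rest. f n * g (of_int n))"
      by (rule sum.union_disjoint) auto
    finally have K: "weyl_sum N \<phi> (of_int a / real q + \<theta>)
       = complete_sum \<phi> a q / of_nat q * integral {- real N..b} g
         + ((\<Sum>n\<in>{- int N..<- int N + int J * int q}. f n * g (of_int n)) - complete_sum \<phi> a q / of_nat q * integral {- real N..b} g)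
         + (\<Sum>n\<in>?rest. f n * g (of_int n))" by simp
    have rest: "cmod (\<Sum>n\<in>?rest. f n * g (of_int n)) \<le> real q"
    proof -
      have "cmod (\<Sum>n\<in>?rest. f n * g (of_int n)) \<le> (\<Sum>n\<in>?rest. 1)"
        by (rule sum_norm_le) (simp add: norm_mult f_def g_def)
      also have "\<dots> = real (card ?rest)" by simp
      also have "\<dots> \<le> real q" using cardr by (rule of_nat_mono)
      finally show ?thesis .
    qed
    have "real J * (real q * V) \<le> 6 * pi * L * (real q * (real N ^ 3 * \<bar>\<theta>\<bar>))"
    proof -
      have "real (J * q) \<le> real (2 * N + 1)" using Jq by (rule of_nat_mono)
      also have "\<dots> \<le> 3 * real N" using N by simp
      finally have "(real J * real q) * V \<le> (3 * real N) * V" using V by (intro mult_right_mono) auto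
      also have "\<dots> = 6 * pi * L * (real q * (real N ^ 3 * \<bar>\<theta>\<bar>))"
        by (simp add: V_def power2_eq_square power3_eq_cube)
      finally show ?thesis by simp
    qed
    then have err: "real J * (real q * V) + real q \<le> (1 + 6 * pi * L) * (real q * (1 + real N ^ 3 * \<bar>\<theta>\<bar>))"
    proof -
      have "0 \<le> 6 * pi * L * real q" "0 \<le> real q * (real N ^ 3 * \<bar>\<theta>\<bar>)" using L by auto
      moreover have "(1 + 6 * pi * L) * (real q * (1 + real N ^ 3 * \<bar>\<theta>\<bar>)) = real q + real q * (real N ^ 3 * \<bar>\<theta>\<bar>)
         + 6 * pi * L * real q + 6 * pi * L * (real q * (real N ^ 3 * \<bar>\<theta>\<bar>))" by (simp add: algebra_simps)
      ultimately show ?thesis using \<open>real J * (real q * V) \<le> _\<close> by linarith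
    qed
    have "cmod (weyl_sum N \<phi> (of_int a / real q + \<theta>))
      \<le> cmod (complete_sum \<phi> a q / of_nat q * integral {- real N..b} g) + real J * (real q * V) + real q"
      unfolding K by (intro order_trans[OF norm_triangle_ineq] add_mono main rest order.refl)
    also have "cmod (complete_sum \<phi> a q / of_nat q * integral {- real N..b} g)
       = cmod (complete_sum \<phi> a q) / real q * cmod (integral {- real N..b} g)"
      by (simp add: norm_mult norm_divide)
    finally have "cmod (weyl_sum N \<phi> (of_int a / real q + \<theta>))
      \<le> cmod (complete_sum \<phi> a q) / real q * cmod (integral {- real N..b} g)
        + (1 + 6 * pi * L) * (real q * (1 + real N ^ 3 * \<bar>\<theta>\<bar>))"
      using err by linarith
    then show "\<exists>b. b \<le> 2 * real N \<and> cmod (weyl_sum N \<phi> (of_int a / real q + \<theta>))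
      \<le> cmod (complete_sum \<phi> a q) / real q * cmod (integral {- real N..b} (\<lambda>t. e_char (\<theta> * poly (map_poly real_of_int \<phi>) t)))
        + (1 + 6 * pi * L) * (real q * (1 + real N ^ 3 * \<bar>\<theta>\<bar>))"
      using b unfolding g_def \<psi>_def by blast
  qed
qed

text \<open>
This combines the third derivative test with the trivial bound by the length of the interval, which covers the
case of small \<open>\<theta>\<close>.
\<close>

lemma cubic_integral_decay:
  fixes \<phi> :: "int poly"
  assumes "degree \<phi> = 3" "N \<ge> 1" "b \<le> 2 * real N"
  shows "cmod (integral {- real N..b} (\<lambda>t. e_char (\<theta> * poly (map_poly real_of_int \<phi>) t)))
    \<le> 36 * real N * (1 + real N ^ 3 * \<bar>\<theta>\<bar>) powr (- 1 / 3)"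
proof -
  let ?I = "cmod (integral {- real N..b} (\<lambda>t. e_char (\<theta> * poly (map_poly real_of_int \<phi>) t)))"
  define X where "X = real N ^ 3 * \<bar>\<theta>\<bar>"
  have X: "X \<ge> 0" by (simp add: X_def)
  have N: "real N > 0" using assms by simp
  have half: "(1 / 2) powr (1 / 3) \<ge> (1 / 2 :: real)"
    using powr_mono'[of "1 / 3" 1 "1 / 2 :: real"] by simp
  show ?thesis
  proof (cases "X \<le> 1")
    case True
    have "?I \<le> 3 * real N"
    proof (cases "- real N \<le> b")
      case True
      have "?I \<le> 1 * (b - - real N)"
        using True by (intro integral_bound) (auto intro!: continuous_intros)
      then show ?thesis using assms by simp
    qed (use N in simp)
    moreover have "36 * real N * (1 + X) powr (- 1 / 3) \<ge> 36 * real N * (1 / 2)"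
    proof (rule mult_left_mono)
      have "2 powr (- 1 / 3) \<le> (1 + X) powr (- 1 / 3)"
        using True X by (intro powr_mono2') auto
      moreover have "(2::real) powr (- 1 / 3) = (1 / 2) powr (1 / 3)"
        by (simp add: powr_minus_divide powr_divide)
      ultimately show "1 / 2 \<le> (1 + X) powr (- 1 / 3)" using half by linarith
    qed simp
    ultimately show ?thesis unfolding X_def using N by linarith
  next
    case False
    then have \<theta>: "\<theta> \<noteq> 0" by (auto simp: X_def)
    have "?I \<le> 18 * \<bar>\<theta>\<bar> powr (- 1 / 3)" by (rule cubic_oscillatory_integral[OF assms(1) \<theta>])
    also have "\<bar>\<theta>\<bar> powr (- 1 / 3) = real N * X powr (- 1 / 3)"
    proof -
      have "(real N ^ 3) powr (- 1 / 3) = real N powr (- 1)"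
        using N by (simp add: powr_powr flip: powr_numeral)
      then show ?thesis using N by (simp add: X_def powr_mult powr_minus_divide)
    qed
    also have "18 * (real N * X powr (- 1 / 3)) \<le> 18 * (real N * ((1 + X) powr (- 1 / 3) * 2))"
    proof (intro mult_left_mono)
      have "X powr (- 1 / 3) \<le> ((1 + X) * (1 / 2)) powr (- 1 / 3)"
        using False by (intro powr_mono2') auto
      also have "\<dots> = (1 + X) powr (- 1 / 3) * (1 / 2) powr (- 1 / 3)"
        by (rule powr_mult)
      also have "\<dots> \<le> (1 + X) powr (- 1 / 3) * 2"
      proof (rule mult_left_mono)
        have "(1 / 2 :: real) powr (- 1 / 3) = 1 / (1 / 2) powr (1 / 3)" by (simp add: powr_minus_divide)
        also have "\<dots> \<le> 1 / (1 / 2)" using half by (intro divide_left_mono) auto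
        finally show "(1 / 2 :: real) powr (- 1 / 3) \<le> 2" by simp
      qed simp
      finally show "X powr (- 1 / 3) \<le> (1 + X) powr (- 1 / 3) * 2" .
    qed auto
    finally show ?thesis unfolding X_def[symmetric] by (simp add: mult_ac)
  qed
qed

text \<open>
Dirichlet approximation with denominators up to \<open>N powr (5/2)\<close>: if the denominator is at least \<open>sqrt N\<close>, the minor arc
bound applies.  Otherwise \<open>Y = q * (1 + N ^ 3 * \<bar>\<theta>\<bar>)\<close> is \<open>O(sqrt N)\<close>, so the error \<open>O(Y)\<close> of the major arc
approximation is smaller than the main term.
\<close>

lemma weyl_sum_dichotomy:
  fixes \<phi> :: "int poly" and \<kappa> :: real
  assumes "degree \<phi> = 3" "0 < \<kappa>" "\<kappa> < 1 / 4"
  obtains C where "C \<ge> 1"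
    "\<And>N x. N \<ge> 1 \<Longrightarrow> cmod (weyl_sum N \<phi> x) \<le> C * real N powr (31 / 32) \<or>
      (\<exists>a q. q \<ge> 1 \<and> cmod (weyl_sum N \<phi> x) \<le> C * real N * (real q * (1 + real N ^ 3 * \<bar>x - of_int a / real q\<bar>)) powr (- \<kappa>))"
proof -
  \<comment> \<open>then \<open>q powr (3 / 4 + \<epsilon>) / q\<close> is \<open>q powr - \<kappa>\<close>\<close>
  define \<epsilon> where "\<epsilon> = 1 / 4 - \<kappa>"
  have \<epsilon>: "\<epsilon> > 0" using assms by (simp add: \<epsilon>_def)
  obtain C1 where C1: "C1 \<ge> 1"
    "\<And>N x a q. N \<ge> 1 \<Longrightarrow> coprime a q \<Longrightarrow> real N powr (1 / 2) \<le> of_int q \<Longrightarrow> of_int q \<le> real N powr (5 / 2) \<Longrightarrow>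
      \<bar>x - of_int a / of_int q\<bar> \<le> 1 / (of_int q)\<^sup>2 \<Longrightarrow>
      cmod (weyl_sum N \<phi> x) \<le> C1 * real N powr (31 / 32)"
    using weyl_minor_arc[OF assms(1)] by metis
  obtain C2 where C2: "C2 \<ge> 1"
    "\<And>a q. q \<ge> 1 \<Longrightarrow> coprime a (int q) \<Longrightarrow> cmod (complete_sum \<phi> a q) \<le> C2 * real q powr (3 / 4 + \<epsilon>)"
    using complete_sum_bound[OF assms(1) \<epsilon>] by metis
  obtain C3 where C3: "C3 \<ge> 1"
    "\<And>N a q \<theta>. N \<ge> 1 \<Longrightarrow> q \<ge> 1 \<Longrightarrow>
      \<exists>b. b \<le> 2 * real N \<and> cmod (weyl_sum N \<phi> (of_int a / real q + \<theta>))
      \<le> cmod (complete_sum \<phi> a q) / real q * cmod (integral {- real N..b} (\<lambda>t. e_char (\<theta> * poly (map_poly real_of_int \<phi>) t)))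
        + C3 * (real q * (1 + real N ^ 3 * \<bar>\<theta>\<bar>))"
    using major_arc_approximation[OF assms(1)] by metis
  show thesis
  proof (rule that[of "C1 + 36 * C2 + 9 * C3"])
    show "C1 + 36 * C2 + 9 * C3 \<ge> 1" using C1 C2 C3 by simp
    fix N :: nat and x :: real assume N: "N \<ge> 1"
    have N1: "real N \<ge> 1" using N by simp
    define M where "M = nat \<lfloor>real N powr (5 / 2)\<rfloor>"
    have P: "real N powr (5 / 2) \<ge> 1" using N1 by (intro ge_one_powr_ge_zero) auto
    have M: "real M \<le> real N powr (5 / 2)" "real N powr (5 / 2) \<le> 2 * real M" "M > 0"
    proof -
      have fl: "\<lfloor>real N powr (5 / 2)\<rfloor> \<ge> 1" using P by (simp add: le_floor_iff)
      then have eq: "real M = of_int \<lfloor>real N powr (5 / 2)\<rfloor>" by (simp add: M_def)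
      show "real M \<le> real N powr (5 / 2)" unfolding eq by simp
      show "M > 0" using fl by (simp add: M_def)
      have "real N powr (5 / 2) < of_int \<lfloor>real N powr (5 / 2)\<rfloor> + 1" by linarith
      also have "\<dots> \<le> 2 * of_int \<lfloor>real N powr (5 / 2)\<rfloor>" using fl by linarith
      finally show "real N powr (5 / 2) \<le> 2 * real M" unfolding eq by simp
    qed
    obtain h k where hk: "coprime h k" "0 < k" "k \<le> int M" "\<bar>of_int k * x - of_int h\<bar> < 1 / real M"
      using Dirichlet_approx_coprime[OF M(3), of x] by blast
    define q where "q = nat k"
    have kq: "k = int q" "q \<ge> 1" using hk by (auto simp: q_def)
    have qM: "real q \<le> real M" using hk kq by simp
    have qpos: "real q > 0" using kq by simp
    define \<theta> where "\<theta> = x - of_int h / real q"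
    have \<theta>: "real q * \<bar>\<theta>\<bar> \<le> 1 / real M"
    proof -
      have "real q * \<theta> = of_int k * x - of_int h" using qpos kq by (simp add: \<theta>_def right_diff_distrib)
      then show ?thesis using hk(4) qpos by (metis abs_mult abs_of_pos less_eq_real_def)
    qed
    show "cmod (weyl_sum N \<phi> x) \<le> (C1 + 36 * C2 + 9 * C3) * real N powr (31 / 32) \<or>
      (\<exists>a q. q \<ge> 1 \<and> cmod (weyl_sum N \<phi> x) \<le> (C1 + 36 * C2 + 9 * C3) * real N * (real q * (1 + real N ^ 3 * \<bar>x - of_int a / real q\<bar>)) powr (- \<kappa>))"
    proof (cases "real N powr (1 / 2) \<le> real q")
      case True
      have "\<bar>\<theta>\<bar> \<le> 1 / (real q)\<^sup>2"
      proof -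
        have "\<bar>\<theta>\<bar> * real q \<le> 1 / real q"
          using \<theta> qM qpos by (smt (verit) frac_le mult.commute)
        then show ?thesis using qpos by (simp add: field_simps power2_eq_square)
      qed
      then have "cmod (weyl_sum N \<phi> x) \<le> C1 * real N powr (31 / 32)"
        using True qM M(1) kq hk(1) by (intro C1(2)[OF N, of h k]) (auto simp: \<theta>_def)
      also have "\<dots> \<le> (C1 + 36 * C2 + 9 * C3) * real N powr (31 / 32)"
        using C2 C3 by (intro mult_right_mono) auto
      finally show ?thesis ..
    next
      case False
      define Z where "Z = 1 + real N ^ 3 * \<bar>\<theta>\<bar>"
      define Y where "Y = real q * Z"
      have Z: "Z \<ge> 1" by (simp add: Z_def)
      have Y: "Y \<ge> 1" using kq(2) Z mult_mono[of 1 "real q" 1 Z] by (simp add: Y_def)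
      have xe: "x = of_int h / real q + \<theta>" by (simp add: \<theta>_def)
      have Yle: "Y \<le> 3 * real N powr (1 / 2)"
      proof -
        have "real N ^ 3 * (real q * \<bar>\<theta>\<bar>) \<le> real N ^ 3 * (1 / real M)" using \<theta> by (intro mult_left_mono) auto
        also have "\<dots> = real N ^ 3 * (2 / (2 * real M))" by simp
        also have "\<dots> \<le> real N ^ 3 * (2 / real N powr (5 / 2))"
          using M P N1 by (intro mult_left_mono divide_left_mono mult_pos_pos) auto
        also have "\<dots> = 2 * real N powr (3 - 5 / 2)"
          unfolding powr_diff using N1 by (simp add: powr_numeral)
        finally have "real N ^ 3 * (real q * \<bar>\<theta>\<bar>) \<le> 2 * real N powr (1 / 2)" by simp
        moreover have "Y = real q + real N ^ 3 * (real q * \<bar>\<theta>\<bar>)" by (simp add: Y_def Z_def algebra_simps)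
        ultimately show ?thesis using False by linarith
      qed
      obtain b where b: "b \<le> 2 * real N" "cmod (weyl_sum N \<phi> (of_int h / real q + \<theta>))
        \<le> cmod (complete_sum \<phi> h q) / real q * cmod (integral {- real N..b} (\<lambda>t. e_char (\<theta> * poly (map_poly real_of_int \<phi>) t)))
        + C3 * (real q * (1 + real N ^ 3 * \<bar>\<theta>\<bar>))"
        using C3(2)[OF N kq(2)] by blast
      note b(2)
      also have "cmod (complete_sum \<phi> h q) / real q * cmod (integral {- real N..b} (\<lambda>t. e_char (\<theta> * poly (map_poly real_of_int \<phi>) t)))
         \<le> (C2 * real q powr (- \<kappa>)) * (36 * real N * Z powr (- \<kappa>))"
      proof (rule mult_mono)
        have "cmod (complete_sum \<phi> h q) / real q \<le> C2 * real q powr (3 / 4 + \<epsilon>) / real q"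
          using C2(2)[OF kq(2)] hk(1) kq(1) by (intro divide_right_mono) auto
        also have "\<dots> = C2 * real q powr ((3 / 4 + \<epsilon>) - 1)"
          unfolding powr_diff using qpos by simp
        finally show "cmod (complete_sum \<phi> h q) / real q \<le> C2 * real q powr (- \<kappa>)" by (simp add: \<epsilon>_def)
        have "cmod (integral {- real N..b} (\<lambda>t. e_char (\<theta> * poly (map_poly real_of_int \<phi>) t))) \<le> 36 * real N * Z powr (- 1 / 3)"
          unfolding Z_def by (rule cubic_integral_decay[OF assms(1) N b(1)])
        also have "\<dots> \<le> 36 * real N * Z powr (- \<kappa>)"
          using assms Z by (intro mult_left_mono powr_mono) auto
        finally show "cmod (integral {- real N..b} (\<lambda>t. e_char (\<theta> * poly (map_poly real_of_int \<phi>) t))) \<le> 36 * real N * Z powr (- \<kappa>)" .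
      qed (use C2 in auto)
      also have "(C2 * real q powr (- \<kappa>)) * (36 * real N * Z powr (- \<kappa>)) = 36 * C2 * (real N * Y powr (- \<kappa>))"
        using Z by (simp add: Y_def powr_mult)
      also have "C3 * (real q * (1 + real N ^ 3 * \<bar>\<theta>\<bar>)) = C3 * Y" by (simp add: Y_def Z_def)
      also have "C3 * Y \<le> C3 * (9 * (real N * Y powr (- \<kappa>)))"
      proof (rule mult_left_mono)
        have "Y powr (1 + \<kappa>) \<le> (3 * real N powr (1 / 2)) powr (1 + \<kappa>)"
          using Yle Y assms by (intro powr_mono2) auto
        also have "\<dots> = 3 powr (1 + \<kappa>) * real N powr ((1 / 2) * (1 + \<kappa>))"
          by (simp add: powr_mult powr_powr)
        also have "\<dots> \<le> 3 powr 2 * real N powr 1"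
          using assms N1 by (intro mult_mono powr_mono) auto
        finally have "Y powr (1 + \<kappa>) \<le> 9 * real N" using N1 by simp
        then have "Y powr (1 + \<kappa>) * Y powr (- \<kappa>) \<le> 9 * real N * Y powr (- \<kappa>)" by (intro mult_right_mono) auto
        then show "Y \<le> 9 * (real N * Y powr (- \<kappa>))" using Y by (simp flip: powr_add)
      qed (use C3 in simp)
      finally have "cmod (weyl_sum N \<phi> x) \<le> 36 * C2 * (real N * Y powr (- \<kappa>)) + C3 * (9 * (real N * Y powr (- \<kappa>)))"
        unfolding xe[symmetric] by simp
      also have "\<dots> \<le> (C1 + 36 * C2 + 9 * C3) * (real N * Y powr (- \<kappa>))"
      proof -
        have "0 \<le> C1 * (real N * Y powr (- \<kappa>))" using C1 by simp
        then show ?thesis by (simp add: algebra_simps)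
      qed
      finally have "cmod (weyl_sum N \<phi> x) \<le> (C1 + 36 * C2 + 9 * C3) * real N * (real q * (1 + real N ^ 3 * \<bar>x - of_int h / real q\<bar>)) powr (- \<kappa>)"
        unfolding Y_def Z_def \<theta>_def by (simp add: mult.assoc)
      then show ?thesis using kq(2) by blast
    qed
  qed
qed

section \<open>Duality on level sets and Dirichlet kernels\<close>

abbreviation torus2 :: "(real \<times> real) measure" where
  "torus2 \<equiv> circle \<Otimes>\<^sub>M circle"

lemma pair_sigma_finite_circle: "pair_sigma_finite circle circle"
  by (intro pair_sigma_finite.intro) (rule circle.sigma_finite_measure_axioms)+

lemma finite_measure_torus2: "finite_measure torus2"
  by (rule finite_measure_pair_measure) (rule finite_measure_circle)+

lemma measurable_torus2_fst [measurable]: "fst \<in> borel_measurable torus2"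
  using measurable_compose[OF measurable_fst measurable_circle_ident] by simp

lemma measurable_torus2_snd [measurable]: "snd \<in> borel_measurable torus2"
  using measurable_compose[OF measurable_snd measurable_circle_ident] by simp

lemma integrable_torus2_bounded:
  fixes f :: "real \<times> real \<Rightarrow> 'a::{banach, second_countable_topology}"
  assumes "f \<in> borel_measurable torus2" "\<And>z. norm (f z) \<le> B"
  shows "integrable torus2 f"
  using assms by (intro finite_measure.integrable_const_bound[OF finite_measure_torus2, of _ B]) auto

text \<open>
This replaces the Fubini theorem: every function integrated over the torus is bounded by a finite
sum of such products.
\<close>

lemma integral_torus2_product:
  fixes u v :: "real \<Rightarrow> complex"
  assumes [measurable]: "u \<in> borel_measurable circle" "v \<in> borel_measurable circle"
    and b: "\<And>x. cmod (u x) \<le> B" "\<And>x. cmod (v x) \<le> B'"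
  shows "integrable torus2 (\<lambda>z. u (fst z) * v (snd z))"
    "(\<integral>z. u (fst z) * v (snd z) \<partial>torus2) = (\<integral>x. u x \<partial>circle) * (\<integral>x. v x \<partial>circle)"
proof -
  interpret P: pair_sigma_finite circle circle by (rule pair_sigma_finite_circle)
  show int: "integrable torus2 (\<lambda>z. u (fst z) * v (snd z))"
  proof (rule integrable_torus2_bounded)
    show "(\<lambda>z. u (fst z) * v (snd z)) \<in> borel_measurable torus2" by measurable
    show "cmod (u (fst z) * v (snd z)) \<le> B * B'" for z
      unfolding norm_mult using b by (intro mult_mono) (auto intro: order_trans[OF norm_ge_zero])
  qed
  have "(\<integral>z. u (fst z) * v (snd z) \<partial>torus2) = (\<integral>x. \<integral>y. u x * v y \<partial>circle \<partial>circle)"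
    using P.integral_fst'[OF int] by simp
  also have "\<dots> = (\<integral>x. u x * (\<integral>y. v y \<partial>circle) \<partial>circle)"
    by simp
  also have "\<dots> = (\<integral>x. u x \<partial>circle) * (\<integral>x. v x \<partial>circle)"
    by simp
  finally show "(\<integral>z. u (fst z) * v (snd z) \<partial>torus2) = (\<integral>x. u x \<partial>circle) * (\<integral>x. v x \<partial>circle)" .
qed

definition fourier_coeff :: "(real \<Rightarrow> complex) \<Rightarrow> int \<Rightarrow> complex" where
  "fourier_coeff u m = (\<integral>x. u x * e_char (x * of_int m) \<partial>circle)"

text \<open>
Characters of \<open>x - y\<close> are positive definite: integrated against \<open>u\<close> in both variables they give
squares of Fourier coefficients.
\<close>

lemma fourier_coeff_torus2:
  fixes u :: "real \<Rightarrow> complex"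
  assumes u [measurable]: "u \<in> borel_measurable circle" and b: "\<And>x. cmod (u x) \<le> 1"
  shows "integrable torus2 (\<lambda>z. u (fst z) * cnj (u (snd z)) * e_char ((fst z - snd z) * of_int m))"
    "(\<integral>z. u (fst z) * cnj (u (snd z)) * e_char ((fst z - snd z) * of_int m) \<partial>torus2)
       = of_real ((cmod (fourier_coeff u m))\<^sup>2)"
proof -
  let ?U = "\<lambda>x. u x * e_char (x * of_int m)"
  have e: "(\<lambda>x. e_char (x * of_int m)) \<in> borel_measurable circle"
    by (rule measurable_circleI) measurable
  have mU: "?U \<in> borel_measurable circle" by (intro borel_measurable_times u e)
  have mU': "(\<lambda>x. cnj (?U x)) \<in> borel_measurable circle"
    by (rule measurable_compose[OF mU]) (intro borel_measurable_continuous_onI continuous_intros)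
  have eq: "u (fst z) * cnj (u (snd z)) * e_char ((fst z - snd z) * of_int m) = ?U (fst z) * cnj (?U (snd z))" for z
  proof -
    have "e_char ((fst z - snd z) * of_int m) = e_char (fst z * of_int m) * cnj (e_char (snd z * of_int m))"
      by (simp only: left_diff_distrib e_char_diff)
    then show ?thesis by (simp only: complex_cnj_mult mult_ac)
  qed
  have bU: "cmod (?U x) \<le> 1" for x using b by (simp add: norm_mult)
  have bU': "cmod (cnj (?U x)) \<le> 1" for x using b by (simp add: norm_mult)
  show "integrable torus2 (\<lambda>z. u (fst z) * cnj (u (snd z)) * e_char ((fst z - snd z) * of_int m))"
    unfolding eq by (rule integral_torus2_product(1)[OF mU mU' bU bU'])
  have "(\<integral>z. ?U (fst z) * cnj (?U (snd z)) \<partial>torus2) = fourier_coeff u m * cnj (fourier_coeff u m)"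
    unfolding integral_torus2_product(2)[OF mU mU' bU bU'] fourier_coeff_def Bochner_Integration.integral_cnj ..
  then show "(\<integral>z. u (fst z) * cnj (u (snd z)) * e_char ((fst z - snd z) * of_int m) \<partial>torus2)
       = of_real ((cmod (fourier_coeff u m))\<^sup>2)"
    unfolding eq cmod_square_cnj .
qed

lemma fourier_coeff_indicator_le:
  assumes [measurable]: "E \<in> sets circle"
  shows "cmod (fourier_coeff (indicator E) m) \<le> measure circle E"
proof -
  have "cmod (fourier_coeff (indicator E) m) \<le> (\<integral>x. cmod (indicator E x * e_char (x * of_int m)) \<partial>circle)"
    unfolding fourier_coeff_def by (rule integral_norm_bound)
  also have "\<dots> = (\<integral>x. indicator E x \<partial>circle)"
    by (intro Bochner_Integration.integral_cong) (auto simp: norm_mult indicator_def)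
  also have "\<dots> = measure circle E" using sets.sets_into_space[OF assms] by (simp add: Int_absorb2 Int_commute)
  finally show ?thesis .
qed

text \<open>
With \<open>T\<close> the partial Fourier series and \<open>B\<close> the sum on the left, the integral of \<open>T\<close> over \<open>E\<close> and the
integral of \<open>cmod (T x) ^ 2\<close> are both \<open>B\<close>; the inequality \<open>t \<le> (1 + t\<^sup>2) / 2\<close> then gives \<open>B \<le> (\<mu> + B) / 2\<close>.
\<close>

lemma bessel_indicator:
  assumes E [measurable]: "E \<in> sets circle" and F: "finite F"
  shows "(\<Sum>m\<in>F. (cmod (fourier_coeff (indicator E) m))\<^sup>2) \<le> measure circle E"
proof -
  define c where "c = fourier_coeff (indicator E)"
  define T where "T = trig_sum F (\<lambda>m. cnj (c m)) (\<lambda>m. m)"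
  define B where "B = (\<Sum>m\<in>F. (cmod (c m))\<^sup>2)"
  have ind: "(\<integral>x. indicator E x \<partial>circle) = measure circle E"
    using sets.sets_into_space[OF E] by (simp add: Int_absorb2 Int_commute)
  have mT [measurable]: "T \<in> borel_measurable circle"
    unfolding T_def by (rule measurable_circleI) measurable
  have parT: "(\<integral>x. (cmod (T x))\<^sup>2 \<partial>circle) = B"
  proof -
    have "{i \<in> F. i = m} = {m}" if "m \<in> F" for m using that by auto
    then show ?thesis unfolding T_def parseval_trig_sum[OF F] B_def by simp
  qed
  have int: "integrable circle (\<lambda>x. indicator E x * (cnj (c m) * e_char (x * of_int m)))" for m
    by (rule integrable_circle_bounded[where B = "cmod (c m)"])
       (auto simp: norm_mult indicator_def intro!: borel_measurable_times measurable_circleI)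
  have "(\<integral>x. indicator E x * T x \<partial>circle) = (\<Sum>m\<in>F. \<integral>x. indicator E x * (cnj (c m) * e_char (x * of_int m)) \<partial>circle)"
    unfolding T_def trig_sum_def sum_distrib_left by (rule Bochner_Integration.integral_sum) (rule int)
  also have "\<dots> = (\<Sum>m\<in>F. cnj (c m) * c m)"
  proof (rule sum.cong)
    fix m
    have "(\<integral>x. indicator E x * (cnj (c m) * e_char (x * of_int m)) \<partial>circle)
       = (\<integral>x. cnj (c m) * (indicator E x * e_char (x * of_int m)) \<partial>circle)"
      by (simp only: mult.left_commute)
    also have "\<dots> = cnj (c m) * c m" by (simp add: c_def fourier_coeff_def)
    finally show "(\<integral>x. indicator E x * (cnj (c m) * e_char (x * of_int m)) \<partial>circle) = cnj (c m) * c m" .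
  qed simp
  also have "\<dots> = of_real B"
    unfolding B_def of_real_sum cmod_square_cnj by (simp add: mult.commute)
  finally have eqB: "(\<integral>x. indicator E x * T x \<partial>circle) = of_real B" .
  have "B \<ge> 0" by (simp add: B_def sum_nonneg)
  then have "B = cmod (\<integral>x. indicator E x * T x \<partial>circle)"
    unfolding eqB by simp
  also have "\<dots> \<le> (\<integral>x. cmod (indicator E x * T x) \<partial>circle)"
    by (rule integral_norm_bound)
  also have "\<dots> \<le> (\<integral>x. (indicator E x + (cmod (T x))\<^sup>2) / 2 \<partial>circle)"
  proof (rule integral_mono)
    fix x
    have "0 \<le> (1 - cmod (T x))\<^sup>2" by simp
    then have "cmod (T x) \<le> (1 + (cmod (T x))\<^sup>2) / 2" by (simp add: power2_diff)
    then show "cmod (indicator E x * T x) \<le> (indicator E x + (cmod (T x))\<^sup>2) / 2"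
      by (simp add: norm_mult indicator_def)
    show "integrable circle (\<lambda>x. cmod (indicator E x * T x))"
    proof (rule integrable_circle_bounded)
      show "norm (cmod (indicator E x * T x)) \<le> (\<Sum>m\<in>F. cmod (cnj (c m)))" for x
        unfolding T_def using norm_trig_sum_le[of F "\<lambda>m. cnj (c m)" "\<lambda>m. m" x]
        by (auto simp: norm_mult indicator_def sum_nonneg)
    qed measurable
    show "integrable circle (\<lambda>x. (indicator E x + (cmod (T x))\<^sup>2) / 2)"
      unfolding T_def
      by (intro integrable_divide Bochner_Integration.integrable_add integrable_trig_sum_power integrable_circle_bounded[where B = 1])
         (auto simp: indicator_def)
  qed
  also have "\<dots> = (measure circle E + B) / 2"
  proof -
    have "integrable circle (\<lambda>x. indicator E x :: real)"
      by (rule integrable_circle_bounded[where B = 1]) (auto simp: indicator_def)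
    then have "(\<integral>x. indicator E x + (cmod (T x))\<^sup>2 \<partial>circle) = measure circle E + B"
      using integrable_trig_sum_power[of F "\<lambda>m. cnj (c m)" "\<lambda>m. m" 2] parT ind
      by (subst Bochner_Integration.integral_add) (auto simp: T_def)
    then show ?thesis by simp
  qed
  finally show ?thesis unfolding B_def c_def by simp
qed

text \<open>
The integral of \<open>cmod (F x)\<close> over \<open>E\<close> is the pairing of \<open>F\<close> with a function \<open>u\<close> of modulus at most 1 supported on \<open>E\<close>;
moving the operator to \<open>u\<close> and squaring produces the kernel with coefficients 1.  This is the \<open>T T*\<close> argument.
\<close>

lemma level_set_duality:
  fixes a :: "'i \<Rightarrow> complex" and f :: "'i \<Rightarrow> int"
  assumes I: "finite I" and \<Lambda>: "\<Lambda> \<ge> 0"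
  defines "E \<equiv> {x \<in> {0..<1}. \<Lambda> < cmod (trig_sum I a f x)}"
  shows "E \<in> sets circle"
    "\<Lambda>\<^sup>2 * (measure circle E)\<^sup>2 \<le> (\<Sum>i\<in>I. (cmod (a i))\<^sup>2) *
       (\<integral>z. indicator E (fst z) * indicator E (snd z) * cmod (trig_sum I (\<lambda>_. 1) f (fst z - snd z)) \<partial>torus2)"
proof -
  let ?F = "trig_sum I a f" and ?K = "trig_sum I (\<lambda>_. 1) f"
  have mF [measurable]: "?F \<in> borel_measurable circle" by (rule measurable_circleI) measurable
  have "{x \<in> space circle. \<Lambda> < cmod (?F x)} \<in> sets circle" by measurable
  then show E [measurable]: "E \<in> sets circle" by (simp add: E_def)
  have ind: "(\<integral>x. indicator E x \<partial>circle) = measure circle E"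
    using sets.sets_into_space[OF E] by (simp add: Int_absorb2 Int_commute)
  \<comment> \<open>\<open>u\<close> removes the phase of \<open>F\<close> on \<open>E\<close>\<close>
  define u where "u x = indicator E x * cnj (sgn (?F x))" for x
  have mu [measurable]: "u \<in> borel_measurable circle"
  proof -
    have "(\<lambda>z::complex. inverse (norm z) *\<^sub>R cnj z) \<in> borel_measurable borel"
      by (intro borel_measurable_scaleR borel_measurable_inverse borel_measurable_norm borel_measurable_continuous_onI continuous_intros measurable_ident)
    then have "(\<lambda>z. cnj (sgn z)) \<in> borel_measurable borel"
      by (simp add: sgn_div_norm)
    then have "(\<lambda>x. cnj (sgn (?F x))) \<in> borel_measurable circle" by (rule measurable_compose[OF mF])
    then show ?thesis unfolding u_def by (intro borel_measurable_times) auto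
  qed
  have bu: "cmod (u x) \<le> indicator E x" for x
    by (simp add: u_def norm_mult norm_sgn indicator_def)
  then have bu1: "cmod (u x) \<le> 1" for x by (rule order_trans) (simp add: indicator_def)
  have uF: "u x * ?F x = of_real (indicator E x * cmod (?F x))" for x
  proof -
    have "cnj (?F x) * ?F x = of_real (cmod (?F x)) * of_real (cmod (?F x))"
      using cmod_square_cnj[of "?F x"] by (simp add: power2_eq_square mult.commute)
    then have "cnj (sgn (?F x)) * ?F x = of_real (cmod (?F x))"
      by (cases "?F x = 0") (simp_all add: sgn_eq)
    then show ?thesis by (simp add: u_def indicator_def)
  qed
  let ?c = "\<lambda>i. fourier_coeff u (f i)"
  have "\<Lambda> * measure circle E = (\<integral>x. \<Lambda> * indicator E x \<partial>circle)"
    unfolding ind[symmetric] by (rule integral_mult_right_zero[symmetric])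
  also have "\<dots> \<le> (\<integral>x. indicator E x * cmod (?F x) \<partial>circle)"
  proof (rule integral_mono)
    show "integrable circle (\<lambda>x. \<Lambda> * indicator E x)"
      by (rule integrable_circle_bounded[where B = \<Lambda>]) (use \<Lambda> in \<open>auto simp: indicator_def\<close>)
    show "integrable circle (\<lambda>x. indicator E x * cmod (?F x))"
      by (rule integrable_circle_bounded[where B = "\<Sum>i\<in>I. cmod (a i)"])
         (auto simp: indicator_def norm_trig_sum_le sum_nonneg)
    show "\<Lambda> * indicator E x \<le> indicator E x * cmod (?F x)" for x
      by (auto simp: indicator_def E_def)
  qed
  finally have 1: "\<Lambda> * measure circle E \<le> (\<integral>x. indicator E x * cmod (?F x) \<partial>circle)" .
  have int: "integrable circle (\<lambda>x. u x * (a i * e_char (x * of_int (f i))))" for i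
  proof (rule integrable_circle_bounded)
    show "norm (u x * (a i * e_char (x * of_int (f i)))) \<le> 1 * cmod (a i)" for x
      unfolding norm_mult norm_e_char mult_1_right using bu1 by (intro mult_right_mono) auto
  qed (intro borel_measurable_times mu measurable_circleI, measurable)
  have "complex_of_real (\<integral>x. indicator E x * cmod (?F x) \<partial>circle) = (\<integral>x. u x * ?F x \<partial>circle)"
    unfolding uF by (rule integral_complex_of_real[symmetric])
  also have "\<dots> = (\<Sum>i\<in>I. \<integral>x. u x * (a i * e_char (x * of_int (f i))) \<partial>circle)"
    unfolding trig_sum_def sum_distrib_left by (rule Bochner_Integration.integral_sum) (rule int)
  also have "\<dots> = (\<Sum>i\<in>I. a i * ?c i)"
  proof (rule sum.cong)
    fix i
    have "(\<integral>x. u x * (a i * e_char (x * of_int (f i))) \<partial>circle) = (\<integral>x. a i * (u x * e_char (x * of_int (f i))) \<partial>circle)"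
      by (simp only: mult.left_commute)
    then show "(\<integral>x. u x * (a i * e_char (x * of_int (f i))) \<partial>circle) = a i * ?c i"
      by (simp add: fourier_coeff_def)
  qed simp
  finally have 2: "complex_of_real (\<integral>x. indicator E x * cmod (?F x) \<partial>circle) = (\<Sum>i\<in>I. a i * ?c i)" .
  have "(\<Lambda> * measure circle E)\<^sup>2 \<le> (\<integral>x. indicator E x * cmod (?F x) \<partial>circle)\<^sup>2"
    using 1 \<Lambda> by (intro power_mono) auto
  also have "\<dots> = (cmod (\<Sum>i\<in>I. a i * ?c i))\<^sup>2"
    unfolding 2[symmetric] by simp
  also have "\<dots> \<le> (\<Sum>i\<in>I. (cmod (a i))\<^sup>2) * (\<Sum>i\<in>I. (cmod (?c i))\<^sup>2)"
    by (rule norm_sum_mult_square_le)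
  also have "\<dots> \<le> (\<Sum>i\<in>I. (cmod (a i))\<^sup>2) *
       (\<integral>z. indicator E (fst z) * indicator E (snd z) * cmod (?K (fst z - snd z)) \<partial>torus2)"
  proof (rule mult_left_mono)
    let ?h = "\<lambda>z. u (fst z) * cnj (u (snd z)) * ?K (fst z - snd z)"
    have "complex_of_real (\<Sum>i\<in>I. (cmod (?c i))\<^sup>2)
        = (\<Sum>i\<in>I. \<integral>z. u (fst z) * cnj (u (snd z)) * e_char ((fst z - snd z) * of_int (f i)) \<partial>torus2)"
      unfolding of_real_sum fourier_coeff_torus2(2)[OF mu bu1] ..
    also have "\<dots> = (\<integral>z. ?h z \<partial>torus2)"
      unfolding trig_sum_def sum_distrib_left mult_1_left
      by (rule Bochner_Integration.integral_sum[symmetric]) (rule fourier_coeff_torus2(1)[OF mu bu1])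
    finally have eqh: "complex_of_real (\<Sum>i\<in>I. (cmod (?c i))\<^sup>2) = (\<integral>z. ?h z \<partial>torus2)" .
    have "(\<Sum>i\<in>I. (cmod (?c i))\<^sup>2) = cmod (complex_of_real (\<Sum>i\<in>I. (cmod (?c i))\<^sup>2))"
      by (simp only: norm_of_real abs_of_nonneg sum_nonneg zero_le_power2)
    also have "\<dots> = cmod (\<integral>z. ?h z \<partial>torus2)"
      by (simp only: eqh)
    also have "\<dots> \<le> (\<integral>z. cmod (?h z) \<partial>torus2)" by (rule integral_norm_bound)
    also have "\<dots> \<le> (\<integral>z. indicator E (fst z) * indicator E (snd z) * cmod (?K (fst z - snd z)) \<partial>torus2)"
    proof (rule integral_mono')
      show "integrable torus2 (\<lambda>z. indicator E (fst z) * indicator E (snd z) * cmod (?K (fst z - snd z)))"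
      proof (rule integrable_torus2_bounded)
        show "norm (indicator E (fst z) * indicator E (snd z) * cmod (?K (fst z - snd z))) \<le> real (card I)" for z :: "real \<times> real"
        proof -
          have "cmod (?K (fst z - snd z)) \<le> real (card I)"
            using norm_trig_sum_le[of I "\<lambda>_. 1" f "fst z - snd z"] by simp
          then show ?thesis
            by (cases "fst z \<in> E"; cases "snd z \<in> E") simp_all
        qed
        have "(\<lambda>z. ?K (fst z - snd z)) \<in> borel_measurable torus2"
          by (rule measurable_compose[OF borel_measurable_diff[OF measurable_torus2_fst measurable_torus2_snd] measurable_trig_sum])
        then have "(\<lambda>z. cmod (?K (fst z - snd z))) \<in> borel_measurable torus2"
          by (rule measurable_compose[OF _ borel_measurable_norm])
        then show "(\<lambda>z. indicator E (fst z) * indicator E (snd z) * cmod (?K (fst z - snd z))) \<in> borel_measurable torus2"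
          by (intro borel_measurable_times
              measurable_compose[OF measurable_fst borel_measurable_indicator[OF E]]
              measurable_compose[OF measurable_snd borel_measurable_indicator[OF E]])
      qed
      show "cmod (?h z) \<le> indicator E (fst z) * indicator E (snd z) * cmod (?K (fst z - snd z))" for z
      proof -
        have "cmod (u (fst z)) * cmod (u (snd z)) \<le> indicator E (fst z) * indicator E (snd z)"
          by (rule mult_mono[OF bu bu]) simp_all
        then show ?thesis
          unfolding norm_mult complex_mod_cnj by (rule mult_right_mono) simp
      qed
    qed simp
    finally show "(\<Sum>i\<in>I. (cmod (?c i))\<^sup>2)
        \<le> (\<integral>z. indicator E (fst z) * indicator E (snd z) * cmod (?K (fst z - snd z)) \<partial>torus2)" .
  qed (simp add: sum_nonneg)
  finally show "\<Lambda>\<^sup>2 * (measure circle E)\<^sup>2 \<le> (\<Sum>i\<in>I. (cmod (a i))\<^sup>2) *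
       (\<integral>z. indicator E (fst z) * indicator E (snd z) * cmod (?K (fst z - snd z)) \<partial>torus2)"
    by (simp add: power_mult_distrib)
qed

definition dirichlet_kernel :: "nat \<Rightarrow> real \<Rightarrow> complex" where
  "dirichlet_kernel M t = (\<Sum>m<M. e_char (t * real m))"

lemma cmod_dirichlet_kernel_ge:
  assumes "real M * \<bar>t\<bar> \<le> 1 / 6"
  shows "real M / 2 \<le> cmod (dirichlet_kernel M t)"
proof -
  have "real M / 2 = (\<Sum>m<M. 1 / 2)" by simp
  also have "\<dots> \<le> (\<Sum>m<M. Re (e_char (t * real m)))"
  proof (rule sum_mono)
    fix m assume "m \<in> {..<M}"
    then have "real m * \<bar>t\<bar> \<le> real M * \<bar>t\<bar>" by (intro mult_right_mono) auto
    then have "\<bar>t * real m\<bar> \<le> 1 / 6" using assms by (simp add: abs_mult mult.commute)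
    then have "2 * pi * \<bar>t * real m\<bar> \<le> 2 * pi * (1 / 6)" by (intro mult_left_mono) auto
    then have "cos (pi / 3) \<le> cos (2 * pi * \<bar>t * real m\<bar>)"
      using pi_gt_zero by (intro cos_monotone_0_pi_le) auto
    also have "cos (2 * pi * \<bar>t * real m\<bar>) = cos (2 * pi * (t * real m))" by (simp add: abs_if)
    finally show "1 / 2 \<le> Re (e_char (t * real m))" by (simp add: e_char_cis cos_60)
  qed
  also have "\<dots> = Re (dirichlet_kernel M t)" by (simp add: dirichlet_kernel_def)
  also have "\<dots> \<le> cmod (dirichlet_kernel M t)" by (rule complex_Re_le_cmod)
  finally show ?thesis .
qed

lemma dirichlet_kernel_shift_int: "dirichlet_kernel M (t + of_int k) = dirichlet_kernel M t"
proof -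
  have "e_char ((t + of_int k) * real m) = e_char (t * real m)" for m
  proof -
    have "(t + of_int k) * real m = t * real m + of_int (k * int m)" by (simp add: distrib_right)
    then show ?thesis by (simp only: e_char_add e_char_of_int mult_1_right)
  qed
  then show ?thesis by (simp add: dirichlet_kernel_def)
qed

lemma sum_additive_characters:
  fixes l :: int
  assumes "q \<ge> 1"
  shows "(\<Sum>a<q. e_char (of_int l * (real a / real q))) = (if int q dvd l then of_nat q else 0)"
proof (cases "int q dvd l")
  case True
  then obtain k where k: "l = int q * k" by (elim dvdE)
  have "e_char (of_int l * (real a / real q)) = 1" for a
  proof -
    have "of_int l * (real a / real q) = of_int (k * int a)" using assms k by simp
    then show ?thesis by (simp only: e_char_of_int)
  qed
  then show ?thesis using True by simp
next
  case False
  define w where "w = e_char (of_int l / real q)"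
  have pow: "e_char (of_int l * (real a / real q)) = w ^ a" for a
  proof (induction a)
    case 0
    then show ?case by simp
  next
    case (Suc a)
    have "of_int l * (real (Suc a) / real q) = of_int l / real q + of_int l * (real a / real q)"
      using assms by (simp add: field_simps)
    then show ?case using Suc by (simp add: e_char_add w_def)
  qed
  have wq: "w ^ q = 1"
    unfolding pow[symmetric] using assms e_char_of_int[of l] by simp
  have "w \<noteq> 1"
  proof
    assume "w = 1"
    then have "cis (2 * pi * (of_int l / real q)) = 1" by (simp add: w_def e_char_cis)
    then have "cos (2 * pi * (of_int l / real q)) = 1" by (metis cis.sel(1) one_complex.sel(1))
    then obtain n :: int where "2 * pi * (of_int l / real q) = of_int n * 2 * pi"
      by (auto simp: cos_one_2pi_int)
    then have "of_int l = real q * of_int n" using assms by (simp add: field_simps)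
    then have "real_of_int l = real_of_int (int q * n)" by simp
    then have "l = int q * n" by (simp only: of_int_eq_iff)
    then show False using False by simp
  qed
  then have "(\<Sum>a<q. w ^ a) = (w ^ q - 1) / (w - 1)" by (rule geometric_sum)
  then show ?thesis using False unfolding pow by (simp add: wq)
qed

text \<open>
Summation over the shifts \<open>a / q\<close> retains exactly the frequencies divisible by \<open>q\<close>.
\<close>

lemma sum_shifted_dirichlet_kernels:
  assumes "q \<ge> 1"
  shows "complex_of_real (\<Sum>a<q. (cmod (dirichlet_kernel M (t - real a / real q)))\<^sup>2)
    = of_nat q * (\<Sum>p\<in>{p \<in> {..<M} \<times> {..<M}. int q dvd int (fst p) - int (snd p)}. e_char (t * of_int (int (fst p) - int (snd p))))"
proof -
  let ?l = "\<lambda>p. int (fst p) - int (snd p)"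
  have sq: "complex_of_real ((cmod (dirichlet_kernel M s))\<^sup>2) = (\<Sum>p\<in>{..<M} \<times> {..<M}. e_char (s * of_int (?l p)))" for s
    unfolding cmod_square_cnj dirichlet_kernel_def cnj_sum sum_product sum.cartesian_product
    by (intro sum.cong) (auto simp: right_diff_distrib e_char_diff)
  have "complex_of_real (\<Sum>a<q. (cmod (dirichlet_kernel M (t - real a / real q)))\<^sup>2)
      = (\<Sum>a<q. \<Sum>p\<in>{..<M} \<times> {..<M}. e_char ((t - real a / real q) * of_int (?l p)))"
    unfolding of_real_sum sq ..
  also have "\<dots> = (\<Sum>p\<in>{..<M} \<times> {..<M}. \<Sum>a<q. e_char ((t - real a / real q) * of_int (?l p)))"
    by (rule sum.swap)
  also have "\<dots> = (\<Sum>p\<in>{..<M} \<times> {..<M}. if int q dvd ?l p then of_nat q * e_char (t * of_int (?l p)) else 0)"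
  proof (rule sum.cong)
    fix p
    have "(\<Sum>a<q. e_char ((t - real a / real q) * of_int (?l p)))
        = (\<Sum>a<q. e_char (t * of_int (?l p)) * e_char (of_int (- ?l p) * (real a / real q)))"
      by (intro sum.cong) (simp_all add: e_char_add[symmetric] algebra_simps)
    also have "\<dots> = e_char (t * of_int (?l p)) * (if int q dvd - ?l p then of_nat q else 0)"
      unfolding sum_distrib_left[symmetric] sum_additive_characters[OF assms] ..
    also have "\<dots> = (if int q dvd ?l p then of_nat q * e_char (t * of_int (?l p)) else 0)"
      unfolding dvd_minus_iff by simp
    finally show "(\<Sum>a<q. e_char ((t - real a / real q) * of_int (?l p)))
        = (if int q dvd ?l p then of_nat q * e_char (t * of_int (?l p)) else 0)" .
  qed simp
  also have "\<dots> = (\<Sum>p\<in>{p \<in> {..<M} \<times> {..<M}. int q dvd ?l p}. of_nat q * e_char (t * of_int (?l p)))"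
    by (rule sum.inter_filter[symmetric]) simp
  finally show ?thesis by (simp only: sum_distrib_left)
qed

text \<open>
A frequency \<open>l\<close> is the difference of at most \<open>M\<close> pairs of indices below \<open>M\<close>.
\<close>

lemma integral_shifted_dirichlet_kernels:
  assumes E [measurable]: "E \<in> sets circle" and q: "q \<ge> 1"
  shows "integrable torus2 (\<lambda>z. indicator E (fst z) * indicator E (snd z) * (\<Sum>a<q. (cmod (dirichlet_kernel M (fst z - snd z - real a / real q)))\<^sup>2))"
    and "(\<integral>z. indicator E (fst z) * indicator E (snd z) * (\<Sum>a<q. (cmod (dirichlet_kernel M (fst z - snd z - real a / real q)))\<^sup>2) \<partial>torus2)
      \<le> real q * real M * (\<Sum>l\<in>{l \<in> {- int M<..<int M}. int q dvd l}. (cmod (fourier_coeff (indicator E) l))\<^sup>2)"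
proof -
  let ?l = "\<lambda>p. int (fst p) - int (snd p)"
  let ?P = "{p \<in> {..<M} \<times> {..<M}. int q dvd ?l p}"
  let ?L = "{l \<in> {- int M<..<int M}. int q dvd l}"
  let ?A = "\<lambda>l. (cmod (fourier_coeff (indicator E) l))\<^sup>2"
  let ?g = "\<lambda>z. indicator E (fst z) * indicator E (snd z) * (\<Sum>a<q. (cmod (dirichlet_kernel M (fst z - snd z - real a / real q)))\<^sup>2) :: real"
  let ?h = "\<lambda>p z. indicator E (fst z) * cnj (indicator E (snd z)) * e_char ((fst z - snd z) * of_int (?l p))"
  have mE: "(indicator E :: real \<Rightarrow> complex) \<in> borel_measurable circle" by measurable
  have bE: "cmod (indicator E x) \<le> 1" for x by (simp add: indicator_def)
  have finL: "finite ?L" by (rule finite_subset[of _ "{- int M<..<int M}"]) auto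
  have finP: "finite ?P" by (rule finite_subset[of _ "{..<M} \<times> {..<M}"]) auto
  have g: "complex_of_real (?g z) = of_nat q * (\<Sum>p\<in>?P. ?h p z)" for z
  proof -
    have "complex_of_real (?g z) = complex_of_real (indicator E (fst z) * indicator E (snd z)) *
       (of_nat q * (\<Sum>p\<in>?P. e_char ((fst z - snd z) * of_int (?l p))))"
      unfolding of_real_mult sum_shifted_dirichlet_kernels[OF q, of M "fst z - snd z", symmetric] ..
    also have "\<dots> = of_nat q * (\<Sum>p\<in>?P. ?h p z)"
      by (simp add: sum_distrib_left indicator_def)
    finally show ?thesis .
  qed
  have inth: "integrable torus2 (\<lambda>z. of_nat q * (\<Sum>p\<in>?P. ?h p z))"
    by (intro integrable_mult_right Bochner_Integration.integrable_sum fourier_coeff_torus2(1)[OF mE bE])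
  show intg: "integrable torus2 ?g"
    using integrable_Re[OF inth] unfolding g[symmetric] by (simp only: Re_complex_of_real)
  have "complex_of_real (\<integral>z. ?g z \<partial>torus2) = (\<integral>z. of_nat q * (\<Sum>p\<in>?P. ?h p z) \<partial>torus2)"
    unfolding g[symmetric] by (rule integral_complex_of_real[symmetric])
  also have "\<dots> = of_nat q * (\<Sum>p\<in>?P. \<integral>z. ?h p z \<partial>torus2)"
  proof -
    have "(\<integral>z. (\<Sum>p\<in>?P. ?h p z) \<partial>torus2) = (\<Sum>p\<in>?P. \<integral>z. ?h p z \<partial>torus2)"
      by (rule Bochner_Integration.integral_sum) (rule fourier_coeff_torus2(1)[OF mE bE])
    then show ?thesis by (simp only: integral_mult_right_zero)
  qed
  also have "\<dots> = complex_of_real (real q * (\<Sum>p\<in>?P. ?A (?l p)))"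
    unfolding fourier_coeff_torus2(2)[OF mE bE] by simp
  finally have "(\<integral>z. ?g z \<partial>torus2) = real q * (\<Sum>p\<in>?P. ?A (?l p))"
    by (simp only: of_real_eq_iff)
  also have "(\<Sum>p\<in>?P. ?A (?l p)) \<le> (\<Sum>p\<in>?L \<times> {..<M}. ?A (fst p))"
  proof -
    have inj: "inj_on (\<lambda>p. (?l p, snd p)) ?P" by (auto simp: inj_on_def)
    have "(\<Sum>p\<in>?P. ?A (?l p)) = (\<Sum>p\<in>(\<lambda>p. (?l p, snd p)) ` ?P. ?A (fst p))"
      unfolding sum.reindex[OF inj] by simp
    also have "\<dots> \<le> (\<Sum>p\<in>?L \<times> {..<M}. ?A (fst p))"
      by (rule sum_mono2[OF finite_cartesian_product[OF finL finite_lessThan]]) auto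
    finally show ?thesis .
  qed
  also have "(\<Sum>p\<in>?L \<times> {..<M}. ?A (fst p)) = real M * (\<Sum>l\<in>?L. ?A l)"
  proof -
    have "(\<Sum>p\<in>?L \<times> {..<M}. ?A (fst p)) = (\<Sum>l\<in>?L. \<Sum>m\<in>{..<M}. ?A l)"
      by (simp only: sum.cartesian_product case_prod_unfold)
    then show ?thesis by (simp add: sum_distrib_left)
  qed
  finally show "(\<integral>z. ?g z \<partial>torus2) \<le> real q * real M * (\<Sum>l\<in>?L. ?A l)"
    by (simp add: mult.assoc mult_left_mono)
qed

section \<open>A positive-definite majorant for the major arcs\<close>

text \<open>
The length of a Dirichlet kernel that is comparable to its value at 0 on the arc of radius
\<open>2 * 2 ^ j / N ^ 3\<close>: the constant 12 makes length times radius at most \<open>1/6\<close>.  It may be 0, and then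
the corresponding term of the majorant is 0 because of \<open>4 / 0 = 0\<close>.
\<close>

definition arc_scale :: "nat \<Rightarrow> nat \<Rightarrow> nat" where
  "arc_scale N j = nat \<lfloor>real N ^ 3 / (12 * 2 ^ j)\<rfloor>"

text \<open>
The function \<open>(q * (1 + N ^ 3 * dist)) powr - \<rho>\<close> on the major arcs, with the distance to \<open>a / q\<close> grouped into dyadic ranges.
Squared Dirichlet kernels replace the indicator functions of the arcs, since their Fourier
coefficients are nonnegative and of bounded support.  All residues \<open>a\<close> are included, not only reduced
ones, so that the sum over \<open>a\<close> is as simple as possible.
\<close>

definition arc_majorant :: "nat \<Rightarrow> real \<Rightarrow> nat \<Rightarrow> real \<Rightarrow> real" where
  "arc_majorant N \<rho> X t = (\<Sum>j\<in>{..X}. \<Sum>q\<in>{1..X}. (2 ^ j) powr (- \<rho>) * real q powr (- \<rho>) * (4 / (real (arc_scale N j))\<^sup>2) *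
      (\<Sum>a<q. (cmod (dirichlet_kernel (arc_scale N j) (t - real a / real q)))\<^sup>2))"

lemma arc_majorant_nonneg: "arc_majorant N \<rho> X t \<ge> 0"
  unfolding arc_majorant_def by (intro sum_nonneg mult_nonneg_nonneg) auto

text \<open>
One term of the majorant is large enough: the one with the given \<open>q\<close>, the residue of \<open>a\<close> and the dyadic range \<open>j\<close>
of \<open>Z = 1 + N ^ 3 * \<bar>t - a / q\<bar>\<close>.
\<close>

lemma arc_majorant_ge:
  assumes N: "N \<ge> 1" and q: "q \<ge> 1"
    and Y: "real q * (1 + real N ^ 3 * \<bar>t - of_int a / real q\<bar>) \<le> X0" and X0: "12 * X0 \<le> real N ^ 3" and \<rho>: "\<rho> \<ge> 0"
  shows "(real q * (1 + real N ^ 3 * \<bar>t - of_int a / real q\<bar>)) powr (- \<rho>) \<le> arc_majorant N \<rho> (nat \<lfloor>X0\<rfloor>) t"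
proof -
  define X where "X = nat \<lfloor>X0\<rfloor>"
  define Z where "Z = 1 + real N ^ 3 * \<bar>t - of_int a / real q\<bar>"
  have Z: "Z \<ge> 1" by (simp add: Z_def)
  have q1: "real q \<ge> 1" using q by simp
  have ZX: "Z \<le> X0" using Y Z q1 mult_right_mono[of 1 "real q" Z] unfolding Z_def[symmetric] by linarith
  have qX: "real q \<le> X0" using Y Z q1 mult_left_mono[of 1 Z "real q"] unfolding Z_def[symmetric] by linarith
  have leX: "n \<le> X" if "real n \<le> X0" for n
    unfolding X_def using that by (simp add: le_nat_iff le_floor_iff)
  define j where "j = nat \<lfloor>log 2 Z\<rfloor>"
  have lz: "log 2 Z \<ge> 0" using Z by simp
  have j1: "2 ^ j \<le> Z"
  proof -
    have "real j \<le> log 2 Z" using lz by (simp add: j_def)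
    then have "2 powr real j \<le> 2 powr (log 2 Z)" by (intro powr_mono) auto
    then show ?thesis using Z by (simp add: powr_realpow)
  qed
  have j2: "Z \<le> 2 * 2 ^ j"
  proof -
    have "log 2 Z \<le> real (Suc j)" using lz unfolding j_def by linarith
    then have "2 powr (log 2 Z) \<le> 2 powr (real (Suc j))" by (intro powr_mono) auto
    then show ?thesis using Z by (simp add: powr_realpow del: of_nat_Suc)
  qed
  have jX: "j \<le> X"
  proof (rule leX)
    have "real j < 2 ^ j" by (rule of_nat_less_two_power)
    then show "real j \<le> X0" using j1 ZX by linarith
  qed
  define M where "M = arc_scale N j"
  have M1: "M \<ge> 1"
  proof -
    have "12 * 2 ^ j \<le> real N ^ 3" using j1 ZX X0 by linarith
    then have "1 \<le> real N ^ 3 / (12 * 2 ^ j)" by simp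
    then have "1 \<le> \<lfloor>real N ^ 3 / (12 * 2 ^ j)\<rfloor>" by (simp add: le_floor_iff)
    then show ?thesis unfolding M_def arc_scale_def by linarith
  qed
  have Mle: "real M \<le> real N ^ 3 / (12 * 2 ^ j)"
    unfolding M_def arc_scale_def by simp
  have "real M * \<bar>t - of_int a / real q\<bar> \<le> real N ^ 3 / (12 * 2 ^ j) * \<bar>t - of_int a / real q\<bar>"
    using Mle by (intro mult_right_mono) auto
  also have "\<dots> = (Z - 1) / (12 * 2 ^ j)" by (simp add: Z_def)
  also have "\<dots> \<le> (2 * 2 ^ j) / (12 * 2 ^ j)" using j2 by (intro divide_right_mono) auto
  finally have "real M * \<bar>t - of_int a / real q\<bar> \<le> 1 / 6" by simp
  then have D: "real M / 2 \<le> cmod (dirichlet_kernel M (t - of_int a / real q))"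
    by (rule cmod_dirichlet_kernel_ge)
  define a' where "a' = nat (a mod int q)"
  have a': "int a' = a mod int q" "a' < q" using q by (simp_all add: a'_def nat_less_iff)
  have "dirichlet_kernel M (t - real a' / real q) = dirichlet_kernel M (t - of_int a / real q)"
  proof -
    have "real a' = of_int a - real q * of_int (a div int q)"
    proof -
      have "int a' = a - int q * (a div int q)" using a'(1) by (simp add: minus_mult_div_eq_mod)
      then have "real_of_int (int a') = real_of_int (a - int q * (a div int q))" by (simp only:)
      then show ?thesis by simp
    qed
    then have "t - real a' / real q = (t - of_int a / real q) + of_int (a div int q)"
      using q1 by (simp add: diff_divide_distrib)
    then show ?thesis by (simp only: dirichlet_kernel_shift_int)
  qed
  then have "(real M / 2)\<^sup>2 \<le> (cmod (dirichlet_kernel M (t - real a' / real q)))\<^sup>2"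
    using D by (intro power_mono) auto
  also have "\<dots> \<le> (\<Sum>a<q. (cmod (dirichlet_kernel M (t - real a / real q)))\<^sup>2)"
    using a' by (intro member_le_sum) auto
  finally have "4 / (real M)\<^sup>2 * (real M / 2)\<^sup>2 \<le> 4 / (real M)\<^sup>2 * (\<Sum>a<q. (cmod (dirichlet_kernel M (t - real a / real q)))\<^sup>2)"
    by (intro mult_left_mono) auto
  then have one: "1 \<le> 4 / (real M)\<^sup>2 * (\<Sum>a<q. (cmod (dirichlet_kernel M (t - real a / real q)))\<^sup>2)"
    using M1 by (simp add: power_divide)
  have "(real q * Z) powr (- \<rho>) = Z powr (- \<rho>) * real q powr (- \<rho>)"
    using Z by (simp add: powr_mult)
  also have "\<dots> \<le> (2 ^ j) powr (- \<rho>) * real q powr (- \<rho>)"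
    using j1 \<rho> by (intro mult_right_mono powr_mono2') auto
  also have "\<dots> * 1 \<le> (2 ^ j) powr (- \<rho>) * real q powr (- \<rho>) * (4 / (real M)\<^sup>2 * (\<Sum>a<q. (cmod (dirichlet_kernel M (t - real a / real q)))\<^sup>2))"
    using one by (intro mult_left_mono) auto
  finally have "(real q * Z) powr (- \<rho>) \<le> (2 ^ j) powr (- \<rho>) * real q powr (- \<rho>) * (4 / (real (arc_scale N j))\<^sup>2) * (\<Sum>a<q. (cmod (dirichlet_kernel (arc_scale N j) (t - real a / real q)))\<^sup>2)"
    by (simp add: M_def mult.assoc)
  also have "\<dots> \<le> (\<Sum>q\<in>{1..X}. (2 ^ j) powr (- \<rho>) * real q powr (- \<rho>) * (4 / (real (arc_scale N j))\<^sup>2) * (\<Sum>a<q. (cmod (dirichlet_kernel (arc_scale N j) (t - real a / real q)))\<^sup>2))"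
  proof (rule member_le_sum[where f = "\<lambda>q. (2 ^ j) powr (- \<rho>) * real q powr (- \<rho>) * (4 / (real (arc_scale N j))\<^sup>2) * (\<Sum>a<q. (cmod (dirichlet_kernel (arc_scale N j) (t - real a / real q)))\<^sup>2)"])
    show "q \<in> {1..X}" using q leX[OF qX] by simp
  qed (intro mult_nonneg_nonneg sum_nonneg, simp_all)
  also have "\<dots> \<le> arc_majorant N \<rho> X t"
    unfolding arc_majorant_def
  proof (rule member_le_sum[where f = "\<lambda>j. \<Sum>q\<in>{1..X}. (2 ^ j) powr (- \<rho>) * real q powr (- \<rho>) * (4 / (real (arc_scale N j))\<^sup>2) * (\<Sum>a<q. (cmod (dirichlet_kernel (arc_scale N j) (t - real a / real q)))\<^sup>2)"])
    show "j \<in> {..X}" using jX by simp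
  qed (intro mult_nonneg_nonneg sum_nonneg, simp_all)
  finally show ?thesis unfolding X_def Z_def .
qed

lemma inverse_arc_scale_le:
  assumes "N \<ge> 1"
  shows "4 / (real (arc_scale N j))\<^sup>2 * real (arc_scale N j) \<le> 96 * 2 ^ j / real N ^ 3"
proof (cases "arc_scale N j = 0")
  case True
  then show ?thesis by simp
next
  case False
  define y where "y = real N ^ 3 / (12 * 2 ^ j)"
  have y: "y > 0" using assms by (simp add: y_def)
  have fl: "\<lfloor>y\<rfloor> \<ge> 1" using False unfolding arc_scale_def y_def[symmetric] by linarith
  have M: "real (arc_scale N j) = of_int \<lfloor>y\<rfloor>" unfolding arc_scale_def y_def[symmetric] using fl by simp
  have "y < of_int \<lfloor>y\<rfloor> + 1" by linarith
  also have "\<dots> \<le> 2 * of_int \<lfloor>y\<rfloor>" using fl by linarith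
  finally have "y \<le> 2 * real (arc_scale N j)" unfolding M by simp
  then have "8 / (2 * real (arc_scale N j)) \<le> 8 / y"
    using y False by (intro divide_left_mono mult_pos_pos) auto
  moreover have "4 / (real (arc_scale N j))\<^sup>2 * real (arc_scale N j) = 8 / (2 * real (arc_scale N j))"
    using False by (simp add: power2_eq_square)
  moreover have "8 / y = 96 * 2 ^ j / real N ^ 3" by (simp add: y_def)
  ultimately show ?thesis by simp
qed

lemma sum_geometric_le:
  fixes r :: real
  assumes "0 \<le> r" "r < 1" "finite F"
  shows "(\<Sum>j\<in>F. r ^ j) \<le> 1 / (1 - r)"
proof -
  have "(\<Sum>j\<in>F. r ^ j) \<le> (\<Sum>j. r ^ j)"
    using assms by (intro sum_le_suminf summable_geometric) auto
  also have "\<dots> = 1 / (1 - r)" using assms by (intro suminf_geometric) auto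
  finally show ?thesis .
qed

definition int_divisors_upto :: "nat \<Rightarrow> int \<Rightarrow> nat" where
  "int_divisors_upto X l = card {q \<in> {1..X}. int q dvd l}"

text \<open>
For each \<open>j\<close> and \<open>q\<close> the integral is a sum over the multiples of \<open>q\<close>; summing over \<open>q\<close> produces the truncated
divisor function, and \<open>\<rho> > 1\<close> makes both the powers of \<open>q\<close> bounded and the sum over \<open>j\<close> geometric.
\<close>

lemma integral_arc_majorant:
  assumes E [measurable]: "E \<in> sets circle" and N: "N \<ge> 1" and \<rho>: "\<rho> > 1"
  shows "integrable torus2 (\<lambda>z. indicator E (fst z) * indicator E (snd z) * arc_majorant N \<rho> X (fst z - snd z))"
    and "(\<integral>z. indicator E (fst z) * indicator E (snd z) * arc_majorant N \<rho> X (fst z - snd z) \<partial>torus2)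
      \<le> 96 / (1 - 2 powr (1 - \<rho>)) / real N ^ 3 *
        (\<Sum>l\<in>{- int (N ^ 3)<..<int (N ^ 3)}. real (int_divisors_upto X l) * (cmod (fourier_coeff (indicator E) l))\<^sup>2)"
proof -
  let ?w = "\<lambda>j q. (2 ^ j) powr (- \<rho>) * real q powr (- \<rho>) * (4 / (real (arc_scale N j))\<^sup>2)"
  let ?D = "\<lambda>j q t. \<Sum>a<q. (cmod (dirichlet_kernel (arc_scale N j) (t - real a / real q)))\<^sup>2"
  let ?e = "\<lambda>z. indicator E (fst z) * indicator E (snd z) :: real"
  let ?A = "\<lambda>l. (cmod (fourier_coeff (indicator E) l))\<^sup>2"
  let ?L = "{- int (N ^ 3)<..<int (N ^ 3)}"
  define S where "S = (\<Sum>l\<in>?L. real (int_divisors_upto X l) * ?A l)"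
  have split: "?e z * arc_majorant N \<rho> X (fst z - snd z) = (\<Sum>j\<in>{..X}. \<Sum>q\<in>{1..X}. ?w j q * (?e z * ?D j q (fst z - snd z)))" for z
    unfolding arc_majorant_def sum_distrib_left by (intro sum.cong refl) (simp only: mult_ac sum_distrib_left)
  have int: "integrable torus2 (\<lambda>z. ?w j q * (?e z * ?D j q (fst z - snd z)))" if "q \<in> {1..X}" for j q
    using that by (intro integrable_mult_right integral_shifted_dirichlet_kernels(1)[OF E]) auto
  show "integrable torus2 (\<lambda>z. ?e z * arc_majorant N \<rho> X (fst z - snd z))"
    unfolding split by (intro Bochner_Integration.integrable_sum int)
  have Sq: "(\<Sum>q\<in>{1..X}. \<Sum>l\<in>{l \<in> ?L. int q dvd l}. ?A l) = S"
  proof -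
    have "(\<Sum>q\<in>{1..X}. \<Sum>l\<in>{l \<in> ?L. int q dvd l}. ?A l) = (\<Sum>q\<in>{1..X}. \<Sum>l\<in>?L. if int q dvd l then ?A l else 0)"
      by (simp only: sum.inter_filter[OF finite_greaterThanLessThan_int])
    also have "\<dots> = (\<Sum>l\<in>?L. \<Sum>q\<in>{1..X}. if int q dvd l then ?A l else 0)" by (rule sum.swap)
    also have "\<dots> = S"
      unfolding S_def int_divisors_upto_def
      by (simp only: sum.inter_filter[OF finite_atLeastAtMost, symmetric] sum_constant)
    finally show ?thesis .
  qed
  have S0: "S \<ge> 0" unfolding S_def by (intro sum_nonneg) auto
  have "(\<integral>z. ?e z * arc_majorant N \<rho> X (fst z - snd z) \<partial>torus2)
      = (\<Sum>j\<in>{..X}. \<Sum>q\<in>{1..X}. ?w j q * (\<integral>z. ?e z * ?D j q (fst z - snd z) \<partial>torus2))"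
  proof -
    have "(\<integral>z. ?e z * arc_majorant N \<rho> X (fst z - snd z) \<partial>torus2)
        = (\<Sum>j\<in>{..X}. \<integral>z. (\<Sum>q\<in>{1..X}. ?w j q * (?e z * ?D j q (fst z - snd z))) \<partial>torus2)"
      unfolding split by (rule Bochner_Integration.integral_sum) (intro Bochner_Integration.integrable_sum int)
    also have "\<dots> = (\<Sum>j\<in>{..X}. \<Sum>q\<in>{1..X}. \<integral>z. ?w j q * (?e z * ?D j q (fst z - snd z)) \<partial>torus2)"
      by (intro sum.cong refl Bochner_Integration.integral_sum int)
    finally show ?thesis by (simp only: integral_mult_right_zero)
  qed
  also have "\<dots> \<le> (\<Sum>j\<in>{..X}. \<Sum>q\<in>{1..X}. (2 powr (1 - \<rho>)) ^ j * (96 / real N ^ 3) * (\<Sum>l\<in>{l \<in> ?L. int q dvd l}. ?A l))"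
  proof (intro sum_mono)
    fix j q assume q: "q \<in> {1..X}"
    let ?M = "arc_scale N j"
    let ?s = "\<Sum>l\<in>{l \<in> {- int ?M<..<int ?M}. int q dvd l}. ?A l"
    let ?S = "\<Sum>l\<in>{l \<in> ?L. int q dvd l}. ?A l"
    have q1: "real q \<ge> 1" using q by simp
    have scale_le: "?M \<le> N ^ 3"
    proof -
      have "real N ^ 3 / (12 * 2 ^ j) \<le> real N ^ 3 / 1"
        by (intro divide_left_mono) (auto intro: order_trans[OF _ mult_mono[of 1 12 1 "2 ^ j"]])
      then have "\<lfloor>real N ^ 3 / (12 * 2 ^ j)\<rfloor> \<le> \<lfloor>real N ^ 3\<rfloor>" by (intro floor_mono) simp
      also have "\<lfloor>real N ^ 3\<rfloor> = int (N ^ 3)" by (metis floor_of_nat of_nat_power)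
      finally show ?thesis unfolding arc_scale_def by linarith
    qed
    have sS: "?s \<le> ?S"
    proof (rule sum_mono2)
      have "int ?M \<le> int (N ^ 3)" using scale_le by (simp only: of_nat_le_iff)
      then show "{l \<in> {- int ?M<..<int ?M}. int q dvd l} \<subseteq> {l \<in> ?L. int q dvd l}" by (auto simp del: of_nat_power)
      show "finite {l \<in> ?L. int q dvd l}" by (rule finite_subset[of _ ?L]) auto
    qed auto
    have s0: "?S \<ge> 0" by (intro sum_nonneg) auto
    have "?w j q * (\<integral>z. ?e z * ?D j q (fst z - snd z) \<partial>torus2) \<le> ?w j q * (real q * real ?M * ?s)"
      using q by (intro mult_left_mono integral_shifted_dirichlet_kernels(2)[OF E]) auto
    also have "\<dots> \<le> ?w j q * (real q * real ?M * ?S)"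
      using sS by (intro mult_left_mono) auto
    also have "\<dots> = (2 ^ j) powr (- \<rho>) * (real q powr (- \<rho>) * real q) * (4 / (real ?M)\<^sup>2 * real ?M) * ?S"
      by (simp only: mult_ac)
    also have "\<dots> \<le> (2 ^ j) powr (- \<rho>) * 1 * (96 * 2 ^ j / real N ^ 3) * ?S"
    proof (intro mult_right_mono[OF _ s0] mult_mono inverse_arc_scale_le[OF N] mult_left_mono)
      have "real q powr (- \<rho>) * real q = real q powr (- \<rho> + 1)"
        using powr_add[of "real q" "- \<rho>" 1] q1 by simp
      also have "\<dots> \<le> real q powr 0" using q1 \<rho> by (intro powr_mono) auto
      finally show "real q powr (- \<rho>) * real q \<le> 1" using q1 by simp
    qed auto
    also have "\<dots> = (2 powr (1 - \<rho>)) ^ j * (96 / real N ^ 3) * ?S"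
    proof -
      have "(2 ^ j) powr (- \<rho>) * 2 ^ j = (2 powr (1 - \<rho>)) ^ j"
        by (simp add: powr_powr powr_add[symmetric] algebra_simps flip: powr_realpow)
      then show ?thesis by (simp add: mult_ac)
    qed
    finally show "?w j q * (\<integral>z. ?e z * ?D j q (fst z - snd z) \<partial>torus2) \<le> (2 powr (1 - \<rho>)) ^ j * (96 / real N ^ 3) * ?S" .
  qed
  also have "\<dots> = (\<Sum>j\<in>{..X}. (2 powr (1 - \<rho>)) ^ j) * (96 / real N ^ 3 * S)"
  proof -
    have "(\<Sum>q\<in>{1..X}. (2 powr (1 - \<rho>)) ^ j * (96 / real N ^ 3) * (\<Sum>l\<in>{l \<in> ?L. int q dvd l}. ?A l))
        = (2 powr (1 - \<rho>)) ^ j * (96 / real N ^ 3 * S)" for j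
      unfolding sum_distrib_left[symmetric] Sq by (rule mult.assoc)
    then show ?thesis by (simp only: sum_distrib_right)
  qed
  also have "\<dots> \<le> 1 / (1 - 2 powr (1 - \<rho>)) * (96 / real N ^ 3 * S)"
  proof (intro mult_right_mono sum_geometric_le)
    have "2 powr (1 - \<rho>) < 2 powr 0" using \<rho> by (intro powr_less_mono) auto
    then show "2 powr (1 - \<rho>) < (1::real)" by simp
  qed (use S0 in auto)
  finally show "(\<integral>z. ?e z * arc_majorant N \<rho> X (fst z - snd z) \<partial>torus2)
      \<le> 96 / (1 - 2 powr (1 - \<rho>)) / real N ^ 3 * (\<Sum>l\<in>?L. real (int_divisors_upto X l) * ?A l)"
    unfolding S_def by simp
qed

lemma sum_nonzero_int_le:
  fixes f :: "nat \<Rightarrow> real"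
  assumes "\<And>n. f n \<ge> 0"
  shows "(\<Sum>l\<in>{- int L<..<int L} - {0}. f (nat \<bar>l\<bar>)) \<le> 2 * (\<Sum>n\<in>{1..L}. f n)"
proof -
  have sub: "{- int L<..<int L} - {0} \<subseteq> int ` {1..L} \<union> (\<lambda>n. - int n) ` {1..L}"
  proof
    fix l assume l: "l \<in> {- int L<..<int L} - {0}"
    then have "nat \<bar>l\<bar> \<in> {1..L}" by auto
    moreover have "l = int (nat \<bar>l\<bar>) \<or> l = - int (nat \<bar>l\<bar>)" by auto
    ultimately show "l \<in> int ` {1..L} \<union> (\<lambda>n. - int n) ` {1..L}" by blast
  qed
  have "(\<Sum>l\<in>{- int L<..<int L} - {0}. f (nat \<bar>l\<bar>)) \<le> (\<Sum>l\<in>int ` {1..L} \<union> (\<lambda>n. - int n) ` {1..L}. f (nat \<bar>l\<bar>))"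
    using sub assms by (intro sum_mono2) auto
  also have "\<dots> \<le> (\<Sum>l\<in>int ` {1..L}. f (nat \<bar>l\<bar>)) + (\<Sum>l\<in>(\<lambda>n. - int n) ` {1..L}. f (nat \<bar>l\<bar>))"
    using assms by (subst sum.union_inter[symmetric]) (auto intro!: sum_nonneg)
  also have "(\<Sum>l\<in>int ` {1..L}. f (nat \<bar>l\<bar>)) = (\<Sum>n\<in>{1..L}. f n)"
    by (subst sum.reindex) (auto simp: inj_on_def)
  also have "(\<Sum>l\<in>(\<lambda>n. - int n) ` {1..L}. f (nat \<bar>l\<bar>)) = (\<Sum>n\<in>{1..L}. f n)"
    by (subst sum.reindex) (auto simp: inj_on_def)
  finally show ?thesis by simp
qed

text \<open>
Where the number of divisors is at most \<open>T\<close> the Bessel inequality is used, elsewhere the trivial bound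
\<open>\<mu>\<close> for the Fourier coefficients together with a high moment: \<open>d \<le> T + d ^ (b + 1) / T ^ b\<close>.
\<close>

lemma divisor_weighted_sum_le:
  fixes T :: real
  assumes E [measurable]: "E \<in> sets circle" and T: "T > 0"
  shows "(\<Sum>l\<in>{- int L<..<int L}. real (int_divisors_upto X l) * (cmod (fourier_coeff (indicator E) l))\<^sup>2)
    \<le> real X * (measure circle E)\<^sup>2 + T * measure circle E
      + 2 / T ^ b * (\<Sum>n\<in>{1..L}. real (card (divisors_upto X n)) ^ Suc b) * (measure circle E)\<^sup>2"
proof -
  let ?L = "{- int L<..<int L}"
  let ?A = "\<lambda>l. (cmod (fourier_coeff (indicator E) l))\<^sup>2"
  let ?\<mu> = "measure circle E"
  let ?d = "\<lambda>n. real (card (divisors_upto X n))"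
  have A: "?A l \<le> ?\<mu>\<^sup>2" for l
    using fourier_coeff_indicator_le[OF E] by (intro power_mono) auto
  have d0: "int_divisors_upto X 0 = X"
  proof -
    have "{q \<in> {1..X}. int q dvd 0} = {1..X}" by auto
    then show ?thesis unfolding int_divisors_upto_def by simp
  qed
  have d: "int_divisors_upto X l = card (divisors_upto X (nat \<bar>l\<bar>))" for l
    unfolding int_divisors_upto_def divisors_upto_def by (simp add: dvd_nat_abs_iff int_dvd_int_iff[symmetric] del: int_dvd_int_iff)
  have key: "real (int_divisors_upto X l) * ?A l \<le> T * ?A l + ?d (nat \<bar>l\<bar>) ^ Suc b / T ^ b * ?\<mu>\<^sup>2" for l
  proof (cases "?d (nat \<bar>l\<bar>) \<le> T")
    case True
    then have "?d (nat \<bar>l\<bar>) * ?A l \<le> T * ?A l" by (intro mult_right_mono) auto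
    moreover have "0 \<le> ?d (nat \<bar>l\<bar>) ^ Suc b / T ^ b * ?\<mu>\<^sup>2" using T by simp
    ultimately show ?thesis unfolding d by linarith
  next
    case False
    have "1 \<le> (?d (nat \<bar>l\<bar>) / T) ^ b" using False T by (intro one_le_power) simp
    then have "?d (nat \<bar>l\<bar>) * 1 \<le> ?d (nat \<bar>l\<bar>) * (?d (nat \<bar>l\<bar>) / T) ^ b" by (intro mult_left_mono) auto
    then have "?d (nat \<bar>l\<bar>) \<le> ?d (nat \<bar>l\<bar>) ^ Suc b / T ^ b" by (simp add: power_divide)
    then have "?d (nat \<bar>l\<bar>) * ?A l \<le> ?d (nat \<bar>l\<bar>) ^ Suc b / T ^ b * ?\<mu>\<^sup>2"
      using A T by (intro mult_mono) auto
    moreover have "0 \<le> T * ?A l" using T by simp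
    ultimately show ?thesis unfolding d by linarith
  qed
  have "(\<Sum>l\<in>?L. real (int_divisors_upto X l) * ?A l)
      \<le> real X * ?A 0 + (\<Sum>l\<in>?L - {0}. real (int_divisors_upto X l) * ?A l)"
  proof (cases "0 \<in> ?L")
    case True
    then show ?thesis by (subst sum.remove[OF _ True]) (auto simp: d0)
  next
    case False
    then show ?thesis by simp
  qed
  also have "\<dots> \<le> real X * ?\<mu>\<^sup>2 + (\<Sum>l\<in>?L - {0}. T * ?A l + ?d (nat \<bar>l\<bar>) ^ Suc b / T ^ b * ?\<mu>\<^sup>2)"
    by (intro add_mono mult_left_mono A sum_mono key) auto
  also have "\<dots> = real X * ?\<mu>\<^sup>2 + (T * (\<Sum>l\<in>?L - {0}. ?A l) + (\<Sum>l\<in>?L - {0}. ?d (nat \<bar>l\<bar>) ^ Suc b) / T ^ b * ?\<mu>\<^sup>2)"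
    by (simp only: sum.distrib sum_distrib_left sum_distrib_right sum_divide_distrib)
  also have "\<dots> \<le> real X * ?\<mu>\<^sup>2 + (T * ?\<mu> + (2 * (\<Sum>n\<in>{1..L}. ?d n ^ Suc b)) / T ^ b * ?\<mu>\<^sup>2)"
    using T by (intro add_left_mono add_mono mult_left_mono mult_right_mono divide_right_mono bessel_indicator[OF E] sum_nonzero_int_le) auto
  finally show ?thesis by simp
qed

section \<open>Level sets and the final estimates\<close>

lemma weyl_sum_eq_trig_sum: "weyl_sum N \<phi> = trig_sum (window N) (\<lambda>_. 1) (poly \<phi>)"
  by (simp add: fun_eq_iff weyl_sum_def trig_sum_def)

lemma integral_indicator_square_le:
  assumes E [measurable]: "E \<in> sets circle"
  shows "integrable torus2 (\<lambda>z. indicator E (fst z) * indicator E (snd z) :: real)"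
    and "(\<integral>z. indicator E (fst z) * indicator E (snd z) \<partial>torus2) \<le> (measure circle E)\<^sup>2"
proof -
  have mE: "(indicator E :: real \<Rightarrow> complex) \<in> borel_measurable circle" by measurable
  have bE: "cmod (indicator E x) \<le> 1" for x by (simp add: indicator_def)
  have eq: "indicator E (fst z) * cnj (indicator E (snd z)) * e_char ((fst z - snd z) * of_int 0)
      = complex_of_real (indicator E (fst z) * indicator E (snd z))" for z
    by (simp add: indicator_def)
  show "integrable torus2 (\<lambda>z. indicator E (fst z) * indicator E (snd z) :: real)"
    using integrable_Re[OF fourier_coeff_torus2(1)[OF mE bE, of 0]] unfolding eq by (simp only: Re_complex_of_real)
  have "complex_of_real (\<integral>z. indicator E (fst z) * indicator E (snd z) \<partial>torus2)
      = complex_of_real ((cmod (fourier_coeff (indicator E) 0))\<^sup>2)"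
    unfolding fourier_coeff_torus2(2)[OF mE bE, of 0, symmetric] eq by (rule integral_complex_of_real[symmetric])
  then have "(\<integral>z. indicator E (fst z) * indicator E (snd z) \<partial>torus2) = (cmod (fourier_coeff (indicator E) 0))\<^sup>2"
    by (simp only: of_real_eq_iff)
  also have "\<dots> \<le> (measure circle E)\<^sup>2"
    using fourier_coeff_indicator_le[OF E] by (intro power_mono) auto
  finally show "(\<integral>z. indicator E (fst z) * indicator E (snd z) \<partial>torus2) \<le> (measure circle E)\<^sup>2" .
qed

text \<open>
Where the Weyl sum exceeds \<open>k0\<close>, its major arc bound \<open>k0 * (X0 / Y) powr \<kappa>\<close> forces \<open>Y \<le> X0\<close>, so the exponent \<open>\<kappa>\<close> may
be raised to \<open>\<rho> > 1\<close>.  This makes the majorant summable at the price of the factor \<open>X0 powr \<rho>\<close>.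
\<close>

lemma weyl_sum_majorant:
  fixes \<phi> :: "int poly"
  assumes dich: "cmod (weyl_sum N \<phi> t) \<le> C * real N powr (31 / 32) \<or>
      (\<exists>a q. q \<ge> 1 \<and> cmod (weyl_sum N \<phi> t) \<le> C * real N * (real q * (1 + real N ^ 3 * \<bar>t - of_int a / real q\<bar>)) powr (- \<kappa>))"
    and N: "N \<ge> 1" and C: "C \<ge> 1" and \<kappa>: "0 < \<kappa>" "\<kappa> \<le> \<rho>" and k0: "k0 > 0"
    and small: "C * real N powr (31 / 32) \<le> k0"
    and X0: "X0 = (C * real N / k0) powr (1 / \<kappa>)" "12 * X0 \<le> real N ^ 3"
  shows "cmod (weyl_sum N \<phi> t) \<le> k0 + k0 * X0 powr \<rho> * arc_majorant N \<rho> (nat \<lfloor>X0\<rfloor>) t"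
proof (cases "cmod (weyl_sum N \<phi> t) \<le> k0")
  case True
  moreover have "0 \<le> k0 * X0 powr \<rho> * arc_majorant N \<rho> (nat \<lfloor>X0\<rfloor>) t"
    using k0 arc_majorant_nonneg by (intro mult_nonneg_nonneg) auto
  ultimately show ?thesis by linarith
next
  case False
  then obtain a q where q: "q \<ge> 1" and K: "cmod (weyl_sum N \<phi> t) \<le> C * real N * (real q * (1 + real N ^ 3 * \<bar>t - of_int a / real q\<bar>)) powr (- \<kappa>)"
    using dich small by auto
  define Y where "Y = real q * (1 + real N ^ 3 * \<bar>t - of_int a / real q\<bar>)"
  have Y: "Y \<ge> 1" using q mult_mono[of 1 "real q" 1 "1 + real N ^ 3 * \<bar>t - of_int a / real q\<bar>"] by (simp add: Y_def)
  define B where "B = C * real N / k0"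
  have B: "B > 0" using C N k0 by (simp add: B_def)
  have X0pos: "X0 > 0" and X0\<kappa>: "X0 powr \<kappa> = B"
    using B \<kappa> by (simp_all add: X0(1) B_def[symmetric] powr_powr)
  have CN: "C * real N = k0 * B" using k0 by (simp add: B_def)
  have K': "cmod (weyl_sum N \<phi> t) \<le> k0 * (B * Y powr (- \<kappa>))"
    using K unfolding Y_def[symmetric] CN by (simp add: mult.assoc)
  then have "k0 * 1 < k0 * (B * Y powr (- \<kappa>))" using False by linarith
  then have "1 < B * Y powr (- \<kappa>)" using k0 by (simp only: mult_less_cancel_left_pos)
  then have "Y powr \<kappa> < B" using Y by (simp add: powr_minus field_simps)
  then have "(Y powr \<kappa>) powr (1 / \<kappa>) < B powr (1 / \<kappa>)" using \<kappa> by (intro powr_less_mono2) auto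
  then have YX: "Y \<le> X0" using \<kappa> Y by (simp add: powr_powr X0(1) B_def)
  have "B * Y powr (- \<kappa>) = (X0 / Y) powr \<kappa>"
    using X0pos Y by (simp add: X0\<kappa>[symmetric] powr_divide powr_minus_divide)
  also have "\<dots> \<le> (X0 / Y) powr \<rho>"
    using YX Y \<kappa> by (intro powr_mono) auto
  also have "\<dots> = X0 powr \<rho> * Y powr (- \<rho>)"
    using X0pos Y by (simp add: powr_divide powr_minus_divide)
  also have "\<dots> \<le> X0 powr \<rho> * arc_majorant N \<rho> (nat \<lfloor>X0\<rfloor>) t"
    using YX \<kappa> unfolding Y_def by (intro mult_left_mono arc_majorant_ge[OF N q _ X0(2)]) auto
  finally have "k0 * (B * Y powr (- \<kappa>)) \<le> k0 * (X0 powr \<rho> * arc_majorant N \<rho> (nat \<lfloor>X0\<rfloor>) t)"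
    using k0 by (intro mult_left_mono) auto
  then have "cmod (weyl_sum N \<phi> t) \<le> k0 * X0 powr \<rho> * arc_majorant N \<rho> (nat \<lfloor>X0\<rfloor>) t"
    using K' by (simp add: mult.assoc)
  then show ?thesis using k0 by linarith
qed

text \<open>
With \<open>k0 = N / (2 * D\<^sup>2)\<close> the part of the kernel below \<open>k0\<close> accounts for half of the left side
of the duality inequality and can be absorbed.
\<close>

lemma level_set_quadratic_bound:
  fixes \<phi> :: "int poly"
  assumes major: "\<And>t. cmod (weyl_sum N \<phi> t) \<le> k0 + k0 * W * arc_majorant N \<rho> X t"
    and N: "N \<ge> 1" and \<rho>: "\<rho> > 1" and k0: "k0 = real N / (2 * D\<^sup>2)" and D: "D > 0" and W: "W \<ge> 0"
    and T: "T > 0" and m: "mass N a > 0"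
  defines "E \<equiv> {x \<in> {0..<1}. sqrt (mass N a) * sqrt (real N) / D < cmod (extension_op N \<phi> a x)}"
  shows "(measure circle E)\<^sup>2 \<le> W * (96 / (1 - 2 powr (1 - \<rho>)) / real N ^ 3) *
     (real X * (measure circle E)\<^sup>2 + T * measure circle E
      + 2 / T ^ b * (\<Sum>n\<in>{1..N ^ 3}. real (card (divisors_upto X n)) ^ Suc b) * (measure circle E)\<^sup>2)"
proof -
  let ?\<mu> = "measure circle E"
  let ?\<Lambda> = "sqrt (mass N a) * sqrt (real N) / D"
  let ?e = "\<lambda>z. indicator E (fst z) * indicator E (snd z) :: real"
  let ?G = "\<lambda>z. arc_majorant N \<rho> X (fst z - snd z)"
  let ?K = "\<lambda>z. cmod (weyl_sum N \<phi> (fst z - snd z))"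
  have k0pos: "k0 > 0" using N D by (simp add: k0)
  have \<Lambda>: "?\<Lambda> \<ge> 0" using D m by simp
  have Edef: "E = {x \<in> {0..<1}. ?\<Lambda> < cmod (trig_sum (window N) a (poly \<phi>) x)}"
    unfolding E_def extension_op_eq_trig_sum ..
  have fw: "finite (window N)" by simp
  have E [measurable]: "E \<in> sets circle"
    unfolding Edef by (rule level_set_duality(1)[OF fw \<Lambda>])
  have "?\<Lambda>\<^sup>2 * ?\<mu>\<^sup>2 \<le> mass N a * (\<integral>z. ?e z * ?K z \<partial>torus2)"
    using level_set_duality(2)[OF fw \<Lambda>, of a "poly \<phi>"] unfolding mass_def[symmetric] Edef[symmetric] weyl_sum_eq_trig_sum .
  moreover have "?\<Lambda>\<^sup>2 = mass N a * (2 * k0)"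
    using m D by (simp add: k0 power_divide power_mult_distrib)
  ultimately have "mass N a * (2 * k0 * ?\<mu>\<^sup>2) \<le> mass N a * (\<integral>z. ?e z * ?K z \<partial>torus2)" by (simp add: mult.assoc)
  then have 1: "2 * k0 * ?\<mu>\<^sup>2 \<le> (\<integral>z. ?e z * ?K z \<partial>torus2)" using m by simp
  have iG: "integrable torus2 (\<lambda>z. ?e z * ?G z)" by (rule integral_arc_majorant(1)[OF E N \<rho>])
  have ie: "integrable torus2 ?e" by (rule integral_indicator_square_le(1)[OF E])
  have "(\<integral>z. ?e z * ?K z \<partial>torus2) \<le> (\<integral>z. k0 * ?e z + k0 * W * (?e z * ?G z) \<partial>torus2)"
  proof (rule integral_mono')
    show "integrable torus2 (\<lambda>z. k0 * ?e z + k0 * W * (?e z * ?G z))"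
      by (intro Bochner_Integration.integrable_add integrable_mult_right ie iG)
    fix z
    have "?e z * ?K z \<le> ?e z * (k0 + k0 * W * ?G z)" by (intro mult_left_mono major) auto
    then show "?e z * ?K z \<le> k0 * ?e z + k0 * W * (?e z * ?G z)" by (simp add: algebra_simps)
    show "0 \<le> k0 * ?e z + k0 * W * (?e z * ?G z)"
      using k0pos W arc_majorant_nonneg by (intro add_nonneg_nonneg mult_nonneg_nonneg) auto
  qed
  also have "\<dots> = k0 * (\<integral>z. ?e z \<partial>torus2) + k0 * W * (\<integral>z. ?e z * ?G z \<partial>torus2)"
    using Bochner_Integration.integral_add[OF integrable_mult_right[OF ie, of k0] integrable_mult_right[OF iG, of "k0 * W"]]
    by (simp only: integral_mult_right_zero)
  also have "\<dots> \<le> k0 * ?\<mu>\<^sup>2 + k0 * W * (\<integral>z. ?e z * ?G z \<partial>torus2)"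
    using k0pos by (intro add_right_mono mult_left_mono integral_indicator_square_le(2)[OF E]) auto
  finally have "k0 * ?\<mu>\<^sup>2 \<le> k0 * (W * (\<integral>z. ?e z * ?G z \<partial>torus2))" using 1 by (simp add: mult.assoc)
  then have "?\<mu>\<^sup>2 \<le> W * (\<integral>z. ?e z * ?G z \<partial>torus2)" using k0pos by simp
  also have "\<dots> \<le> W * (96 / (1 - 2 powr (1 - \<rho>)) / real N ^ 3 *
        (\<Sum>l\<in>{- int (N ^ 3)<..<int (N ^ 3)}. real (int_divisors_upto X l) * (cmod (fourier_coeff (indicator E) l))\<^sup>2))"
    by (intro mult_left_mono integral_arc_majorant(2)[OF E N \<rho>] W)
  also have "\<dots> \<le> W * (96 / (1 - 2 powr (1 - \<rho>)) / real N ^ 3 *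
     (real X * ?\<mu>\<^sup>2 + T * ?\<mu> + 2 / T ^ b * (\<Sum>n\<in>{1..N ^ 3}. real (card (divisors_upto X n)) ^ Suc b) * ?\<mu>\<^sup>2))"
  proof (intro mult_left_mono divisor_weighted_sum_le[OF E T] W)
    have "2 powr (1 - \<rho>) < 2 powr 0" using \<rho> by (intro powr_less_mono) auto
    then show "0 \<le> 96 / (1 - 2 powr (1 - \<rho>)) / real N ^ 3" by simp
  qed
  finally show ?thesis by (simp only: mult.assoc)
qed

lemma quadratic_bound_solve:
  fixes \<mu> u v w :: real
  assumes "\<mu>\<^sup>2 \<le> u * \<mu>\<^sup>2 + v * \<mu> + w * \<mu>\<^sup>2" "u \<le> 1 / 4" "w \<le> 1 / 4" "v \<ge> 0" "\<mu> \<ge> 0"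
  shows "\<mu> \<le> 2 * v"
proof (cases "\<mu> = 0")
  case False
  have "u * \<mu>\<^sup>2 \<le> 1 / 4 * \<mu>\<^sup>2" "w * \<mu>\<^sup>2 \<le> 1 / 4 * \<mu>\<^sup>2"
    by (rule mult_right_mono[OF assms(2)], simp) (rule mult_right_mono[OF assms(3)], simp)
  then have "\<mu>\<^sup>2 \<le> 2 * v * \<mu>" using assms(1) by linarith
  then have "\<mu> * \<mu> \<le> (2 * v) * \<mu>" by (simp add: power2_eq_square)
  then show ?thesis using False assms by (simp add: mult_le_cancel_right)
qed (use assms in simp)

text \<open>
With \<open>X0 = (2 * C * D\<^sup>2) powr (1 / \<kappa>)\<close> and \<open>T ^ b\<close> proportional to \<open>X0 powr (\<rho> + 1)\<close>, the quadratic inequality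
gives \<open>\<mu>\<close> of order \<open>X0 powr \<rho> * T / N ^ 3\<close>, which is a power of \<open>D\<close> with exponent \<open>2 / \<kappa> * (\<rho> + (\<rho> + 1) / b)\<close>.  This
tends to 8 as \<open>\<kappa>\<close> tends to \<open>1/4\<close>, \<open>\<rho>\<close> to 1 and \<open>b\<close> to infinity.  The bound \<open>c * N powr \<sigma>\<close> on \<open>D\<close> keeps \<open>X0\<close> small
compared with \<open>N\<close>, as needed for the minor arcs, for the frequency 0 and for the scales of the majorant.
\<close>

lemma level_set_bound:
  fixes \<phi> :: "int poly" and p' :: real
  assumes deg: "degree \<phi> = 3" and p': "p' > 8"
  obtains C c \<sigma> where "C > 0" "c > 0" "\<sigma> > 0"
    "\<And>N a D. N \<ge> 1 \<Longrightarrow> D \<ge> 1 \<Longrightarrow> D \<le> c * real N powr \<sigma> \<Longrightarrow> mass N a > 0 \<Longrightarrow>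
       measure circle {x \<in> {0..<1}. sqrt (mass N a) * sqrt (real N) / D < cmod (extension_op N \<phi> a x)} \<le> C * D powr p' / real N ^ 3"
proof -
  \<comment> \<open>chosen so that \<open>8 * (1 + \<eta>) * (1 + 2 * \<eta>)\<close> is at most \<open>p'\<close>\<close>
  define \<eta> where "\<eta> = min 1 ((p' - 8) / 40)"
  have \<eta>: "0 < \<eta>" "\<eta> \<le> 1" "40 * \<eta> \<le> p' - 8" using p' by (auto simp: \<eta>_def min_def)
  define \<kappa> where "\<kappa> = 1 / (4 * (1 + \<eta>))"
  define \<rho> where "\<rho> = 1 + \<eta>"
  define b where "b = nat \<lceil>3 / \<eta>\<rceil>"
  define s where "s = \<rho> + (\<rho> + 1) / real b"
  have \<kappa>: "0 < \<kappa>" "\<kappa> < 1 / 4" using \<eta> by (auto simp: \<kappa>_def field_simps)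
  have \<rho>: "\<rho> > 1" "\<rho> \<le> 2" using \<eta> by (auto simp: \<rho>_def)
  have b: "real b \<ge> 3 / \<eta>" unfolding b_def by linarith
  then have b0: "b > 0" using \<eta> by (metis divide_pos_pos gr0I not_less of_nat_0 zero_less_numeral)
  have s: "2 * s / \<kappa> \<le> p'"
  proof -
    have "3 \<le> \<eta> * real b" using b \<eta> by (simp add: field_simps)
    then have "(\<rho> + 1) / real b \<le> \<eta>" using b0 \<rho> by (simp add: field_simps)
    then have "s \<le> 1 + 2 * \<eta>" by (simp add: s_def \<rho>_def)
    then have "8 * (1 + \<eta>) * s \<le> 8 * (1 + \<eta>) * (1 + 2 * \<eta>)" using \<eta> by (intro mult_left_mono) auto
    also have "\<dots> = 8 + 24 * \<eta> + 16 * (\<eta> * \<eta>)" by (simp add: algebra_simps)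
    also have "\<eta> * \<eta> \<le> \<eta> * 1" using \<eta> by (intro mult_left_mono) auto
    finally have "8 * (1 + \<eta>) * s \<le> p'" using \<eta> by simp
    moreover have "2 * s / \<kappa> = 8 * (1 + \<eta>) * s" using \<eta> by (simp add: \<kappa>_def)
    ultimately show ?thesis by simp
  qed
  obtain C where C: "C \<ge> 1"
    "\<And>N x. N \<ge> 1 \<Longrightarrow> cmod (weyl_sum N \<phi> x) \<le> C * real N powr (31 / 32) \<or>
      (\<exists>a q. q \<ge> 1 \<and> cmod (weyl_sum N \<phi> x) \<le> C * real N * (real q * (1 + real N ^ 3 * \<bar>x - of_int a / real q\<bar>)) powr (- \<kappa>))"
    using weyl_sum_dichotomy[OF deg \<kappa>] by metis
  obtain Cb where Cb: "Cb > 0" "\<And>X L g. X \<ge> 1 \<Longrightarrow> g \<ge> 1 \<Longrightarrow>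
     (\<Sum>l\<in>{l\<in>{1..L}. g dvd l}. real (card (divisors_upto X l)) ^ Suc b)
     \<le> Cb * real L * (real X powr 1) * (real g powr 1) / real g"
    using divisors_upto_moment[of 1 "Suc b"] by auto
  define c1 where "c1 = 96 / (1 - 2 powr (1 - \<rho>))"
  have c1: "c1 \<ge> 1"
  proof -
    have "2 powr (1 - \<rho>) < 2 powr 0" using \<rho> by (intro powr_less_mono) auto
    then show ?thesis unfolding c1_def by (simp add: le_divide_eq) (smt (verit) powr_ge_zero)
  qed
  define K1 where "K1 = 12 + 4 * c1"
  have K1: "K1 \<ge> 1" using c1 by (simp add: K1_def)
  \<comment> \<open>\<open>D \<le> c * N powr (\<kappa> / 64)\<close> is equivalent to \<open>K1 * X0 \<le> N powr (1 / 32)\<close>, and \<open>1/32\<close> is the saving on the minor arcs\<close>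
  define c where "c = sqrt (K1 powr (- \<kappa>) / (2 * C))"
  define C1 where "C1 = 2 * c1 * (8 * c1 * Cb) powr (1 / real b) * (2 * C) powr (s / \<kappa>)"
  show thesis
  proof (rule that[of C1 c "\<kappa> / 64"])
    show "C1 > 0" using c1 Cb C by (simp add: C1_def)
    show "c > 0" using K1 C by (simp add: c_def)
    show "\<kappa> / 64 > 0" using \<kappa> by simp
    fix N :: nat and a :: "int \<Rightarrow> complex" and D :: real
    assume N: "N \<ge> 1" and D: "D \<ge> 1" and Dle: "D \<le> c * real N powr (\<kappa> / 64)" and m: "mass N a > 0"
    define E where "E = {x \<in> {0..<1}. sqrt (mass N a) * sqrt (real N) / D < cmod (extension_op N \<phi> a x)}"
    let ?\<mu> = "measure circle E"
    have N1: "real N \<ge> 1" using N by simp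
    define n0 where "n0 = real N powr (1 / 32)"
    have n0: "n0 \<ge> 1" "n0 \<le> real N"
    proof -
      show "n0 \<ge> 1" unfolding n0_def using N1 by (intro ge_one_powr_ge_zero) auto
      have "n0 \<le> real N powr 1" unfolding n0_def using N1 by (intro powr_mono) auto
      then show "n0 \<le> real N" using N1 by simp
    qed
    define B where "B = 2 * C * D\<^sup>2"
    have B: "B \<ge> 1"
    proof -
      have "1 * 1 \<le> (2 * C) * D\<^sup>2" using C D by (intro mult_mono) auto
      then show ?thesis by (simp add: B_def)
    qed
    define X0 where "X0 = B powr (1 / \<kappa>)"
    have X0B: "B \<le> X0"
    proof -
      have "B powr 1 \<le> B powr (1 / \<kappa>)" using B \<kappa> by (intro powr_mono) auto
      then show ?thesis using B by (simp add: X0_def)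
    qed
    have X01: "X0 \<ge> 1" using X0B B by linarith
    have KX: "K1 * X0 \<le> n0"
    proof -
      have "D\<^sup>2 \<le> (c * real N powr (\<kappa> / 64))\<^sup>2" using Dle D by (intro power_mono) auto
      also have "\<dots> = c\<^sup>2 * real N powr (\<kappa> / 32)"
        by (simp add: power_mult_distrib power2_eq_square[of "_ powr _"] flip: powr_add)
      also have "c\<^sup>2 = K1 powr (- \<kappa>) / (2 * C)" using C by (simp add: c_def)
      finally have "B \<le> 2 * C * (K1 powr (- \<kappa>) / (2 * C) * real N powr (\<kappa> / 32))"
        unfolding B_def using C by (intro mult_left_mono) auto
      also have "\<dots> = K1 powr (- \<kappa>) * n0 powr \<kappa>"
        using C by (simp add: n0_def powr_powr mult.commute)
      also have "\<dots> = (n0 / K1) powr \<kappa>"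
        using n0 K1 by (simp add: powr_divide powr_minus_divide)
      finally have "X0 \<le> ((n0 / K1) powr \<kappa>) powr (1 / \<kappa>)"
        unfolding X0_def using B \<kappa> by (intro powr_mono2) auto
      also have "\<dots> = n0 / K1" using \<kappa> n0 K1 by (simp add: powr_powr)
      finally show ?thesis using K1 by (simp add: field_simps)
    qed
    have X0n: "X0 \<le> n0" using KX K1 X01 mult_right_mono[of 1 K1 X0] by linarith
    have NN3: "real N \<le> real N ^ 3" using N1 by (intro self_le_power) auto
    have X12: "12 * X0 \<le> real N ^ 3"
    proof -
      have "12 * X0 \<le> K1 * X0" using c1 X01 by (intro mult_right_mono) (auto simp: K1_def)
      then show ?thesis using KX n0 NN3 by linarith
    qed
    have cX: "c1 * (X0 powr \<rho> * X0) \<le> real N ^ 3 / 4"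
    proof -
      have "X0 powr \<rho> \<le> X0 powr 2" using X01 \<rho> by (intro powr_mono) auto
      also have "\<dots> = X0\<^sup>2" using X01 by simp
      finally have "4 * c1 * (X0 powr \<rho> * X0) \<le> 4 * c1 * (X0\<^sup>2 * X0)"
        using c1 X01 by (intro mult_left_mono mult_right_mono) auto
      also have "\<dots> \<le> K1 ^ 3 * (X0\<^sup>2 * X0)"
      proof (rule mult_right_mono)
        have "K1 \<le> K1 ^ 3" using K1 by (intro self_le_power) auto
        then show "4 * c1 \<le> K1 ^ 3" by (simp add: K1_def)
      qed (use X01 in auto)
      also have "\<dots> = (K1 * X0) ^ 3" by (simp add: power_mult_distrib power2_eq_square power3_eq_cube)
      also have "\<dots> \<le> real N ^ 3" using KX n0 K1 X01 by (intro power_mono) auto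
      finally show ?thesis by simp
    qed
    define k0 where "k0 = real N / (2 * D\<^sup>2)"
    have k0: "k0 > 0" using N D by (simp add: k0_def)
    have Bk0: "C * real N / k0 = B" using N D by (simp add: k0_def B_def)
    have small: "C * real N powr (31 / 32) \<le> k0"
    proof -
      have "B * real N powr (31 / 32) \<le> n0 * real N powr (31 / 32)"
        using X0B X0n by (intro mult_right_mono) auto
      also have "\<dots> = real N" unfolding n0_def using N1 by (simp flip: powr_add)
      finally have "C * real N powr (31 / 32) * (2 * D\<^sup>2) \<le> real N" by (simp add: B_def mult_ac)
      then show ?thesis using D by (simp add: k0_def le_divide_eq)
    qed
    define X where "X = nat \<lfloor>X0\<rfloor>"
    have X: "X \<ge> 1" "real X \<le> X0" using X01 by (auto simp: X_def le_nat_iff le_floor_iff)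
    have major: "cmod (weyl_sum N \<phi> t) \<le> k0 + k0 * X0 powr \<rho> * arc_majorant N \<rho> X t" for t
      unfolding X_def using \<kappa> \<rho>
      by (intro weyl_sum_majorant[OF C(2)[OF N] N C(1) \<kappa>(1) _ k0 small _ X12]) (auto simp: Bk0 X0_def)
    \<comment> \<open>chosen so that the term with the divisor moment is exactly \<open>\<mu>\<^sup>2 / 4\<close> after inserting the moment bound\<close>
    define T where "T = (8 * c1 * Cb * (X0 powr \<rho> * X0)) powr (1 / real b)"
    have Tpos: "T > 0" using c1 Cb X01 by (simp add: T_def)
    have Tb: "T ^ b = 8 * c1 * Cb * (X0 powr \<rho> * X0)"
    proof -
      have "T ^ b = T powr real b" using Tpos by (simp add: powr_realpow)
      also have "\<dots> = 8 * c1 * Cb * (X0 powr \<rho> * X0)"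
        using b0 c1 Cb X01 by (simp add: T_def powr_powr)
      finally show ?thesis .
    qed
    let ?M = "\<Sum>n\<in>{1..N ^ 3}. real (card (divisors_upto X n)) ^ Suc b"
    have M: "?M \<le> Cb * real N ^ 3 * X0"
    proof -
      have "{l \<in> {1..N ^ 3}. 1 dvd l} = {1..N ^ 3}" by auto
      then have "?M \<le> Cb * real (N ^ 3) * real X"
        using Cb(2)[OF X(1), of 1 "N ^ 3"] X by simp
      also have "\<dots> \<le> Cb * real N ^ 3 * X0" using X Cb by (simp add: mult_left_mono)
      finally show ?thesis .
    qed
    define u where "u = X0 powr \<rho> * (c1 / real N ^ 3)"
    have u: "u \<ge> 0" using c1 by (simp add: u_def)
    have "?\<mu>\<^sup>2 \<le> u * (real X * ?\<mu>\<^sup>2 + T * ?\<mu> + 2 / T ^ b * ?M * ?\<mu>\<^sup>2)"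
      unfolding u_def c1_def E_def
      by (rule level_set_quadratic_bound[OF major N \<rho>(1) k0_def _ _ Tpos m]) (use D in auto)
    then have quad: "?\<mu>\<^sup>2 \<le> (u * real X) * ?\<mu>\<^sup>2 + (u * T) * ?\<mu> + (u * (2 / T ^ b * ?M)) * ?\<mu>\<^sup>2"
      by (simp add: algebra_simps)
    have "?\<mu> \<le> 2 * (u * T)"
    proof (rule quadratic_bound_solve[OF quad])
      have "u * real X \<le> u * X0" using u X by (intro mult_left_mono) auto
      also have "\<dots> = c1 * (X0 powr \<rho> * X0) / real N ^ 3" by (simp add: u_def)
      also have "\<dots> \<le> (real N ^ 3 / 4) / real N ^ 3" using cX by (intro divide_right_mono) auto
      also have "\<dots> = 1 / 4" using N by simp
      finally show "u * real X \<le> 1 / 4" .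
      have "u * (2 / T ^ b * ?M) \<le> u * (2 / T ^ b * (Cb * real N ^ 3 * X0))"
        using u Tpos M by (intro mult_left_mono) auto
      also have "\<dots> = 1 / 4"
        unfolding Tb u_def using N c1 Cb X01 by (simp add: field_simps)
      finally show "u * (2 / T ^ b * ?M) \<le> 1 / 4" .
    qed (use u Tpos in auto)
    also have "2 * (u * T) \<le> C1 * D powr p' / real N ^ 3"
    proof -
      have "T = (8 * c1 * Cb) powr (1 / real b) * X0 powr ((\<rho> + 1) / real b)"
      proof -
        have "X0 powr \<rho> * X0 = X0 powr (\<rho> + 1)" using X01 by (simp add: powr_add)
        then show ?thesis unfolding T_def using c1 Cb X01 by (simp add: powr_mult powr_powr)
      qed
      then have "X0 powr \<rho> * T = (8 * c1 * Cb) powr (1 / real b) * X0 powr s"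
        by (simp add: s_def powr_add)
      moreover have "X0 powr s = (2 * C) powr (s / \<kappa>) * D powr (2 * s / \<kappa>)"
      proof -
        have "X0 powr s = B powr (s / \<kappa>)" by (simp add: X0_def powr_powr)
        also have "\<dots> = (2 * C) powr (s / \<kappa>) * (D\<^sup>2) powr (s / \<kappa>)"
          unfolding B_def by (rule powr_mult)
        also have "(D\<^sup>2) powr (s / \<kappa>) = D powr (2 * s / \<kappa>)"
          using D by (simp add: powr_powr flip: powr_numeral)
        finally show ?thesis .
      qed
      ultimately have "2 * (u * T) = C1 * D powr (2 * s / \<kappa>) / real N ^ 3"
        by (simp add: u_def C1_def)
      also have "\<dots> \<le> C1 * D powr p' / real N ^ 3"
        using s D \<open>C1 > 0\<close> by (intro divide_right_mono mult_left_mono powr_mono) auto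
      finally show ?thesis .
    qed
    finally show "measure circle {x \<in> {0..<1}. sqrt (mass N a) * sqrt (real N) / D < cmod (extension_op N \<phi> a x)} \<le> C1 * D powr p' / real N ^ 3"
      unfolding E_def .
  qed
qed

lemma cmod_extension_op_le: "cmod (extension_op N \<phi> a x) \<le> 2 * (sqrt (mass N a) * sqrt (real N))" if "N \<ge> 1"
proof -
  have "(cmod (extension_op N \<phi> a x))\<^sup>2 \<le> real (card (window N)) * (\<Sum>n\<in>window N. (cmod (a n * e_char (x * of_int (poly \<phi> n))))\<^sup>2)"
    unfolding extension_op_def by (rule norm_sum_square_le)
  also have "\<dots> = real (2 * N + 1) * mass N a"
    by (simp add: norm_mult mass_def nat_add_distrib)
  also have "\<dots> \<le> (4 * real N) * mass N a"
    using that mass_nonneg by (intro mult_right_mono) auto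
  also have "\<dots> = (2 * (sqrt (mass N a) * sqrt (real N)))\<^sup>2"
    using mass_nonneg by (simp add: power_mult_distrib)
  finally show ?thesis by (rule power2_le_imp_le) (simp add: mass_nonneg)
qed

text \<open>
Values of \<open>f\<close> above \<open>Y\<close> are sorted into dyadic levels, where the level set bound with \<open>p' < p\<close> gives a
geometric series with ratio \<open>r\<close>.  Below \<open>Y\<close> the eighth moment is used with \<open>\<epsilon> = \<sigma> * (p - 8)\<close>, which is
exactly what the factor \<open>Y powr (p - 8)\<close> saves.
\<close>

lemma Lp_estimate_cubic:
  fixes \<phi> :: "int poly" and p :: real
  assumes deg: "degree \<phi> = 3" and p: "p > 8"
  obtains C where "C > 0"
    "\<And>N a. N \<ge> 1 \<Longrightarrow> (\<integral>x. cmod (extension_op N \<phi> a x) powr p \<partial>circle) \<le> C * real N powr (p / 2 - 3) * sqrt (mass N a) powr p"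
proof -
  define p' where "p' = (p + 8) / 2"
  have p': "p' > 8" "p' < p" using p by (auto simp: p'_def)
  obtain C1 c \<sigma> where C1: "C1 > 0" "c > 0" "\<sigma> > 0" and lev:
    "\<And>N a D. N \<ge> 1 \<Longrightarrow> D \<ge> 1 \<Longrightarrow> D \<le> c * real N powr \<sigma> \<Longrightarrow> mass N a > 0 \<Longrightarrow>
       measure circle {x \<in> {0..<1}. sqrt (mass N a) * sqrt (real N) / D < cmod (extension_op N \<phi> a x)} \<le> C1 * D powr p' / real N ^ 3"
    using level_set_bound[OF deg p'(1)] by blast
  have \<epsilon>: "\<sigma> * (p - 8) > 0" using C1 p by simp
  have deg3: "degree \<phi> \<ge> 3" using deg by simp
  obtain C8 where C8: "C8 \<ge> 1"
    "\<And>N a. N \<ge> 1 \<Longrightarrow> (\<integral>x. cmod (extension_op N \<phi> a x) ^ 8 \<partial>circle) \<le> C8 * real N powr (1 + \<sigma> * (p - 8)) * mass N a ^ 4"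
    using L8_estimate[OF deg3 \<epsilon>] by blast
  define r :: real where "r = 2 powr (p' - p)"
  have r: "0 < r" "r < 1"
  proof -
    have "2 powr (p' - p) < 2 powr 0" using p' by (intro powr_less_mono) auto
    then show "0 < r" "r < 1" by (auto simp: r_def)
  qed
  define CC where "CC = (2 / c) powr (p - 8) * C8 + C1 * 2 powr p / (1 - r)"
  show thesis
  proof (rule that[of CC])
    show "CC > 0" unfolding CC_def using C1 C8 r by (intro add_pos_pos mult_pos_pos divide_pos_pos) auto
    fix N :: nat and a :: "int \<Rightarrow> complex" assume N: "N \<ge> 1"
    have N1: "real N \<ge> 1" using N by simp
    define A where "A = sqrt (mass N a)"
    have A0: "A \<ge> 0" by (simp add: A_def mass_nonneg)
    define f where "f x = cmod (extension_op N \<phi> a x)" for x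
    define Q where "Q = A * sqrt (real N)"
    have fQ: "f x \<le> 2 * Q" for x
      unfolding f_def Q_def A_def by (rule cmod_extension_op_le[OF N])
    have f0: "f x \<ge> 0" for x by (simp add: f_def)
    show "(\<integral>x. cmod (extension_op N \<phi> a x) powr p \<partial>circle) \<le> CC * real N powr (p / 2 - 3) * sqrt (mass N a) powr p"
    proof (cases "mass N a = 0")
      case True
      then have "f x = 0" for x using fQ[of x] f0[of x] by (simp add: Q_def A_def)
      then show ?thesis unfolding f_def[symmetric] using True by simp
    next
      case False
      then have m: "mass N a > 0" using mass_nonneg[of N a] by linarith
      then have A: "A > 0" by (simp add: A_def)
      have Q: "Q > 0" using A N by (simp add: Q_def)
      define Y0 where "Y0 = c * real N powr \<sigma>"
      have Y0: "Y0 > 0" using C1 N by (simp add: Y0_def)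
      define Y where "Y = 2 * Q / Y0"
      have Y: "Y > 0" using Q Y0 by (simp add: Y_def)
      define J where "J = {j::nat. 2 ^ j \<le> Y0}"
      have finJ: "finite J"
      proof (rule finite_subset)
        show "J \<subseteq> {..nat \<lfloor>Y0\<rfloor>}"
        proof
          fix j assume "j \<in> J"
          then have "real (2 ^ j) \<le> Y0" by (simp add: J_def)
          moreover have "real j \<le> real (2 ^ j)" using less_exp[of j] by (intro of_nat_mono) simp
          ultimately have "real j \<le> Y0" by linarith
          then show "j \<in> {..nat \<lfloor>Y0\<rfloor>}" by (simp add: le_nat_iff le_floor_iff)
        qed
      qed simp
      define E where "E j = {x \<in> {0..<1}. Q / 2 ^ j < f x}" for j :: nat
      have fw: "finite (window N)" by simp
      have mE: "E j \<in> sets circle" for j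
        unfolding E_def f_def extension_op_eq_trig_sum by (rule level_set_duality(1)[OF fw]) (use Q in simp)
      have mf: "f \<in> borel_measurable circle"
        unfolding f_def extension_op_eq_trig_sum
        by (rule measurable_compose[OF measurable_circleI[OF measurable_trig_sum] borel_measurable_norm])
      have muE: "measure circle (E j) \<le> C1 * (2 ^ j) powr p' / real N ^ 3" if "j \<in> J" for j
        using lev[OF N, of "2 ^ j" a] that m unfolding E_def f_def Q_def A_def J_def Y0_def by simp
      have pw: "f x powr p \<le> Y powr (p - 8) * f x ^ 8 + (\<Sum>j\<in>J. (2 * Q / 2 ^ j) powr p * indicator (E j) x)"
        if x: "x \<in> {0..<1}" for x
      proof (cases "f x \<le> Y")
        case True
        have "f x powr p \<le> Y powr (p - 8) * f x ^ 8"
        proof (cases "f x = 0")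
          case False
          then have "f x powr p = f x powr (p - 8) * f x ^ 8"
            using f0[of x] powr_add[of "f x" "p - 8" 8] by simp
          also have "\<dots> \<le> Y powr (p - 8) * f x ^ 8"
            using True p f0[of x] by (intro mult_right_mono powr_mono2) auto
          finally show ?thesis .
        qed simp
        moreover have "0 \<le> (\<Sum>j\<in>J. (2 * Q / 2 ^ j) powr p * indicator (E j) x)" by (intro sum_nonneg) auto
        ultimately show ?thesis by linarith
      next
        case False
        then have fpos: "f x > 0" using Y by linarith
        define z where "z = 2 * Q / f x"
        have z: "z \<ge> 1" using fQ[of x] fpos by (simp add: z_def)
        have zY: "z \<le> Y0" using False fpos Y0 by (simp add: z_def Y_def field_simps)
        \<comment> \<open>the dyadic level of \<open>f x\<close>; it belongs to \<open>J\<close> because \<open>f x\<close> exceeds \<open>Y\<close>\<close>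
        define j where "j = nat \<lfloor>log 2 z\<rfloor>"
        have lz: "log 2 z \<ge> 0" using z by simp
        have "2 powr real j \<le> 2 powr (log 2 z)" using lz by (intro powr_mono) (auto simp: j_def)
        then have j1: "2 ^ j \<le> z" using z by (simp add: powr_realpow)
        have "2 powr (log 2 z) < 2 powr (real (Suc j))" using lz unfolding j_def by (intro powr_less_mono) linarith+
        then have j2: "z < 2 * 2 ^ j" using z by (simp add: powr_realpow del: of_nat_Suc)
        have jJ: "j \<in> J" using j1 zY by (simp add: J_def)
        have xE: "x \<in> E j" using j2 fpos x by (simp add: E_def z_def field_simps)
        have "f x \<le> 2 * Q / 2 ^ j" using j1 fpos by (simp add: z_def field_simps)
        then have "f x powr p \<le> (2 * Q / 2 ^ j) powr p * indicator (E j) x"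
          using xE f0[of x] p by (auto intro!: powr_mono2)
        also have "\<dots> \<le> (\<Sum>j\<in>J. (2 * Q / 2 ^ j) powr p * indicator (E j) x)"
          using jJ finJ by (intro member_le_sum[where f = "\<lambda>j. (2 * Q / 2 ^ j) powr p * indicator (E j) x"]) auto
        finally show ?thesis using f0[of x] by (simp add: add_increasing)
      qed
      have i8: "integrable circle (\<lambda>x. f x ^ 8)"
        unfolding f_def extension_op_eq_trig_sum by (rule integrable_trig_sum_power)
      have iE: "integrable circle (\<lambda>x. indicator (E j) x :: real)" for j
        by (rule integrable_circle_bounded[where B = 1]) (use mE in \<open>auto simp: indicator_def intro: borel_measurable_indicator\<close>)
      have ip: "integrable circle (\<lambda>x. f x powr p)"
      proof (rule integrable_circle_bounded)
        show "norm (f x powr p) \<le> (2 * Q) powr p" for x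
          using fQ[of x] f0[of x] p by (auto intro!: powr_mono2)
      qed (use mf in measurable)
      have "(\<integral>x. f x powr p \<partial>circle) \<le> (\<integral>x. Y powr (p - 8) * f x ^ 8 + (\<Sum>j\<in>J. (2 * Q / 2 ^ j) powr p * indicator (E j) x) \<partial>circle)"
        by (intro integral_mono ip Bochner_Integration.integrable_add integrable_mult_right Bochner_Integration.integrable_sum i8 iE)
           (use pw in auto)
      also have "\<dots> = Y powr (p - 8) * (\<integral>x. f x ^ 8 \<partial>circle) + (\<Sum>j\<in>J. (2 * Q / 2 ^ j) powr p * measure circle (E j))"
      proof -
        have "(\<integral>x. (\<Sum>j\<in>J. (2 * Q / 2 ^ j) powr p * indicator (E j) x) \<partial>circle)
            = (\<Sum>j\<in>J. \<integral>x. (2 * Q / 2 ^ j) powr p * indicator (E j) x \<partial>circle)"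
          by (rule Bochner_Integration.integral_sum) (intro integrable_mult_right iE)
        also have "\<dots> = (\<Sum>j\<in>J. (2 * Q / 2 ^ j) powr p * measure circle (E j))"
        proof (rule sum.cong)
          fix j
          have "E j \<inter> space circle = E j" by (auto simp: E_def)
          then have "(\<integral>x. indicator (E j) x \<partial>circle) = measure circle (E j)" by simp
          then show "(\<integral>x. (2 * Q / 2 ^ j) powr p * indicator (E j) x \<partial>circle) = (2 * Q / 2 ^ j) powr p * measure circle (E j)"
            by (simp only: integral_mult_right_zero)
        qed simp
        finally have sumE: "(\<integral>x. (\<Sum>j\<in>J. (2 * Q / 2 ^ j) powr p * indicator (E j) x) \<partial>circle)
            = (\<Sum>j\<in>J. (2 * Q / 2 ^ j) powr p * measure circle (E j))" .
        have isum: "integrable circle (\<lambda>x. \<Sum>j\<in>J. (2 * Q / 2 ^ j) powr p * indicator (E j) x)"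
          by (intro integrable_mult_right Bochner_Integration.integrable_sum iE)
        show ?thesis
          unfolding Bochner_Integration.integral_add[OF integrable_mult_right[OF i8] isum] sumE integral_mult_right_zero ..
      qed
      also have "Y powr (p - 8) * (\<integral>x. f x ^ 8 \<partial>circle) \<le> (2 / c) powr (p - 8) * C8 * (real N powr (p / 2 - 3) * A powr p)"
      proof -
        have A8: "mass N a ^ 4 = A powr 8"
        proof -
          have "A powr 8 = A ^ 8" using A by simp
          also have "\<dots> = (A\<^sup>2) ^ 4" by (simp flip: power_mult)
          finally show ?thesis by (simp add: A_def mass_nonneg)
        qed
        have "Y = (2 / c) * A * real N powr (1 / 2 - \<sigma>)"
          unfolding powr_diff Y_def Q_def Y0_def using N by (simp add: powr_half_sqrt)
        then have "Y powr (p - 8) = (2 / c) powr (p - 8) * A powr (p - 8) * real N powr ((1 / 2 - \<sigma>) * (p - 8))"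
          by (simp only: powr_mult powr_powr)
        moreover have "Y powr (p - 8) * (\<integral>x. f x ^ 8 \<partial>circle) \<le> Y powr (p - 8) * (C8 * real N powr (1 + \<sigma> * (p - 8)) * A powr 8)"
          using C8(2)[OF N, of a] unfolding f_def A8 by (intro mult_left_mono) auto
        moreover have "(2 / c) powr (p - 8) * A powr (p - 8) * real N powr ((1 / 2 - \<sigma>) * (p - 8)) * (C8 * real N powr (1 + \<sigma> * (p - 8)) * A powr 8)
           = (2 / c) powr (p - 8) * C8 * ((real N powr ((1 / 2 - \<sigma>) * (p - 8)) * real N powr (1 + \<sigma> * (p - 8))) * (A powr (p - 8) * A powr 8))"
          by (simp only: mult_ac)
        moreover have "real N powr ((1 / 2 - \<sigma>) * (p - 8)) * real N powr (1 + \<sigma> * (p - 8)) = real N powr (p / 2 - 3)"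
          unfolding powr_add[symmetric] by (rule arg_cong[where f = "\<lambda>s. real N powr s"]) (simp add: algebra_simps)
        moreover have "A powr (p - 8) * A powr 8 = A powr p"
          unfolding powr_add[symmetric] by simp
        ultimately show ?thesis by metis
      qed
      also have "(\<Sum>j\<in>J. (2 * Q / 2 ^ j) powr p * measure circle (E j)) \<le> C1 * 2 powr p / (1 - r) * (real N powr (p / 2 - 3) * A powr p)"
      proof -
        have "(\<Sum>j\<in>J. (2 * Q / 2 ^ j) powr p * measure circle (E j)) \<le> (\<Sum>j\<in>J. (2 * Q) powr p * C1 / real N ^ 3 * r ^ j)"
        proof (rule sum_mono)
          fix j assume j: "j \<in> J"
          have "(2 * Q / 2 ^ j) powr p * measure circle (E j) \<le> (2 * Q / 2 ^ j) powr p * (C1 * (2 ^ j) powr p' / real N ^ 3)"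
            by (intro mult_left_mono muE j) auto
          also have "\<dots> = (2 * Q) powr p * C1 / real N ^ 3 * ((2 ^ j) powr p' / (2 ^ j) powr p)"
            by (simp add: powr_divide mult_ac)
          also have "(2 ^ j) powr p' / (2 ^ j) powr p = (2 ^ j :: real) powr (p' - p)" by (simp add: powr_diff)
          also have "\<dots> = r ^ j"
            unfolding r_def by (simp add: powr_powr mult.commute flip: powr_realpow)
          finally show "(2 * Q / 2 ^ j) powr p * measure circle (E j) \<le> (2 * Q) powr p * C1 / real N ^ 3 * r ^ j" .
        qed
        also have "\<dots> = (2 * Q) powr p * C1 / real N ^ 3 * (\<Sum>j\<in>J. r ^ j)" by (simp only: sum_distrib_left)
        also have "\<dots> \<le> (2 * Q) powr p * C1 / real N ^ 3 * (1 / (1 - r))"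
          using r C1 finJ by (intro mult_left_mono sum_geometric_le) auto
        also have "\<dots> = C1 * 2 powr p / (1 - r) * (real N powr (p / 2 - 3) * A powr p)"
        proof -
          have e1: "(2 * Q) powr p = 2 powr p * A powr p * real N powr (p / 2)"
            unfolding Q_def by (simp add: powr_mult powr_half_sqrt[symmetric] powr_powr)
          have e2: "real N powr (p / 2) / real N ^ 3 = real N powr (p / 2 - 3)"
            unfolding powr_diff using N by simp
          have "(2 * Q) powr p * C1 / real N ^ 3 * (1 / (1 - r))
              = C1 * 2 powr p / (1 - r) * ((real N powr (p / 2) / real N ^ 3) * A powr p)"
            unfolding e1 by (simp only: divide_inverse mult_ac mult_1_left)
          then show ?thesis unfolding e2 .
        qed
        finally show ?thesis .
      qed
      finally have "(\<integral>x. f x powr p \<partial>circle) \<le> (2 / c) powr (p - 8) * C8 * (real N powr (p / 2 - 3) * A powr p)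
          + C1 * 2 powr p / (1 - r) * (real N powr (p / 2 - 3) * A powr p)" by simp
      then show ?thesis unfolding f_def A_def CC_def by (simp add: algebra_simps)
    qed
  qed
qed

lemma mass_le_ell2:
  assumes "a \<in> ell2"
  shows "mass N a \<le> (ell2_norm a)\<^sup>2"
proof -
  have s: "(\<lambda>n. (cmod (a n))\<^sup>2) summable_on UNIV" using assms by (simp add: ell2_def)
  have "mass N a \<le> (\<Sum>\<^sub>\<infinity>n. (cmod (a n))\<^sup>2)"
    unfolding mass_def by (rule finite_sum_le_infsum[OF s]) auto
  also have "\<dots> = (ell2_norm a)\<^sup>2"
    unfolding ell2_norm_def by (simp add: infsum_nonneg)
  finally show ?thesis .
qed

lemma ell2_norm_nonneg: "ell2_norm a \<ge> 0"
  by (simp add: ell2_norm_def infsum_nonneg)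

lemma Lp_norm_circle_power:
  assumes "k > 0"
  shows "Lp_norm_circle (real k) f ^ k = (\<integral>x. cmod (f x) ^ k \<partial>circle)"
proof -
  have "(\<integral>x. cmod (f x) powr real k \<partial>circle) = (\<integral>x. cmod (f x) ^ k \<partial>circle)"
    using assms by (intro Bochner_Integration.integral_cong refl) (auto simp: powr_realpow' )
  moreover have "(\<integral>x. cmod (f x) ^ k \<partial>circle) \<ge> 0" by (intro integral_nonneg_AE) auto
  ultimately show ?thesis
    unfolding Lp_norm_circle_eq using assms
    by (cases "(\<integral>x. cmod (f x) ^ k \<partial>circle) = 0") (auto simp: powr_powr simp flip: powr_realpow)
qed

theorem theorem4p1:
  fixes \<phi> :: "int poly"
  assumes "degree \<phi> \<ge> 3"
  shows
    "(\<forall>\<epsilon>::real. \<epsilon> > 0 \<longrightarrow>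
        (\<exists>C::real. C > 0 \<and>
          (\<forall>N::nat. N \<ge> 1 \<longrightarrow> (\<forall>a \<in> ell2.
             (Lp_norm_circle 4 (extension_op N \<phi> a)) ^ 4
               \<le> C * real N powr \<epsilon> * (ell2_norm a) ^ 4
           \<and> (Lp_norm_circle 8 (extension_op N \<phi> a)) ^ 8
               \<le> C * real N powr (1 + \<epsilon>) * (ell2_norm a) ^ 8)))) \<and>
     (degree \<phi> = 3 \<longrightarrow>
        (\<forall>p::real. p > 8 \<longrightarrow>
          (\<exists>C::real. C > 0 \<and>
            (\<forall>N::nat. N \<ge> 1 \<longrightarrow> (\<forall>a \<in> ell2.
               Lp_norm_circle p (extension_op N \<phi> a)
                 \<le> C * real N powr (1 / 2 - 3 / p) * ell2_norm a)))))"
proof (intro conjI allI impI)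
  fix \<epsilon> :: real assume \<epsilon>: "\<epsilon> > 0"
  have d2: "degree \<phi> \<ge> 2" using assms by simp
  obtain C4 where C4: "C4 \<ge> 1"
    "\<And>N a. N \<ge> 1 \<Longrightarrow> (\<integral>x. cmod (extension_op N \<phi> a x) ^ 4 \<partial>circle) \<le> C4 * real N powr \<epsilon> * (mass N a)\<^sup>2"
    using L4_estimate[OF d2 \<epsilon>] by blast
  obtain C8 where C8: "C8 \<ge> 1"
    "\<And>N a. N \<ge> 1 \<Longrightarrow> (\<integral>x. cmod (extension_op N \<phi> a x) ^ 8 \<partial>circle) \<le> C8 * real N powr (1 + \<epsilon>) * mass N a ^ 4"
    using L8_estimate[OF assms \<epsilon>] by blast
  show "\<exists>C::real. C > 0 \<and>
          (\<forall>N::nat. N \<ge> 1 \<longrightarrow> (\<forall>a \<in> ell2.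
             (Lp_norm_circle 4 (extension_op N \<phi> a)) ^ 4
               \<le> C * real N powr \<epsilon> * (ell2_norm a) ^ 4
           \<and> (Lp_norm_circle 8 (extension_op N \<phi> a)) ^ 8
               \<le> C * real N powr (1 + \<epsilon>) * (ell2_norm a) ^ 8))"
  proof (intro exI[of _ "C4 + C8"] conjI allI impI ballI)
    show "C4 + C8 > 0" using C4 C8 by simp
    fix N :: nat and a :: "int \<Rightarrow> complex" assume N: "N \<ge> 1" and a: "a \<in> ell2"
    have m: "0 \<le> mass N a" "mass N a \<le> (ell2_norm a)\<^sup>2" using mass_nonneg mass_le_ell2[OF a] by auto
    have "Lp_norm_circle 4 (extension_op N \<phi> a) ^ 4 \<le> C4 * real N powr \<epsilon> * (mass N a)\<^sup>2"
      using Lp_norm_circle_power[of 4 "extension_op N \<phi> a"] C4(2)[OF N, of a] by simp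
    also have "\<dots> \<le> (C4 + C8) * real N powr \<epsilon> * ((ell2_norm a)\<^sup>2)\<^sup>2"
      using m C4 C8 by (intro mult_mono power_mono) auto
    also have "((ell2_norm a)\<^sup>2)\<^sup>2 = ell2_norm a ^ 4" by (simp flip: power_mult)
    finally show "Lp_norm_circle 4 (extension_op N \<phi> a) ^ 4 \<le> (C4 + C8) * real N powr \<epsilon> * ell2_norm a ^ 4" .
    have "Lp_norm_circle 8 (extension_op N \<phi> a) ^ 8 \<le> C8 * real N powr (1 + \<epsilon>) * mass N a ^ 4"
      using Lp_norm_circle_power[of 8 "extension_op N \<phi> a"] C8(2)[OF N, of a] by simp
    also have "\<dots> \<le> (C4 + C8) * real N powr (1 + \<epsilon>) * ((ell2_norm a)\<^sup>2) ^ 4"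
      using m C4 C8 by (intro mult_mono power_mono) auto
    also have "((ell2_norm a)\<^sup>2) ^ 4 = ell2_norm a ^ 8" by (simp flip: power_mult)
    finally show "Lp_norm_circle 8 (extension_op N \<phi> a) ^ 8 \<le> (C4 + C8) * real N powr (1 + \<epsilon>) * ell2_norm a ^ 8" .
  qed
next
  fix p :: real assume deg: "degree \<phi> = 3" and p: "p > 8"
  obtain C where C: "C > 0"
    "\<And>N a. N \<ge> 1 \<Longrightarrow> (\<integral>x. cmod (extension_op N \<phi> a x) powr p \<partial>circle) \<le> C * real N powr (p / 2 - 3) * sqrt (mass N a) powr p"
    using Lp_estimate_cubic[OF deg p] by blast
  show "\<exists>C::real. C > 0 \<and>
            (\<forall>N::nat. N \<ge> 1 \<longrightarrow> (\<forall>a \<in> ell2.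
               Lp_norm_circle p (extension_op N \<phi> a)
                 \<le> C * real N powr (1 / 2 - 3 / p) * ell2_norm a))"
  proof (intro exI[of _ "C powr (1 / p)"] conjI allI impI ballI)
    show "C powr (1 / p) > 0" using C by simp
    fix N :: nat and a :: "int \<Rightarrow> complex" assume N: "N \<ge> 1" and a: "a \<in> ell2"
    have "Lp_norm_circle p (extension_op N \<phi> a) \<le> (C * real N powr (p / 2 - 3) * sqrt (mass N a) powr p) powr (1 / p)"
      unfolding Lp_norm_circle_eq using C(2)[OF N] p by (intro powr_mono2 integral_nonneg_AE) auto
    also have "\<dots> = C powr (1 / p) * real N powr (1 / 2 - 3 / p) * sqrt (mass N a)"
      using p mass_nonneg[of N a] by (simp add: powr_mult powr_powr diff_divide_distrib)
    also have "\<dots> \<le> C powr (1 / p) * real N powr (1 / 2 - 3 / p) * ell2_norm a"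
      using mass_le_ell2[OF a] ell2_norm_nonneg by (intro mult_left_mono real_le_lsqrt) auto
    finally show "Lp_norm_circle p (extension_op N \<phi> a) \<le> C powr (1 / p) * real N powr (1 / 2 - 3 / p) * ell2_norm a" .
  qed
qed

end
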